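(* Let $k$ be an algebraic number field and $S$ a finite set of places of $k$ containing all archimedean places, and suppose the group of $S$-units $O_S^{\times}$ has positive rank $r$ (so $|S| = r+1$). Let $\alpha_1, \alpha_2, \dots, \alpha_r$ be multiplicatively independent elements of the free abelian group $\mathfrak{U}_S(k) = O_S^{\times}/\mathrm{Tor}(O_S^{\times})$, and let $\mathfrak{A} \subseteq \mathfrak{U}_S(k)$ be the multiplicative subgroup generated by $\alpha_1, \dots, \alpha_r$. Then \[ \mathrm{Reg}_S(k)\,\bigl[\mathfrak{U}_S(k) : \mathfrak{A}\bigr] \le \prod_{j=1}^r \bigl([k:\mathbb{Q}]\, h(\alpha_j)\bigr). \]
   Context: For each place $v$ of $k$, $\|\cdot\|_v$ denotes the absolute value on $k$ extending the usual archimedean or $p$-adic absolute value on $\mathbb{Q}$, and $|\cdot|_v = \|\cdot\|_v^{d_v/d}$, where $d_v = [k_v:\mathbb{Q}_v]$ is the local degree and $d = [k:\mathbb{Q}]$. The (absolute logarithmic Weil) height of $\alpha \in k^{\times}$ is $h(\alpha) = \sum_v \log^+|\alpha|_v$, where $\log^+ x = \max(0,\log x)$; it is constant on cosets of the torsion subgroup, hence defined on $\mathfrak{U}_S(k)$. $O_S^{\times} = \{\gamma \in k^{\times} : |\gamma|_v = 1 \text{ for all } v \notin S\}$, and $\mathrm{Tor}(O_S^{\times})$ is its (finite) torsion subgroup, i.e. the roots of unity in $k$. The $S$-regulator is defined as follows: let $\eta_1, \dots, \eta_r$ be a basis of the free abelian group $\mathfrak{U}_S(k)$, fix $\hat v \in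 S$, and let $M^{(\hat v)}$ be the $r\times r$ real matrix $(d_v \log\|\eta_j\|_v)$ with rows indexed by $v \in S\setminus\{\hat v\}$ and columns by $j = 1,\dots,r$; then $\mathrm{Reg}_S(k) = |\det M^{(\hat v)}|$, which is independent of the choices. *)

theory Defs
  imports
    "HOL-Analysis.Infinite_Sum"
    "HOL-Computational_Algebra.Primes"
    "HOL-Algebra.Embedded_Algebras"
    "HOL-Algebra.QuotRing"
    "Jordan_Normal_Form.Determinant"
begin

section \<open>Number fields\<close>

text \<open>
  The number field \<open>k\<close> is the universe of a type \<open>'a\<close> of class \<^class>\<open>field_char_0\<close>, regarded as a
  vector space over \<^typ>\<open>rat\<close>.
\<close>

abbreviation rat_scale :: "rat \<Rightarrow> 'a \<Rightarrow> 'a::field_char_0" where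
  "rat_scale q x \<equiv> of_rat q * x"

definition number_field :: "'a::field_char_0 itself \<Rightarrow> bool" where
  "number_field (_ :: 'a itself) \<longleftrightarrow>
     (\<exists>B :: 'a set. finite_dimensional_vector_space rat_scale B)"

definition field_degree :: "'a::field_char_0 itself \<Rightarrow> nat" where
  "field_degree (_ :: 'a itself) = vector_space.dim rat_scale (UNIV :: 'a set)"


section \<open>Places\<close>

definition absolute_value :: "('a::field \<Rightarrow> real) \<Rightarrow> bool" where
  "absolute_value v \<longleftrightarrow>
     (\<forall>x. 0 \<le> v x) \<and> (\<forall>x. v x = 0 \<longleftrightarrow> x = 0) \<and>
     (\<forall>x y. v (x * y) = v x * v y) \<and> (\<forall>x y. v (x + y) \<le> v x + v y)"

definition padic_abs :: "nat \<Rightarrow> rat \<Rightarrow> real" where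
  "padic_abs p q =
     (if q = 0 then 0
      else real p powi (int (multiplicity (int p) (snd (quotient_of q)))
                      - int (multiplicity (int p) (fst (quotient_of q)))))"

definition archimedean_place :: "('a::field_char_0 \<Rightarrow> real) \<Rightarrow> bool" where
  "archimedean_place v \<longleftrightarrow> absolute_value v \<and> (\<forall>q. v (of_rat q) = \<bar>of_rat q\<bar>)"

definition nonarchimedean_place :: "('a::field_char_0 \<Rightarrow> real) \<Rightarrow> bool" where
  "nonarchimedean_place v \<longleftrightarrow>
     absolute_value v \<and> (\<exists>p. Factorial_Ring.prime p \<and> (\<forall>q. v (of_rat q) = padic_abs p q))"

text \<open>
  A place is represented by the unique absolute value in its equivalence class that extends the
  usual archimedean or a \<open>p\<close>-adic absolute value on \<open>\<rat>\<close>; that is, a place \<open>v\<close> is identified with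
  the function \<open>\<parallel>\<cdot>\<parallel>\<^sub>v\<close>.
\<close>

definition places :: "('a::field_char_0 \<Rightarrow> real) set" where
  "places = {v. archimedean_place v \<or> nonarchimedean_place v}"


section \<open>Completions and local degrees\<close>

definition cauchy_seqs :: "('a::field \<Rightarrow> real) \<Rightarrow> (nat \<Rightarrow> 'a) set" where
  "cauchy_seqs v = {x. \<forall>e>0. \<exists>N. \<forall>m\<ge>N. \<forall>n\<ge>N. v (x m - x n) < e}"

definition null_seqs :: "('a::field \<Rightarrow> real) \<Rightarrow> (nat \<Rightarrow> 'a) set" where
  "null_seqs v = {x. (\<lambda>n. v (x n)) \<longlonglongrightarrow> 0}"

definition cauchy_ring :: "('a::field \<Rightarrow> real) \<Rightarrow> (nat \<Rightarrow> 'a) ring" where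
  "cauchy_ring v =
     \<lparr>carrier = cauchy_seqs v,
      monoid.mult = (\<lambda>x y n. x n * y n), one = (\<lambda>_. 1),
      zero = (\<lambda>_. 0), add = (\<lambda>x y n. x n + y n)\<rparr>"

definition completion :: "('a::field \<Rightarrow> real) \<Rightarrow> (nat \<Rightarrow> 'a) set ring" where
  "completion v = cauchy_ring v Quot null_seqs v"

text \<open>\<open>\<rat>\<^sub>v\<close> as a subfield of \<open>k\<^sub>v\<close>: the classes of Cauchy sequences of rational numbers.\<close>

definition rat_completion :: "('a::field_char_0 \<Rightarrow> real) \<Rightarrow> (nat \<Rightarrow> 'a) set set" where
  "rat_completion v =
     {null_seqs v +>\<^bsub>cauchy_ring v\<^esub> x | x. x \<in> cauchy_seqs v \<and> range x \<subseteq> \<rat>}"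

definition local_degree :: "('a::field_char_0 \<Rightarrow> real) \<Rightarrow> nat" where
  "local_degree v =
     (ring.dim (completion v) over rat_completion v) (carrier (completion v))"

text \<open>The normalised absolute value \<open>|\<cdot>|\<^sub>v = \<parallel>\<cdot>\<parallel>\<^sub>v\<close> to the power \<open>d\<^sub>v / d\<close>.\<close>

definition normalized_abs :: "('a::field_char_0 \<Rightarrow> real) \<Rightarrow> 'a \<Rightarrow> real" where
  "normalized_abs v x = v x powr (real (local_degree v) / real (field_degree TYPE('a)))"


section \<open>Height\<close>

definition weil_height :: "'a::field_char_0 \<Rightarrow> real" where
  "weil_height x = (\<Sum>\<^sub>\<infinity>v\<in>places. max 0 (ln (normalized_abs v x)))"


section \<open>Multiplicative groups\<close>

definition torsion_subgroup :: "('g, 'b) monoid_scheme \<Rightarrow> 'g set" where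
  "torsion_subgroup G = {x \<in> carrier G. \<exists>n>0. x [^]\<^bsub>G\<^esub> (n::nat) = \<one>\<^bsub>G\<^esub>}"

definition mult_independent ::
  "('g, 'b) monoid_scheme \<Rightarrow> nat \<Rightarrow> (nat \<Rightarrow> 'g) \<Rightarrow> bool" where
  "mult_independent G r a \<longleftrightarrow>
     (\<forall>e :: nat \<Rightarrow> int.
        (\<Otimes>\<^bsub>G\<^esub>j\<in>{..<r}. a j [^]\<^bsub>G\<^esub> e j) = \<one>\<^bsub>G\<^esub> \<longrightarrow> (\<forall>j<r. e j = 0))"

definition free_basis :: "('g, 'b) monoid_scheme \<Rightarrow> nat \<Rightarrow> (nat \<Rightarrow> 'g) \<Rightarrow> bool" where
  "free_basis G r a \<longleftrightarrow>
     (\<forall>j<r. a j \<in> carrier G) \<and> mult_independent G r a \<and>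
     generate G (a ` {..<r}) = carrier G"

text \<open>The rank of a finitely generated abelian group is that of its free quotient by torsion.\<close>

definition has_rank :: "('g, 'b) monoid_scheme \<Rightarrow> nat \<Rightarrow> bool" where
  "has_rank G r \<longleftrightarrow> (\<exists>a. free_basis (G Mod torsion_subgroup G) r a)"

definition subgroup_index :: "('g, 'b) monoid_scheme \<Rightarrow> 'g set \<Rightarrow> nat" where
  "subgroup_index G H = card (rcosets\<^bsub>G\<^esub> H)"


section \<open>$S$-units and the $S$-regulator\<close>

definition S_units :: "('a::field_char_0 \<Rightarrow> real) set \<Rightarrow> 'a monoid" where
  "S_units S =
     \<lparr>carrier = {x. x \<noteq> 0 \<and> (\<forall>v \<in> places - S. normalized_abs v x = 1)},
      monoid.mult = (*), one = 1\<rparr>"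

definition free_S_units :: "('a::field_char_0 \<Rightarrow> real) set \<Rightarrow> 'a set monoid" where
  "free_S_units S = S_units S Mod torsion_subgroup (S_units S)"

text \<open>
  A function that is constant on cosets of the torsion subgroup descends to the quotient: the value
  at a coset is the unique element of the image of that coset.
\<close>

definition coset_value :: "('a \<Rightarrow> 'b) \<Rightarrow> 'a set \<Rightarrow> 'b" where
  "coset_value f c = the_elem (f ` c)"

definition height :: "'a::field_char_0 set \<Rightarrow> real" where
  "height = coset_value weil_height"

text \<open>
  In the following matrix the list \<open>vs\<close> enumerates the rows. For \<open>vs\<close> an enumeration of
  \<open>S - {w}\<close> and \<open>r\<close> the rank of the \<open>S\<close>-units it is square by Dirichlet's \<open>S\<close>-unit theorem.
\<close>

definition regulator_matrix ::
  "('a::field_char_0 \<Rightarrow> real) list \<Rightarrow> nat \<Rightarrow> (nat \<Rightarrow> 'a set) \<Rightarrow> real mat" where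
  "regulator_matrix vs r \<eta> =
     mat (length vs) r (\<lambda>(i, j). real (local_degree (vs ! i)) * ln (coset_value (vs ! i) (\<eta> j)))"

text \<open>The regulator does not depend on the basis \<open>\<eta>\<close>, the omitted place \<open>w\<close>, or the ordering \<open>vs\<close>.\<close>

definition S_regulator :: "('a::field_char_0 \<Rightarrow> real) set \<Rightarrow> real" where
  "S_regulator S =
     (SOME R. \<exists>r \<eta> w vs.
        free_basis (free_S_units S) r \<eta> \<and> w \<in> S \<and> distinct vs \<and> set vs = S - {w} \<and>
        R = \<bar>det (regulator_matrix vs r \<eta>)\<bar>)"

end

theory Submission
  imports Defs "Jordan_Normal_Form.Char_Poly"
begin

text \<open>
  If \<open>A\<close> expresses the \<open>\<alpha>\<^sub>j\<close> in a basis \<open>\<eta>\<close>, then the index is at most \<open>\<bar>det A\<bar>\<close> and the regulator times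
  \<open>\<bar>det A\<bar>\<close> is the absolute determinant of the matrix \<open>(d\<^sub>v log \<parallel>\<alpha>\<^sub>j\<parallel>\<^sub>v)\<close> with one place omitted. A column
  whose positive and negative parts both sum to at most \<open>h\<close> is \<open>h\<close> times a convex combination of columns
  of a directed incidence matrix, \<open>0\<close> included, and these matrices have determinant \<open>0\<close> or \<open>\<plusminus>1\<close>; hence the
  determinant is at most the product of the bounds \<open>h\<close>. By the product formula both parts of the
  column of \<open>\<alpha>\<^sub>j\<close> sum to at most \<open>[k:\<rat>] h(\<alpha>\<^sub>j)\<close>.

  The product formula reduces to \<open>\<Prod>\<^bsub>v|p\<^esub> \<parallel>x\<parallel>\<^sub>v\<^bsup>d\<^sub>v\<^esup> = \<bar>N x\<bar>\<^sub>p\<close>. Places above \<open>p\<close> exist as minimal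
  submultiplicative seminorms, and for every \<open>x\<close> some place has \<open>\<bar>N x\<bar>\<^sub>p \<le> \<parallel>x\<parallel>\<^sub>v\<^sup>n\<close>; with the trace form this makes
  \<open>max\<^sub>v \<parallel>\<cdot>\<parallel>\<^sub>v\<close> equivalent to a coordinate norm, so that the local degrees add up to \<open>n\<close>. In a basis of \<open>k\<close>
  adapted to the places by weak approximation, the determinant of multiplication by \<open>x\<^sup>m\<close> is
  \<open>O(\<Prod>\<^sub>v \<parallel>x\<parallel>\<^sub>v\<^bsup>m d\<^sub>v\<^esup>)\<close>; letting \<open>m \<rightarrow> \<infinity>\<close>, and using \<open>x\<^sup>-\<^sup>1\<close> as well, gives the identity.
\<close>

section \<open>Absolute values\<close>

text \<open>One argument serves archimedean and \<open>p\<close>-adic places: all that is assumed of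
  the rationals is an absolute value \<open>a\<close> with some value above 1. Only the triangle
  inequality is then available, so determinant estimates lose constants; comparing all powers of an
  element removes them. Local degrees refer to completions, whereas the estimates stay inside
  \<open>k\<close>: independence over the completed rationals becomes a uniform lower bound on
  rational combinations, and the completion is entered only to identify the two notions of degree.
  The set of places above \<open>a\<close> is not known to be finite in advance; this comes out of
  weak approximation, since finitely many places always have total degree at most \<open>n\<close>.
  Adapted bases exist only up to an error \<open>\<epsilon>\<close>, and the error at one place is
  governed by the coefficients at all places, so it is absorbed after summing over the places.
  \<open>S_regulator\<close> is a choice among bases, omitted places and enumerations, so the final
  estimate treats an arbitrary witness, including a non-square matrix, whose determinant is
  0.\<close>

context
  fixes v :: "'a::field \<Rightarrow> real"
  assumes v: "absolute_value v"
begin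

lemma absval_nonneg: "0 \<le> v x"
  and absval_eq_0: "v x = 0 \<longleftrightarrow> x = 0"
  and absval_mult: "v (x * y) = v x * v y"
  and absval_add: "v (x + y) \<le> v x + v y"
  using v by (auto simp: absolute_value_def)

lemma absval_pos: "x \<noteq> 0 \<Longrightarrow> 0 < v x"
  using absval_nonneg[of x] absval_eq_0[of x] by linarith

lemma absval_0: "v 0 = 0" by (simp add: absval_eq_0)

lemma absval_1: "v 1 = 1"
  using absval_mult[of 1 1] absval_eq_0[of 1] by simp

lemma absval_minus: "v (- x) = v x"
proof -
  have "v (-1) * v (-1) = 1" by (simp add: absval_1 flip: absval_mult)
  then have "v (-1) = 1"
    by (metis absval_nonneg abs_of_nonneg abs_square_eq_1 power2_eq_square)
  then show ?thesis using absval_mult[of "-1" x] by simp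
qed

lemma absval_diff: "v (x - y) \<le> v x + v y"
  using absval_add[of x "- y"] by (simp add: absval_minus)

lemma absval_diff_commute: "v (x - y) = v (y - x)"
  by (metis absval_minus minus_diff_eq)

lemma absval_power: "v (x ^ m) = v x ^ m"
  by (induction m) (simp_all add: absval_mult absval_1)

lemma absval_inverse: "v (inverse x) = inverse (v x)"
proof (cases "x = 0")
  case False
  then have "v x * v (inverse x) = 1" by (simp add: absval_1 flip: absval_mult)
  then show ?thesis by (simp add: inverse_unique)
qed (simp add: absval_0)

lemma absval_divide: "v (x / y) = v x / v y"
  by (simp add: divide_inverse absval_mult absval_inverse)

lemma absval_prod: "v (prod f A) = (\<Prod>i\<in>A. v (f i))"
  by (induction A rule: infinite_finite_induct) (simp_all add: absval_mult absval_1)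

lemma absval_sum_le: "v (sum f A) \<le> (\<Sum>i\<in>A. v (f i))"
proof (induction A rule: infinite_finite_induct)
  case (insert x F)
  then show ?case using absval_add[of "f x" "sum f F"] by simp
qed (simp_all add: absval_0)

lemma absval_of_nat_le: "v (of_nat m) \<le> real m"
proof (induction m)
  case (Suc m)
  then show ?case using absval_add[of 1 "of_nat m"] by (simp add: absval_1)
qed (simp add: absval_0)

text \<open>Leibniz expansion: each of the \<open>n!\<close> permutations picks one entry from every
  row, and signs have value 1 under \<open>v\<close>.\<close>

lemma absval_det_le:
  assumes A: "A \<in> carrier_mat n n"
    and R: "\<And>i j. i < n \<Longrightarrow> j < n \<Longrightarrow> v (A $$ (i, j)) \<le> R i"
  shows "v (det A) \<le> fact n * (\<Prod>i<n. R i)"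
proof -
  let ?P = "{p. p permutes {0..<n}}"
  have sg: "v (signof p) = 1" for p :: "nat \<Rightarrow> nat"
    by (cases p rule: sign_cases) (simp_all add: absval_1 absval_minus)
  have "v (det A) \<le> (\<Sum>p\<in>?P. v (signof p * (\<Prod>i = 0..<n. A $$ (i, p i))))"
    unfolding det_def'[OF A] by (rule absval_sum_le)
  also have "\<dots> = (\<Sum>p\<in>?P. \<Prod>i = 0..<n. v (A $$ (i, p i)))"
    by (simp add: absval_mult absval_prod sg)
  also have "\<dots> \<le> (\<Sum>p\<in>?P. \<Prod>i = 0..<n. R i)"
  proof (intro sum_mono prod_mono conjI)
    fix p i assume "p \<in> ?P" "i \<in> {0..<n}"
    then show "v (A $$ (i, p i)) \<le> R i"
      by (intro R) (auto simp: permutes_def dest: permutes_in_image)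
  qed (simp add: absval_nonneg)
  also have "\<dots> = fact n * (\<Prod>i<n. R i)"
    by (simp add: card_permutations[of _ n] lessThan_atLeast0)
  finally show ?thesis .
qed

end

section \<open>Existence of places\<close>

text \<open>
  Places above a given absolute value \<open>a\<close> of \<open>\<rat>\<close> are found as minimal elements of a class of
  submultiplicative seminorms, as in Berkovich's proof that the spectrum is nonempty.
\<close>

definition algebra_seminorm :: "(rat \<Rightarrow> real) \<Rightarrow> ('a::field_char_0 \<Rightarrow> real) \<Rightarrow> bool" where
  "algebra_seminorm a M \<longleftrightarrow>
     (\<forall>x. 0 \<le> M x) \<and> (\<forall>x y. M (x + y) \<le> M x + M y) \<and> (\<forall>x y. M (x * y) \<le> M x * M y) \<and>
     (\<forall>q x. M (of_rat q * x) = a q * M x) \<and> 1 \<le> M 1"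

definition places_over :: "(rat \<Rightarrow> real) \<Rightarrow> ('a::field_char_0 \<Rightarrow> real) set" where
  "places_over a = {v. absolute_value v \<and> (\<forall>q. v (of_rat q) = a q)}"

text \<open>Read \<open>F z s\<close> as saying that \<open>s\<close> is an admissible bound for
  \<open>z\<close>: taking infima turns closure of the bounds under the algebra operations into the
  seminorm axioms. Both constructions of smaller seminorms have this shape, with bounds forced by a
  prescribed value or supplied by the members of a chain.\<close>

lemma algebra_seminorm_Inf:
  fixes F :: "'a::field_char_0 \<Rightarrow> real \<Rightarrow> bool"
  assumes a: "absolute_value a"
    and ex: "\<And>z. \<exists>s. F z s" and nonneg: "\<And>z s. F z s \<Longrightarrow> 0 \<le> s"
    and add: "\<And>z s w u. F z s \<Longrightarrow> F w u \<Longrightarrow> F (z + w) (s + u)"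
    and mult: "\<And>z s w u. F z s \<Longrightarrow> F w u \<Longrightarrow> F (z * w) (s * u)"
    and scale: "\<And>z s q. F z s \<Longrightarrow> F (of_rat q * z) (a q * s)"
    and one: "\<And>s. F 1 s \<Longrightarrow> 1 \<le> s"
  defines "M \<equiv> \<lambda>z. Inf {s. F z s}"
  shows "algebra_seminorm a M \<and> (\<forall>z s. F z s \<longrightarrow> M z \<le> s)"
proof -
  have bdd: "bdd_below {s. F z s}" for z using nonneg by (intro bdd_belowI[of _ 0]) auto
  have ne: "{s. F z s} \<noteq> {}" for z using ex by simp
  have le: "M z \<le> s" if "F z s" for z s
    unfolding M_def using that bdd by (intro cInf_lower) auto
  have ge: "c \<le> M z" if "\<And>s. F z s \<Longrightarrow> c \<le> s" for z c
    unfolding M_def using that ne by (intro cInf_greatest) auto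
  have approx: "\<exists>s. F z s \<and> s < M z + e" if "0 < e" for z e
    using cInf_lessD[OF ne, of z "M z + e"] that unfolding M_def by auto
  \<comment> \<open>Closure under scaling gives only one inequality; scaling back by
    \<open>inverse q\<close> gives the other, and \<open>q = 0\<close> is separate because
    \<open>a q\<close> cannot be inverted.\<close>
  have scale_le: "M (of_rat q * z) \<le> a q * M z" if q: "q \<noteq> 0" for q z
  proof -
    have "M (of_rat q * z) / a q \<le> M z"
    proof (rule ge)
      fix s assume "F z s"
      then have "M (of_rat q * z) \<le> a q * s" using le scale by blast
      then show "M (of_rat q * z) / a q \<le> s"
        using absval_pos[OF a q] by (simp add: pos_divide_le_eq mult.commute)
    qed
    then show ?thesis using absval_pos[OF a q] by (simp add: pos_divide_le_eq mult.commute)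
  qed
  have M0: "0 \<le> M x" for x using ge nonneg by blast
  have "algebra_seminorm a M"
    unfolding algebra_seminorm_def
  proof (intro conjI allI)
    fix x w
    show "0 \<le> M x" by (rule M0)
    show "M (x + w) \<le> M x + M w"
    proof (rule field_le_epsilon)
      fix e :: real assume "0 < e"
      then obtain s u where "F x s" "s < M x + e / 2" "F w u" "u < M w + e / 2"
        using approx[of "e / 2"] by (metis half_gt_zero)
      then show "M (x + w) \<le> M x + M w + e" using le[OF add[of x s w u]] by force
    qed
    \<comment> \<open>The error of a product of two approximate bounds is not linear in
      \<open>e\<close>, hence the limit from the right.\<close>
    show "M (x * w) \<le> M x * M w"
    proof (rule tendsto_lowerbound)
      show "((\<lambda>e. (M x + e) * (M w + e)) \<longlongrightarrow> M x * M w) (at_right 0)"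
        by (auto intro!: tendsto_eq_intros)
      show "\<forall>\<^sub>F e in at_right 0. M (x * w) \<le> (M x + e) * (M w + e)"
        unfolding eventually_at_right_field
      proof (intro exI[of _ 1] conjI allI impI)
        fix e :: real assume "0 < e"
        then obtain s u where su: "F x s" "s < M x + e" "F w u" "u < M w + e"
          using approx by metis
        have "M (x * w) \<le> s * u" using le[OF mult[OF su(1,3)]] .
        also have "\<dots> \<le> (M x + e) * (M w + e)"
          using su nonneg[OF su(3)] M0[of x] \<open>0 < e\<close> by (intro mult_mono) auto
        finally show "M (x * w) \<le> (M x + e) * (M w + e)" .
      qed simp
    qed simp
    fix q :: rat
    show "M (of_rat q * x) = a q * M x"
    proof (cases "q = 0")
      case True
      obtain s where "F x s" using ex by blast
      then have "M 0 \<le> 0" using le[OF scale[of x s 0]] absval_0[OF a] by simp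
      then show ?thesis using True M0[of 0] absval_0[OF a] by simp
    next
      case False
      have "M x = M (of_rat (inverse q) * (of_rat q * x))"
        using False by (simp add: of_rat_inverse flip: mult.assoc)
      also have "\<dots> \<le> inverse (a q) * M (of_rat q * x)"
        using scale_le[of "inverse q" "of_rat q * x"] False by (simp add: absval_inverse[OF a])
      finally have "a q * M x \<le> M (of_rat q * x)"
        using absval_pos[OF a False] by (simp add: field_simps)
      then show ?thesis using scale_le[OF False, of x] by linarith
    qed
  next
    show "1 \<le> M 1" by (rule ge[OF one])
  qed
  then show ?thesis using le by blast
qed

text \<open>
  \<open>forced a M y t z s\<close> says that \<open>s\<close> bounds \<open>z\<close> in every seminorm \<open>M' \<le> M\<close> with \<open>M' y \<le> t\<close>.
\<close>

inductive forced :: "(rat \<Rightarrow> real) \<Rightarrow> ('a::field_char_0 \<Rightarrow> real) \<Rightarrow> 'a \<Rightarrow> real \<Rightarrow> 'a \<Rightarrow> real \<Rightarrow> bool"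
  for a M y t where
  base: "M z \<le> s \<Longrightarrow> forced a M y t z s"
| one: "forced a M y t 1 1"
| scale: "forced a M y t z s \<Longrightarrow> forced a M y t (of_rat q * z) (a q * s)"
| mult: "forced a M y t z s \<Longrightarrow> forced a M y t (z * y) (s * t)"
| add: "forced a M y t z s \<Longrightarrow> forced a M y t w u \<Longrightarrow> forced a M y t (z + w) (s + u)"

context
  fixes a :: "rat \<Rightarrow> real" and M :: "'a::field_char_0 \<Rightarrow> real"
  assumes a: "absolute_value a" and M: "algebra_seminorm a M"
begin

lemma seminorm_nonneg: "0 \<le> M x"
  and seminorm_add: "M (x + y) \<le> M x + M y"
  and seminorm_mult: "M (x * y) \<le> M x * M y"
  and seminorm_scale: "M (of_rat q * x) = a q * M x"
  and seminorm_1: "1 \<le> M 1"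
  using M by (auto simp: algebra_seminorm_def)

lemma forced_nonneg:
  assumes "0 \<le> t" "forced a M y t z s" shows "0 \<le> s"
  using assms(2)
proof induction
  case (base z s)
  then show ?case using seminorm_nonneg[of z] by linarith
qed (use assms(1) a in \<open>simp_all add: absval_nonneg\<close>)

text \<open>The rules multiply only by \<open>y\<close>, yet all products of bounds are derivable:
  induction on the second derivation peels off its rules until a bound of \<open>M\<close> remains,
  induction on the first does the same, and two bounds of \<open>M\<close> multiply by
  submultiplicativity.\<close>

lemma forced_product:
  assumes t: "0 \<le> t" and z: "forced a M y t z s" and w: "forced a M y t w u"
  shows "forced a M y t (z * w) (s * u)"
  using w
proof induction
  case (base w u)
  have u: "0 \<le> u" using base seminorm_nonneg[of w] by linarith
  show ?case
    using z
  proof induction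
    case (base z s)
    have s: "0 \<le> s" using base seminorm_nonneg[of z] by linarith
    have "M (z * w) \<le> M z * M w" by (rule seminorm_mult)
    also have "\<dots> \<le> s * u" using base \<open>M w \<le> u\<close> s by (intro mult_mono) (auto simp: seminorm_nonneg)
    finally show ?case by (rule forced.base)
  next
    case one
    then show ?case using base by (simp add: forced.base)
  next
    case (scale z s q)
    then show ?case using forced.scale[OF scale.IH, of q] by (simp add: mult.assoc)
  next
    case (mult z s)
    then show ?case using forced.mult[OF mult.IH] by (simp add: mult_ac)
  next
    case (add z s w' u')
    then show ?case using forced.add[OF add.IH] by (simp add: distrib_right)
  qed
next
  case one
  then show ?case using z by simp
next
  case (scale w u q)
  then show ?case using forced.scale[OF scale.IH, of q] by (simp add: mult_ac)
next
  case (mult w u)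
  then show ?case using forced.mult[OF mult.IH] by (simp add: mult_ac)
next
  case (add w u w' u')
  then show ?case using forced.add[OF add.IH] by (simp add: distrib_left)
qed

text \<open>A derivation uses \<open>inverse y\<close> finitely often, so a sufficiently high power
  \<open>y ^ m\<close> cancels all its occurrences. Each cancelled factor \<open>1 / t\<close> is
  paid for by one step of \<open>G\<close>, which grows at least by the factor
  \<open>t\<close>.\<close>

lemma forced_inverse_bound:
  assumes y: "y \<noteq> 0" and t: "0 < t"
    and G0: "\<And>m. M (y ^ m) \<le> G m" and G1: "\<And>m. t * G m \<le> G (Suc m)"
    and z: "forced a M (inverse y) (1 / t) z s"
  shows "\<exists>m0. \<forall>m\<ge>m0. M (z * y ^ m) \<le> s * G m"
  using z
proof induction
  case (base z s)
  have "M (z * y ^ m) \<le> s * G m" for m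
  proof -
    have "M (z * y ^ m) \<le> M z * M (y ^ m)" by (rule seminorm_mult)
    also have "\<dots> \<le> s * G m"
      using base G0[of m] by (intro mult_mono) (auto simp: seminorm_nonneg intro: order_trans[OF seminorm_nonneg])
    finally show ?thesis .
  qed
  then show ?case by blast
next
  case one
  then show ?case using G0 by auto
next
  case (scale z s q)
  then obtain m0 where "\<forall>m\<ge>m0. M (z * y ^ m) \<le> s * G m" by blast
  then have "\<forall>m\<ge>m0. M (of_rat q * z * y ^ m) \<le> a q * s * G m"
    using a by (auto simp: seminorm_scale mult.assoc absval_nonneg intro!: mult_left_mono)
  then show ?case by blast
next
  case (mult z s)
  then obtain m0 where m0: "\<forall>m\<ge>m0. M (z * y ^ m) \<le> s * G m" by blast
  have s: "0 \<le> s" using forced_nonneg[OF _ mult.hyps] t by simp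
  have "M (z * inverse y * y ^ m) \<le> s * (1 / t) * G m" if m: "m \<ge> Suc m0" for m
  proof -
    obtain k where k: "m = Suc k" "k \<ge> m0" using m Suc_le_D by blast
    have "M (z * inverse y * y ^ m) = M (z * y ^ k)" using k y by (simp add: field_simps)
    also have "\<dots> \<le> s * G k" using m0 k by blast
    also have "\<dots> \<le> s * (1 / t * G m)"
      using G1[of k] t s k by (intro mult_left_mono) (auto simp: field_simps)
    finally show ?thesis by (simp add: mult.assoc)
  qed
  then show ?case by blast
next
  case (add z s w u)
  then obtain m0 m1 where m0: "\<forall>m\<ge>m0. M (z * y ^ m) \<le> s * G m"
    and m1: "\<forall>m\<ge>m1. M (w * y ^ m) \<le> u * G m" by blast
  have "M ((z + w) * y ^ m) \<le> (s + u) * G m" if "m \<ge> max m0 m1" for m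
    using m0 m1 that seminorm_add[of "z * y ^ m" "w * y ^ m"]
    by (fastforce simp: distrib_right)
  then show ?case by blast
qed

text \<open>
  If the powers of \<open>y\<close> outgrow those of \<open>t\<close>, record values of \<open>M (y ^ m) / t ^ m\<close> show that the
  relation \<open>forced\<close> for \<open>inverse y\<close> and \<open>1 / t\<close> does not collapse.
\<close>

lemma seminorm_forcing:
  assumes y: "y \<noteq> 0" and t: "0 < t" and unbounded: "\<And>B. \<exists>m. B * t ^ m < M (y ^ m)"
  shows "\<exists>M'. algebra_seminorm a M' \<and> (\<forall>x. M' x \<le> M x) \<and> M' 1 = 1 \<and> M' (inverse y) \<le> 1 / t"
proof -
  let ?F = "forced a M (inverse y) (1 / t)"
  have t': "0 \<le> 1 / t" using t by simp
  have ge1: "1 \<le> s" if s: "?F 1 s" for s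
  proof -
    \<comment> \<open>\<open>G\<close> is the least majorant of \<open>M (y ^ m)\<close> that grows
      by at least the factor \<open>t\<close> in each step: \<open>t ^ m\<close> times the running
      maximum of \<open>g\<close>.\<close>
    define g where "g m = M (y ^ m) / t ^ m" for m
    define G where "G m = t ^ m * Max (g ` {..m})" for m
    have G0: "M (y ^ m) \<le> G m" for m
    proof -
      have "g m \<le> Max (g ` {..m})" by simp
      then have "t ^ m * g m \<le> G m" unfolding G_def using t by (intro mult_left_mono) auto
      then show ?thesis using t by (simp add: g_def)
    qed
    have G1: "t * G m \<le> G (Suc m)" for m
    proof -
      have "Max (g ` {..m}) \<le> Max (g ` {..Suc m})" by (intro Max_mono) auto
      then show ?thesis using t by (simp add: G_def field_simps)
    qed
    obtain m0 where m0: "\<And>m. m \<ge> m0 \<Longrightarrow> M (1 * y ^ m) \<le> s * G m"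
      using forced_inverse_bound[OF y t G0 G1 s] by blast
    obtain m1 where m1: "Max (g ` {..m0}) * t ^ m1 < M (y ^ m1)" using unbounded by blast
    then have m1': "Max (g ` {..m0}) < g m1" using t by (simp add: g_def field_simps)
    \<comment> \<open>The maximum of \<open>g\<close> on \<open>{..m1}\<close> is attained at
      \<open>m2\<close>, so \<open>m2\<close> is a record; it lies beyond \<open>m0\<close> because
      \<open>g m1\<close> exceeds all values up to \<open>m0\<close>. At a record
      \<open>G m2 = M (y ^ m2)\<close>, and the bound from the derivation leaves
      \<open>1 \<le> s\<close>.\<close>
    obtain m2 where m2: "m2 \<le> m1" "g m2 = Max (g ` {..m1})"
      using Max_in[of "g ` {..m1}"] by fastforce
    have "g m1 \<le> g m2" using m2 by simp
    have "m2 > m0"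
    proof (rule ccontr)
      assume "\<not> m2 > m0"
      then have "g m2 \<le> Max (g ` {..m0})" by simp
      then show False using m1' \<open>g m1 \<le> g m2\<close> by linarith
    qed
    have "Max (g ` {..m2}) \<le> g m2"
      unfolding m2(2) using m2(1) by (intro Max_mono) auto
    then have eq: "Max (g ` {..m2}) = g m2" by (intro antisym) auto
    have "0 \<le> g 0" by (simp add: g_def seminorm_nonneg)
    also have "g 0 \<le> Max (g ` {..m0})" by simp
    finally have pos: "0 < g m2" using m1' \<open>g m1 \<le> g m2\<close> by linarith
    have "M (y ^ m2) \<le> s * G m2" using m0[of m2] \<open>m2 > m0\<close> by simp
    also have "s * G m2 = s * g m2 * t ^ m2" by (simp only: G_def eq mult_ac)
    finally have "g m2 \<le> s * g m2" unfolding g_def using t by (simp add: field_simps)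
    then show ?thesis using pos by simp
  qed
  define M' where "M' z = Inf {s. ?F z s}" for z
  have "algebra_seminorm a M' \<and> (\<forall>z s. ?F z s \<longrightarrow> M' z \<le> s)"
    unfolding M'_def
  proof (rule algebra_seminorm_Inf[OF a])
    show "\<exists>s. ?F z s" for z using forced.base[of M z "M z"] by blast
  qed (rule forced_nonneg[OF t'] forced.add forced_product[OF t'] forced.scale ge1, assumption+)+
  then have M': "algebra_seminorm a M'" and le: "\<And>z s. ?F z s \<Longrightarrow> M' z \<le> s" by blast+
  have one: "M' 1 = 1"
    using le[OF forced.one] M' by (simp add: algebra_seminorm_def)
  have "M' x \<le> M x" for x by (rule le[OF forced.base]) simp
  moreover have "M' (inverse y) \<le> 1 / t" using le[OF forced.mult[OF forced.one]] by simp
  ultimately show ?thesis using one M' by blast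
qed

text \<open>By minimality the seminorm obtained by forcing is \<open>M\<close> itself, so
  \<open>M (inverse y) \<le> 1 / t\<close> whenever the powers of \<open>y\<close> outgrow those of
  \<open>t\<close>. Were \<open>M y * M (inverse y) > 1\<close>, some \<open>t\<close> would lie
  strictly between \<open>1 / M (inverse y)\<close> and \<open>M y\<close>. Either the powers of
  \<open>y\<close> outgrow those of \<open>t\<close>, or they are \<open>O(t ^ m)\<close> and the
  powers of \<open>inverse y\<close> outgrow those of \<open>1 / t2\<close> for some
  \<open>t < t2 < M y\<close>; forcing contradicts the choice of \<open>t\<close> or of
  \<open>t2\<close>. So the values of \<open>y\<close> and \<open>inverse y\<close> are inverse to
  each other, which gives multiplicativity.\<close>

lemma minimal_seminorm_is_place:
  assumes minimal: "\<And>M'. algebra_seminorm a M' \<Longrightarrow> (\<And>x. M' x \<le> M x) \<Longrightarrow> M' = M"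
  shows "M \<in> places_over a"
proof -
  have forcing: "M 1 = 1" "M (inverse y) \<le> 1 / t"
    if "y \<noteq> 0" "0 < t" "\<And>B. \<exists>m. B * t ^ m < M (y ^ m)" for y t
    using seminorm_forcing[OF that] minimal by metis+
  \<comment> \<open>The powers of 1 outgrow those of \<open>1 / 2\<close>, so forcing applies to
    \<open>y = 1\<close> and gives the normalisation.\<close>
  have one: "M 1 = 1"
  proof (rule forcing(1)[of 1 "1/2"])
    fix B :: real
    obtain m where "B < 2 ^ m" using real_arch_pow[of 2 B] by auto
    then have "B * (1 / 2) ^ m < 1" by (simp add: field_simps)
    then show "\<exists>m. B * (1 / 2) ^ m < M (1 ^ m)" using seminorm_1 by (auto intro: less_le_trans)
  qed auto
  have inv: "M y * M (inverse y) \<le> 1" if y: "y \<noteq> 0" for y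
  proof (rule ccontr)
    assume "\<not> M y * M (inverse y) \<le> 1"
    then have gt: "M y * M (inverse y) > 1" by simp
    have pos: "M y > 0" "M (inverse y) > 0"
      using gt seminorm_nonneg[of y] seminorm_nonneg[of "inverse y"]
      by (metis less_eq_real_def mult_zero_left mult_zero_right not_one_less_zero)+
    then have "1 / M (inverse y) < M y" using gt by (simp add: field_simps)
    then obtain t where t: "1 / M (inverse y) < t" "t < M y" using dense by blast
    obtain t2 where t2: "t < t2" "t2 < M y" using dense[OF t(2)] by blast
    have t0: "0 < t" using t(1) pos(2) by (meson less_trans zero_less_divide_1_iff)
    have "\<not> (\<forall>B. \<exists>m. B * t ^ m < M (y ^ m))"
    proof
      assume "\<forall>B. \<exists>m. B * t ^ m < M (y ^ m)"
      then have "M (inverse y) \<le> 1 / t" using forcing(2)[OF y t0] by blast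
      then show False using t(1) t0 pos by (simp add: field_simps)
    qed
    then obtain B where B: "\<And>m. M (y ^ m) \<le> B * t ^ m" by (force simp: not_less)
    have B0: "B > 0" using B[of 0] one by simp
    have "\<exists>m. C * (1 / t2) ^ m < M (inverse y ^ m)" for C
    proof -
      obtain m where m: "C * B < (t2 / t) ^ m"
        using real_arch_pow[of "t2 / t" "C * B"] t2 t0 by auto
      have "1 \<le> M (y ^ m) * M (inverse y ^ m)"
        using seminorm_mult[of "y ^ m" "inverse y ^ m"] y one by (simp flip: power_mult_distrib)
      also have "\<dots> \<le> B * t ^ m * M (inverse y ^ m)" using B by (intro mult_right_mono) (auto simp: seminorm_nonneg)
      finally have ge: "1 \<le> B * t ^ m * M (inverse y ^ m)" .
      have "C * B * (1 / t2) ^ m * t ^ m < 1"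
        using m t0 t2 by (simp add: field_simps)
      then have "B * t ^ m * (C * (1 / t2) ^ m) < B * t ^ m * M (inverse y ^ m)"
        using ge by (simp add: mult_ac)
      then have "C * (1 / t2) ^ m < M (inverse y ^ m)"
        using B0 t0 by (simp add: mult_less_cancel_left_pos)
      then show ?thesis by blast
    qed
    then have "M (inverse (inverse y)) \<le> 1 / (1 / t2)"
      using y t2 t0 by (intro forcing(2)) auto
    then show False using t2 by simp
  qed
  have pos: "0 < M y" if y: "y \<noteq> 0" for y
  proof -
    have "1 \<le> M y * M (inverse y)" using seminorm_mult[of y "inverse y"] y one by simp
    then show ?thesis using seminorm_nonneg[of y] by (cases "M y = 0") (auto simp: less_le)
  qed
  have zero: "M 0 = 0" using seminorm_scale[of 0 0] a by (simp add: absval_0)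
  have "M (y * z) = M y * M z" for y z
  proof (cases "y = 0")
    case False
    have "M y * M z = M y * M (inverse y * (y * z))" using False by (simp flip: mult.assoc)
    also have "\<dots> \<le> M y * (M (inverse y) * M (y * z))"
      by (intro mult_left_mono seminorm_mult seminorm_nonneg)
    also have "\<dots> \<le> 1 * M (y * z)"
      unfolding mult.assoc[symmetric] using inv[OF False] by (intro mult_right_mono) (auto simp: seminorm_nonneg)
    finally show ?thesis using seminorm_mult[of y z] by simp
  qed (simp add: zero)
  moreover have "M (of_rat q) = a q" for q using seminorm_scale[of q 1] one by simp
  moreover have "M x = 0 \<longleftrightarrow> x = 0" for x by (metis pos zero less_irrefl)
  ultimately show ?thesis
    using seminorm_add seminorm_nonneg by (simp add: places_over_def absolute_value_def)
qed

end

text \<open>A minimal element among the seminorms below \<open>M\<close> is minimal among all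
  seminorms, because anything below it is below \<open>M\<close> too. Zorn's lemma is applied to the
  reversed pointwise order, a nonempty chain being bounded by its infimum.\<close>

lemma place_below_seminorm:
  fixes M :: "'a::field_char_0 \<Rightarrow> real"
  assumes a: "absolute_value a" and M: "algebra_seminorm a M"
  shows "\<exists>v \<in> places_over a. \<forall>x. v x \<le> M x"
proof -
  define A where "A = {N. algebra_seminorm a N \<and> (\<forall>x::'a. N x \<le> M x)}"
  define P where "P N N' = (\<forall>x. N' x \<le> N x)" for N N' :: "'a \<Rightarrow> real"
  have P: "partial_order_on A (relation_of P A)"
  proof (rule partial_order_on_relation_ofI)
    show "P N N''" if "P N N'" "P N' N''" for N N' N''
      using that unfolding P_def by (meson order_trans)
    show "N = N'" if "P N N'" "P N' N" for N N'
      using that unfolding P_def by (intro ext antisym) auto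
  qed (simp add: P_def)
  have "\<exists>m\<in>A. \<forall>N\<in>A. P m N \<longrightarrow> N = m"
  proof (rule predicate_Zorn[OF P])
    fix C assume C: "C \<in> Chains (relation_of P A)"
    then have CA: "C \<subseteq> A" and chain: "\<And>N N'. N \<in> C \<Longrightarrow> N' \<in> C \<Longrightarrow> P N N' \<or> P N' N"
      by (auto simp: Chains_def relation_of_def)
    show "\<exists>u\<in>A. \<forall>N\<in>C. P N u"
    proof (cases "C = {}")
      case True
      then show ?thesis using M by (auto simp: A_def)
    next
      case False
      have asn: "algebra_seminorm a N" if "N \<in> C" for N using that CA by (auto simp: A_def)
      define F where "F z s \<longleftrightarrow> (\<exists>N\<in>C. N z \<le> s)" for z s
      define u where "u z = Inf {s. F z s}" for z
      \<comment> \<open>In a chain one member realises both bounds at once, so the infimum inherits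
        the inequalities that involve two elements.\<close>
      have F2: "\<exists>N\<in>C. N z \<le> s \<and> N w \<le> t" if F: "F z s" "F w t" for z w s t
      proof -
        obtain N N' where "N \<in> C" "N z \<le> s" "N' \<in> C" "N' w \<le> t" using F by (auto simp: F_def)
        then show ?thesis using chain[of N N'] unfolding P_def by (meson order_trans)
      qed
      have inf: "algebra_seminorm a u \<and> (\<forall>z s. F z s \<longrightarrow> u z \<le> s)"
        unfolding u_def
      proof (rule algebra_seminorm_Inf[OF a])
        show "\<exists>s. F z s" for z using False by (auto simp: F_def)
        show "0 \<le> s" if "F z s" for z s
          using that seminorm_nonneg[OF a asn] by (auto simp: F_def intro: order_trans)
        show "F (z + w) (s + t)" if F: "F z s" "F w t" for z s w t
        proof -
          obtain N where N: "N \<in> C" "N z \<le> s" "N w \<le> t" using F2[OF F] by blast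
          then have "N (z + w) \<le> s + t" using seminorm_add[OF a asn[OF N(1)], of z w] by linarith
          then show ?thesis using N(1) unfolding F_def by blast
        qed
        show "F (z * w) (s * t)" if F: "F z s" "F w t" for z s w t
        proof -
          obtain N where N: "N \<in> C" "N z \<le> s" "N w \<le> t" using F2[OF F] by blast
          note nn = seminorm_nonneg[OF a asn[OF N(1)]]
          have "N (z * w) \<le> N z * N w" by (rule seminorm_mult[OF a asn[OF N(1)]])
          also have "\<dots> \<le> s * t" using N nn[of w] order_trans[OF nn N(2)] by (intro mult_mono) auto
          finally show ?thesis using N(1) unfolding F_def by blast
        qed
        show "F (of_rat q * z) (a q * s)" if F: "F z s" for z s q
        proof -
          obtain N where N: "N \<in> C" "N z \<le> s" using F by (auto simp: F_def)
          have "N (of_rat q * z) \<le> a q * s"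
            unfolding seminorm_scale[OF a asn[OF N(1)]] by (intro mult_left_mono N(2) absval_nonneg[OF a])
          then show ?thesis using N(1) unfolding F_def by blast
        qed
        show "1 \<le> s" if "F 1 s" for s
          using that seminorm_1[OF a asn] by (auto simp: F_def intro: order_trans)
      qed
      then have le: "F z s \<Longrightarrow> u z \<le> s" for z s by blast
      note inf[THEN conjunct1]
      moreover have "u x \<le> M x" for x
      proof -
        obtain N where "N \<in> C" using False by blast
        then have "F x (N x)" "N x \<le> M x" using CA by (auto simp: F_def A_def)
        then show ?thesis using le[of x "N x"] by linarith
      qed
      ultimately have "u \<in> A" by (simp add: A_def)
      then show ?thesis using le by (auto simp: P_def F_def)
    qed
  qed
  then obtain v where v: "v \<in> A" "\<And>N. N \<in> A \<Longrightarrow> P v N \<Longrightarrow> N = v" by blast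
  have "v \<in> places_over a"
  proof (rule minimal_seminorm_is_place[OF a])
    show "algebra_seminorm a v" using v(1) by (simp add: A_def)
    fix N assume N: "algebra_seminorm a N" "\<And>x. N x \<le> v x"
    have "N \<in> A" using N v(1) by (auto simp: A_def intro: order_trans)
    then show "N = v" using v(2) N(2) by (simp add: P_def)
  qed
  then show ?thesis using v(1) by (auto simp: A_def)
qed

section \<open>Linear algebra\<close>

text \<open>The system is padded with zero rows to a square one, and \<open>n < k\<close> makes the
  last row zero. Integral domains are allowed since relations are wanted for rational coordinates
  and for integer exponents alike.\<close>

lemma exists_nontrivial_kernel:
  fixes C :: "nat \<Rightarrow> nat \<Rightarrow> 'r::idom"
  assumes nk: "n < k"
  shows "\<exists>q. (\<exists>j<k. q j \<noteq> 0) \<and> (\<forall>i<n. (\<Sum>j<k. C i j * q j) = 0)"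
proof -
  define A where "A = mat k k (\<lambda>(i, j). if i < n then C i j else 0)"
  have A: "A \<in> carrier_mat k k" by (simp add: A_def)
  have "A = mat\<^sub>r k k (\<lambda>i. if i = k - 1 then 0\<^sub>v k else row A i)"
    using nk by (intro eq_matI) (auto simp: A_def)
  also have "det \<dots> = 0" using nk A by (intro det_row_0) auto
  finally obtain q where q: "q \<in> carrier_vec k" "q \<noteq> 0\<^sub>v k" "A *\<^sub>v q = 0\<^sub>v k"
    using det_0_iff_vec_prod_zero[OF A] by auto
  have "(\<Sum>j<k. C i j * q $ j) = 0" if i: "i < n" for i
  proof -
    have "(A *\<^sub>v q) $ i = 0" using q i nk by simp
    then show ?thesis using i nk q by (simp add: A_def scalar_prod_def atLeast0LessThan)
  qed
  moreover have "\<exists>j<k. q $ j \<noteq> 0"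
    using q(1,2) by (metis carrier_vecD eq_vecI index_zero_vec(1) index_zero_vec(2))
  ultimately show ?thesis by blast
qed

lemma trivial_kernel_imp_det_nonzero:
  fixes C :: "nat \<Rightarrow> nat \<Rightarrow> 'r::idom"
  assumes "\<And>q. (\<And>i. i < n \<Longrightarrow> (\<Sum>j<n. C i j * q j) = 0) \<Longrightarrow> \<forall>j<n. q j = 0"
  shows "det (mat n n (\<lambda>(i, j). C i j)) \<noteq> 0"
proof
  let ?A = "mat n n (\<lambda>(i, j). C i j)"
  assume "det ?A = 0"
  then obtain q where q: "q \<in> carrier_vec n" "q \<noteq> 0\<^sub>v n" "?A *\<^sub>v q = 0\<^sub>v n"
    using det_0_iff_vec_prod_zero[of ?A n] by auto
  have "(\<Sum>j<n. C i j * q $ j) = 0" if i: "i < n" for i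
  proof -
    have "(?A *\<^sub>v q) $ i = 0" using q i by simp
    then show ?thesis using i q(1) by (simp add: scalar_prod_def atLeast0LessThan)
  qed
  then have "\<forall>j<n. q $ j = 0" using assms by blast
  then show False using q(1,2) by (metis carrier_vecD eq_vecI index_zero_vec(1) index_zero_vec(2))
qed

text \<open>The derivative of the characteristic polynomial is the sum of those of the principal
  submatrices \<open>mat_delete A i i\<close>. Comparing coefficients expresses the wanted one,
  times the size minus one, through their traces; characteristic 0 permits cancelling that
  factor.\<close>

lemma coeff_char_poly_trace:
  fixes A :: "'r::{idom, ring_char_0} mat"
  assumes "A \<in> carrier_mat (Suc n) (Suc n)"
  shows "coeff (char_poly A) n = - (\<Sum>i<Suc n. A $$ (i, i))"
  using assms
proof (induction n arbitrary: A)
  case 0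
  have "char_poly A = [: - A $$ (0, 0), 1:]"
    using 0 by (subst char_poly_def, subst det_single) (auto simp: char_poly_matrix_def)
  then show ?case by simp
next
  case (Suc n)
  have del: "mat_delete A i i \<in> carrier_mat (Suc n) (Suc n)" for i
    using Suc.prems mat_delete_carrier[OF Suc.prems] by simp
  have tr: "(\<Sum>k<Suc n. mat_delete A i i $$ (k, k)) = (\<Sum>k<Suc (Suc n). A $$ (k, k)) - A $$ (i, i)"
    if i: "i < Suc (Suc n)" for i
  proof -
    have "(\<Sum>k<Suc n. mat_delete A i i $$ (k, k)) = (\<Sum>k<Suc n. A $$ (insert_index i k, insert_index i k))"
      using i Suc.prems mat_delete_index[OF Suc.prems i i] by (intro sum.cong) auto
    also have "\<dots> = (\<Sum>k\<in>insert_index i ` {..<Suc n}. A $$ (k, k))"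
      by (subst sum.reindex) (auto simp: insert_index_inj_on)
    also have "insert_index i ` {..<Suc n} = {..<Suc (Suc n)} - {i}"
      using insert_index_image[OF i] by (simp add: lessThan_atLeast0)
    finally show ?thesis using i by (simp add: sum_diff1)
  qed
  have "of_nat (Suc n) * coeff (char_poly A) (Suc n) = coeff (pderiv (char_poly A)) n"
    by (simp add: coeff_pderiv)
  also have "\<dots> = (\<Sum>i<Suc (Suc n). coeff (char_poly (mat_delete A i i)) n)"
    unfolding pderiv_char_poly[OF Suc.prems] by (simp add: coeff_sum)
  also have "\<dots> = (\<Sum>i<Suc (Suc n). A $$ (i, i) - (\<Sum>k<Suc (Suc n). A $$ (k, k)))"
    by (intro sum.cong refl, subst Suc.IH[OF del], subst tr) auto
  also have "\<dots> = of_nat (Suc n) * (- (\<Sum>k<Suc (Suc n). A $$ (k, k)))"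
    unfolding sum_subtractf by (simp add: algebra_simps)
  finally show ?case by (simp only: mult_cancel_left of_nat_eq_0_iff) simp
qed

text \<open>Interpolation at \<open>0, ..., d\<close> in a form valid for any absolute value:
  \<open>C\<close> depends on \<open>a\<close> and \<open>d\<close> only. Splitting off the last
  node \<open>r\<close> by \<open>P = (X - r) * Q + P(r)\<close> leaves a quotient of smaller degree
  whose values at the other nodes are divided differences.\<close>

lemma poly_coeff_bound_by_values:
  assumes a: "absolute_value (a :: rat \<Rightarrow> real)"
  shows "\<exists>C. \<forall>P B. degree P \<le> d \<longrightarrow> (\<forall>i\<le>d. a (poly P (of_nat i)) \<le> B) \<longrightarrow>
            (\<forall>k. a (coeff P k) \<le> C * B)"
proof (induction d)
  case 0
  show ?case
  proof (intro exI[of _ 1] allI impI)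
    fix P :: "rat poly" and B k
    assume P: "degree P \<le> 0" and B: "\<forall>i\<le>0. a (poly P (of_nat i)) \<le> B"
    obtain c where c: "P = [:c:]" using P by (metis degree_0_id le_zero_eq)
    then have "a c \<le> B" using B by simp
    moreover have "0 \<le> B" using calculation absval_nonneg[OF a, of c] by linarith
    ultimately show "a (coeff P k) \<le> 1 * B" by (cases k) (simp_all add: c absval_0[OF a])
  qed
next
  case (Suc d)
  then obtain C where C: "\<And>P B k. degree P \<le> d \<Longrightarrow> (\<And>i. i \<le> d \<Longrightarrow> a (poly P (of_nat i)) \<le> B) \<Longrightarrow>
      a (coeff P k) \<le> C * B" by blast
  define r :: rat where "r = of_nat (Suc d)"
  \<comment> \<open>Differences of nodes may be \<open>p\<close>-adically small, so their inverses
    need not be bounded by 1; \<open>m\<close> bounds them.\<close>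
  define m where "m = Max ((\<lambda>i. inverse (a (of_nat i - r))) ` {..d})"
  have m: "inverse (a (of_nat i - r)) \<le> m" if "i \<le> d" for i
    unfolding m_def using that by (intro Max_ge) auto
  have m0: "0 \<le> m" using m[of 0] absval_nonneg[OF a] by (meson inverse_nonnegative_iff_nonnegative order_trans zero_le)
  show ?case
  proof (intro exI allI impI)
    fix P :: "rat poly" and B k
    assume P: "degree P \<le> Suc d" and B: "\<forall>i\<le>Suc d. a (poly P (of_nat i)) \<le> B"
    define Q where "Q = synthetic_div P r"
    have dQ: "degree Q \<le> d" using P by (simp add: Q_def degree_synthetic_div)
    have PQ: "P = [:-r, 1:] * Q + [:poly P r:]"
      using synthetic_div_correct'[of r P] by (simp add: Q_def)
    have Pr: "a (poly P r) \<le> B" using B unfolding r_def by blast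
    then have B0: "0 \<le> B" using absval_nonneg[OF a, of "poly P r"] by linarith
    have "a (poly Q (of_nat i)) \<le> 2 * m * B" if i: "i \<le> d" for i
    proof -
      have ne: "of_nat i - r \<noteq> 0"
        using i unfolding r_def by (simp del: of_nat_Suc)
      have "poly P (of_nat i) = (of_nat i - r) * poly Q (of_nat i) + poly P r"
        by (subst PQ) (simp add: algebra_simps)
      then have "poly Q (of_nat i) = (poly P (of_nat i) - poly P r) / (of_nat i - r)"
        using ne by (simp add: field_simps)
      then have "a (poly Q (of_nat i)) = a (poly P (of_nat i) - poly P r) * inverse (a (of_nat i - r))"
        by (simp add: divide_inverse absval_mult[OF a] absval_inverse[OF a])
      also have "\<dots> \<le> (B + B) * m"
      proof (intro mult_mono m i)
        have "a (poly P (of_nat i)) \<le> B" using B i by simp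
        then show "a (poly P (of_nat i) - poly P r) \<le> B + B"
          using absval_diff[OF a, of "poly P (of_nat i)" "poly P r"] Pr by linarith
      qed (use B0 in \<open>simp_all add: absval_nonneg[OF a]\<close>)
      finally show ?thesis by (simp add: algebra_simps)
    qed
    then have Q: "a (coeff Q j) \<le> C * (2 * m * B)" for j by (intro C dQ)
    define u where "u = (if k = 0 then 0 else coeff Q (k - 1))"
    define w where "w = (if k = 0 then poly P r else 0)"
    have "coeff P k = u - r * coeff Q k + w"
      by (subst PQ) (cases k; simp add: u_def w_def algebra_simps)
    then have "a (coeff P k) \<le> a u + a r * a (coeff Q k) + a w"
      using absval_add[OF a, of "u - r * coeff Q k" w] absval_diff[OF a, of u "r * coeff Q k"]
      by (simp add: absval_mult[OF a])
    also have "\<dots> \<le> C * (2 * m * B) + a r * (C * (2 * m * B)) + B"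
    proof (intro add_mono mult_left_mono Q)
      show "a u \<le> C * (2 * m * B)"
        using Q[of "k - 1"] order_trans[OF absval_nonneg[OF a] Q[of 0]]
        by (simp add: u_def absval_0[OF a])
      show "a w \<le> B" using Pr B0 by (simp add: w_def absval_0[OF a])
    qed (simp add: absval_nonneg[OF a])
    finally show "a (coeff P k) \<le> (C * 2 * m + a r * C * 2 * m + 1) * B" by (simp add: algebra_simps)
  qed
qed

section \<open>Coordinates, norm and trace of the field over the rationals\<close>

locale rat_basis =
  fixes n :: nat and b :: "nat \<Rightarrow> 'a::field_char_0" and coord :: "nat \<Rightarrow> 'a \<Rightarrow> rat"
  assumes expand: "(\<Sum>i<n. of_rat (coord i x) * b i) = x"
    and coord_eqI: "(\<Sum>i<n. of_rat (c i) * b i) = x \<Longrightarrow> i < n \<Longrightarrow> coord i x = c i"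
begin

lemma coord_add: "i < n \<Longrightarrow> coord i (x + y) = coord i x + coord i y"
  by (rule coord_eqI) (simp_all add: of_rat_add distrib_right sum.distrib expand)

lemma coord_scale: "i < n \<Longrightarrow> coord i (of_rat q * x) = q * coord i x"
  by (rule coord_eqI) (simp_all add: of_rat_mult mult.assoc expand flip: sum_distrib_left)

lemma coord_scale_right: "i < n \<Longrightarrow> coord i (x * of_rat q) = coord i x * q"
  using coord_scale[of i q x] by (simp add: mult.commute)

lemma coord_0: "i < n \<Longrightarrow> coord i 0 = 0"
  by (rule coord_eqI) simp_all

lemma coord_sum: "i < n \<Longrightarrow> coord i (sum f A) = (\<Sum>j\<in>A. coord i (f j))"
  by (induction A rule: infinite_finite_induct) (simp_all add: coord_add coord_0)

lemma coord_b: "i < n \<Longrightarrow> j < n \<Longrightarrow> coord i (b j) = (if i = j then 1 else 0)"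
  by (rule coord_eqI) (simp_all add: if_distrib if_distribR sum.delta cong: if_cong)

lemma eqI: "(\<And>i. i < n \<Longrightarrow> coord i x = coord i y) \<Longrightarrow> x = y"
  by (subst (1 2) expand[symmetric]) (intro sum.cong, auto)

lemma dim_pos: "0 < n"
  using expand[of 1] by (cases n) auto

definition mult_mat :: "'a \<Rightarrow> rat mat" where
  "mult_mat x = mat n n (\<lambda>(i, j). coord i (x * b j))"

definition field_norm :: "'a \<Rightarrow> rat" where
  "field_norm x = det (mult_mat x)"

definition field_trace :: "'a \<Rightarrow> rat" where
  "field_trace x = (\<Sum>i<n. coord i (x * b i))"

lemma mult_mat_carrier [simp]: "mult_mat x \<in> carrier_mat n n"
  by (simp add: mult_mat_def)

lemma coord_mult: "i < n \<Longrightarrow> coord i (x * y) = (\<Sum>j<n. coord i (x * b j) * coord j y)"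
proof -
  assume i: "i < n"
  have "coord i (x * y) = coord i (\<Sum>j<n. of_rat (coord j y) * (x * b j))"
    by (subst expand[of y, symmetric]) (simp add: sum_distrib_left mult_ac)
  then show ?thesis using i by (simp add: coord_sum coord_scale coord_scale_right mult.commute)
qed

lemma mult_mat_mult: "mult_mat (x * y) = mult_mat x * mult_mat y"
proof (rule eq_matI)
  fix i j assume "i < dim_row (mult_mat x * mult_mat y)" "j < dim_col (mult_mat x * mult_mat y)"
  then have ij: "i < n" "j < n" by (simp_all add: mult_mat_def)
  then show "mult_mat (x * y) $$ (i, j) = (mult_mat x * mult_mat y) $$ (i, j)"
    using coord_mult[OF ij(1), of x "y * b j"]
    by (simp add: mult_mat_def scalar_prod_def atLeast0LessThan mult.assoc)
qed (simp_all add: mult_mat_def)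

lemma field_norm_mult: "field_norm (x * y) = field_norm x * field_norm y"
  unfolding field_norm_def mult_mat_mult by (rule det_mult[of _ n]) auto

lemma mult_mat_1: "mult_mat 1 = 1\<^sub>m n"
  by (intro eq_matI) (auto simp: mult_mat_def coord_b)

lemma field_norm_1: "field_norm 1 = 1"
  by (simp add: field_norm_def mult_mat_1)

lemma field_norm_power: "field_norm (x ^ m) = field_norm x ^ m"
  by (induction m) (simp_all add: field_norm_1 field_norm_mult)

lemma field_norm_inverse: "x \<noteq> 0 \<Longrightarrow> field_norm x * field_norm (inverse x) = 1"
  by (simp add: field_norm_1 flip: field_norm_mult)

lemma field_trace_add: "field_trace (x + y) = field_trace x + field_trace y"
  by (simp add: field_trace_def distrib_right coord_add sum.distrib)

lemma field_trace_scale: "field_trace (of_rat q * x) = q * field_trace x"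
  by (simp add: field_trace_def mult.assoc coord_scale sum_distrib_left)

lemma field_trace_sum: "field_trace (sum f A) = (\<Sum>j\<in>A. field_trace (f j))"
  by (induction A rule: infinite_finite_induct)
    (simp_all add: field_trace_add field_trace_scale[of 0 0, simplified])

lemma field_trace_1: "field_trace 1 = of_nat n"
  by (simp add: field_trace_def coord_b)

text \<open>\<open>P\<close> is the characteristic polynomial of \<open>- mult_mat x\<close>: the
  sign turns its value at \<open>q\<close> into the determinant of multiplication by
  \<open>q + x\<close>, and its coefficient of index \<open>n - 1\<close> into the trace
  itself.\<close>

lemma field_norm_shift_poly:
  obtains P where "degree P \<le> n" "coeff P (n - 1) = field_trace x"
    "\<And>q. poly P q = field_norm (of_rat q + x)"
proof
  let ?A = "- mult_mat x"
  have A: "?A \<in> carrier_mat n n" by simp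
  show "degree (char_poly ?A) \<le> n" using degree_monic_char_poly[OF A] by simp
  have "coeff (char_poly ?A) (n - 1) = - (\<Sum>i<n. ?A $$ (i, i))"
    using coeff_char_poly_trace[of ?A "n - 1"] A dim_pos by simp
  also have "\<dots> = field_trace x"
    by (simp add: field_trace_def sum_negf mult_mat_def)
  finally show "coeff (char_poly ?A) (n - 1) = field_trace x" .
  show "poly (char_poly ?A) q = field_norm (of_rat q + x)" for q
  proof -
    have "poly (char_poly ?A) q = det (- (char_matrix ?A q))" by (rule char_poly_matrix[OF A])
    also have "- (char_matrix ?A q) = mult_mat (of_rat q + x)"
      by (intro eq_matI) (auto simp: char_matrix_def mult_mat_def distrib_right coord_add coord_scale coord_b)
    finally show ?thesis by (simp add: field_norm_def)
  qed
qed

text \<open>The trace form is nondegenerate since \<open>field_trace 1 = n \<noteq> 0\<close>.\<close>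

lemma coord_eq_trace_combination:
  obtains W where "\<And>x j. j < n \<Longrightarrow> coord j x = (\<Sum>i<n. W j i * field_trace (b i * x))"
proof -
  define T where "T = mat n n (\<lambda>(i, j). field_trace (b i * b j))"
  have T: "T \<in> carrier_mat n n" by (simp add: T_def)
  have tr: "field_trace (b i * (\<Sum>j<n. of_rat (q j) * b j)) = (\<Sum>j<n. field_trace (b i * b j) * q j)" for i q
  proof -
    have "b i * (\<Sum>j<n. of_rat (q j) * b j) = (\<Sum>j<n. of_rat (q j) * (b i * b j))"
      by (simp add: sum_distrib_left mult_ac)
    then show ?thesis by (simp add: field_trace_sum field_trace_scale mult.commute)
  qed
  have "det T \<noteq> 0"
    unfolding T_def
  proof (rule trivial_kernel_imp_det_nonzero)
    fix q assume q: "\<And>i. i < n \<Longrightarrow> (\<Sum>j<n. field_trace (b i * b j) * q j) = 0"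
    define x where "x = (\<Sum>j<n. of_rat (q j) * b j)"
    have "x = 0"
    proof (rule ccontr)
      assume "x \<noteq> 0"
      have "of_nat n = field_trace (inverse x * x)" using \<open>x \<noteq> 0\<close> by (simp add: field_trace_1)
      also have "\<dots> = field_trace (\<Sum>i<n. of_rat (coord i (inverse x)) * (b i * x))"
        by (subst expand[of "inverse x", symmetric]) (simp add: sum_distrib_right mult.assoc)
      also have "\<dots> = 0"
        using q tr by (simp add: field_trace_sum field_trace_scale x_def)
      finally show False using dim_pos by simp
    qed
    then show "\<forall>j<n. q j = 0"
      using coord_eqI[of q 0] coord_0 by (metis x_def)
  qed
  \<comment> \<open>A left inverse of the Gram matrix of the trace form recovers the coordinates of
    \<open>x\<close> from the traces of \<open>b i * x\<close>; its entries serve as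
    \<open>W\<close>.\<close>
  from det_non_zero_imp_unit[OF T this, of "()"] obtain U
    where U: "U \<in> carrier_mat n n" "U * T = 1\<^sub>m n"
    by (auto simp: Units_def ring_mat_def)
  have "coord j x = (\<Sum>i<n. U $$ (j, i) * field_trace (b i * x))" if j: "j < n" for x j
  proof -
    define q where "q = vec n (\<lambda>j. coord j x)"
    have q: "q \<in> carrier_vec n" by (simp add: q_def)
    have "T *\<^sub>v q = vec n (\<lambda>i. field_trace (b i * x))"
      using tr[of _ "\<lambda>j. coord j x"]
      by (intro eq_vecI) (auto simp: T_def q_def scalar_prod_def atLeast0LessThan expand)
    moreover have "U *\<^sub>v (T *\<^sub>v q) = q"
      using U T q by (simp flip: assoc_mult_mat_vec)
    ultimately have "(U *\<^sub>v vec n (\<lambda>i. field_trace (b i * x))) $ j = q $ j" by simp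
    then show ?thesis using j U by (simp add: q_def scalar_prod_def atLeast0LessThan)
  qed
  then show thesis by (rule that[of "\<lambda>j i. U $$ (j, i)"])
qed

lemma exists_linear_relation:
  fixes f :: "nat \<Rightarrow> 'a"
  assumes "n < k"
  obtains q where "\<exists>j<k. q j \<noteq> 0" "(\<Sum>j<k. of_rat (q j) * f j) = 0"
proof -
  obtain q where q: "\<exists>j<k. q j \<noteq> 0" "\<forall>i<n. (\<Sum>j<k. coord i (f j) * q j) = 0"
    using exists_nontrivial_kernel[OF assms, of "\<lambda>i j. coord i (f j)"] by blast
  have "(\<Sum>j<k. of_rat (q j) * f j) = 0"
    using q(2) by (intro eqI) (simp add: coord_sum coord_scale coord_scale_right coord_0 mult.commute)
  then show thesis using that q by blast
qed

text \<open>Independence suffices by dimension: \<open>x\<close> together with the \<open>n\<close>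
  given elements is dependent, and the coefficient of \<open>x\<close> in such a relation cannot
  vanish.\<close>

lemma independent_family_rat_basis:
  fixes f :: "nat \<Rightarrow> 'a"
  assumes indep: "\<And>q. (\<Sum>j<n. of_rat (q j) * f j) = 0 \<Longrightarrow> \<forall>j<n. q j = 0"
  obtains coord' where "rat_basis n f coord'"
proof -
  have ex: "\<exists>c. (\<Sum>j<n. of_rat (c j) * f j) = x" for x
  proof -
    obtain q where q: "\<exists>j<Suc n. q j \<noteq> 0" "(\<Sum>j<Suc n. of_rat (q j) * (f(n := x)) j) = 0"
      using exists_linear_relation[of "Suc n"] by blast
    have q': "(\<Sum>j<n. of_rat (q j) * f j) + of_rat (q n) * x = 0" using q(2) by simp
    have "q n \<noteq> 0"
    proof
      assume "q n = 0"
      then have "\<forall>j<n. q j = 0" using q' indep by simp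
      then show False using q(1) \<open>q n = 0\<close> less_Suc_eq by auto
    qed
    have "(\<Sum>j<n. of_rat (- q j / q n) * f j) = - (\<Sum>j<n. of_rat (q j) * f j) / of_rat (q n)"
      by (simp add: of_rat_divide of_rat_minus sum_negf sum_divide_distrib)
    also have "\<dots> = x" using q' \<open>q n \<noteq> 0\<close> by (simp add: field_simps add_eq_0_iff)
    finally show ?thesis by (rule exI[of _ "\<lambda>j. - q j / q n"])
  qed
  define coord' where "coord' i x = (SOME c. (\<Sum>j<n. of_rat (c j) * f j) = x) i" for i x
  have e: "(\<Sum>j<n. of_rat (coord' j x) * f j) = x" for x
    unfolding coord'_def by (rule someI_ex[OF ex])
  have "rat_basis n f coord'"
  proof
    fix c x i assume c: "(\<Sum>i<n. of_rat (c i) * f i) = x" and i: "i < n"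
    have "(\<Sum>j<n. of_rat (coord' j x - c j) * f j) = 0"
      using e[of x] c by (simp add: of_rat_diff left_diff_distrib sum_subtractf)
    then show "coord' i x = c i" using indep i by fastforce
  qed (rule e)
  then show thesis using that by blast
qed

text \<open>The base change matrix intertwines the two multiplication matrices and is invertible.
  The norm can thus be computed in a basis adapted to the places, which may even depend on the
  element.\<close>

lemma field_norm_basis_independent:
  assumes "rat_basis n f coord'"
  shows "field_norm x = det (mat n n (\<lambda>(i, j). coord' i (x * f j)))"
proof -
  interpret B: rat_basis n f coord' by fact
  define F where "F = mat n n (\<lambda>(i, j). coord i (f j))"
  have F: "F \<in> carrier_mat n n" by (simp add: F_def)
  have "mult_mat x * F = F * B.mult_mat x"
  proof (rule eq_matI)
    fix i j assume "i < dim_row (F * B.mult_mat x)" "j < dim_col (F * B.mult_mat x)"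
    then have ij: "i < n" "j < n" by (simp_all add: F_def B.mult_mat_def)
    have "(mult_mat x * F) $$ (i, j) = coord i (x * f j)"
      using ij coord_mult[of i x "f j"]
      by (simp add: mult_mat_def F_def scalar_prod_def atLeast0LessThan)
    also have "\<dots> = coord i (\<Sum>k<n. of_rat (coord' k (x * f j)) * f k)" by (simp add: B.expand)
    also have "\<dots> = (F * B.mult_mat x) $$ (i, j)"
      using ij by (simp add: B.mult_mat_def F_def scalar_prod_def atLeast0LessThan coord_sum
          coord_scale coord_scale_right mult.commute)
    finally show "(mult_mat x * F) $$ (i, j) = (F * B.mult_mat x) $$ (i, j)" .
  qed (simp_all add: F_def mult_mat_def B.mult_mat_def)
  then have "field_norm x * det F = det F * B.field_norm x"
    unfolding field_norm_def B.field_norm_def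
    using det_mult[OF mult_mat_carrier F, of x] det_mult[OF F B.mult_mat_carrier, of x] by metis
  moreover have "det F \<noteq> 0"
    unfolding F_def
  proof (rule trivial_kernel_imp_det_nonzero)
    fix q assume "\<And>i. i < n \<Longrightarrow> (\<Sum>j<n. coord i (f j) * q j) = 0"
    then have "(\<Sum>j<n. of_rat (q j) * f j) = 0"
      by (intro eqI) (simp add: coord_sum coord_scale coord_scale_right coord_0 mult.commute)
    then show "\<forall>j<n. q j = 0" using B.coord_eqI[of q 0] B.coord_0 by metis
  qed
  ultimately have "field_norm x = B.field_norm x" by simp
  then show ?thesis by (simp add: B.field_norm_def B.mult_mat_def)
qed

end

section \<open>Places over a fixed absolute value of the rationals\<close>

text \<open>If \<open>1 < c / d\<close>, the powers of this quotient exceed any constant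
  \<open>K\<close>. This is how the constants of determinant estimates disappear.\<close>

lemma le_if_powers_le:
  fixes c d :: real
  assumes "0 \<le> c" "0 < d" and le: "\<And>m. c ^ m \<le> K * d ^ m"
  shows "c \<le> d"
proof (rule ccontr)
  assume "\<not> c \<le> d"
  then have "1 < c / d" using assms by simp
  then obtain m where "K < (c / d) ^ m" using real_arch_pow by blast
  then show False using le[of m] assms by (simp add: power_divide field_simps)
qed

text \<open>\<open>y ^ m / (1 + y ^ m)\<close> is the switch of weak approximation: it tends to 1
  where \<open>y\<close> is large and to 0 where \<open>y\<close> is small.\<close>

lemma absval_power_limits:
  fixes v :: "'a::field \<Rightarrow> real"
  assumes v: "absolute_value v"
  shows "1 < v y \<Longrightarrow> (\<lambda>m. v (y ^ m / (1 + y ^ m) - 1)) \<longlonglongrightarrow> 0"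
    and "v y < 1 \<Longrightarrow> (\<lambda>m. v (y ^ m / (1 + y ^ m))) \<longlonglongrightarrow> 0"
proof -
  note p = absval_power[OF v]
  assume y: "1 < v y"
  have inf: "filterlim (\<lambda>m. v y ^ m - 1) at_top sequentially"
    unfolding filterlim_at_top
  proof
    fix Z :: real
    obtain N where N: "Z + 1 < v y ^ N" using real_arch_pow[OF y] by blast
    have "Z \<le> v y ^ m - 1" if "N \<le> m" for m
      using N power_increasing[OF that, of "v y"] y by linarith
    then show "\<forall>\<^sub>F m in sequentially. Z \<le> v y ^ m - 1"
      by (auto simp: eventually_sequentially)
  qed
  show "(\<lambda>m. v (y ^ m / (1 + y ^ m) - 1)) \<longlonglongrightarrow> 0"
  proof (rule tendsto_sandwich[where f = "\<lambda>_. 0"])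
    show "(\<lambda>m. inverse (v y ^ m - 1)) \<longlonglongrightarrow> 0"
      using inf by (rule tendsto_inverse_0_at_top)
    show "\<forall>\<^sub>F m in sequentially. v (y ^ m / (1 + y ^ m) - 1) \<le> inverse (v y ^ m - 1)"
      using eventually_gt_at_top[of 0]
    proof eventually_elim
      fix m :: nat assume "0 < m"
      then have gt: "0 < v y ^ m - 1" using y by (simp add: one_less_power)
      have ge: "v y ^ m - 1 \<le> v (1 + y ^ m)"
        using absval_diff[OF v, of "1 + y ^ m" 1] by (simp add: p absval_1[OF v])
      then have ne: "1 + y ^ m \<noteq> 0" using gt absval_0[OF v] by auto
      then have "y ^ m / (1 + y ^ m) - 1 = - inverse (1 + y ^ m)" by (simp add: field_simps)
      then have "v (y ^ m / (1 + y ^ m) - 1) = inverse (v (1 + y ^ m))"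
        by (simp add: absval_minus[OF v] absval_inverse[OF v])
      also have "\<dots> \<le> inverse (v y ^ m - 1)" using ge gt by (intro le_imp_inverse_le)
      finally show "v (y ^ m / (1 + y ^ m) - 1) \<le> inverse (v y ^ m - 1)" .
    qed
  qed (auto simp: absval_nonneg[OF v])
next
  note p = absval_power[OF v]
  assume y: "v y < 1"
  have lim: "(\<lambda>m. v y ^ m) \<longlonglongrightarrow> 0"
    using y by (intro LIMSEQ_realpow_zero absval_nonneg[OF v])
  show "(\<lambda>m. v (y ^ m / (1 + y ^ m))) \<longlonglongrightarrow> 0"
  proof (rule tendsto_sandwich[where f = "\<lambda>_. 0"])
    have "(\<lambda>m. v y ^ m / (1 - v y ^ m)) \<longlonglongrightarrow> 0 / (1 - 0)"
      by (intro tendsto_intros lim) simp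
    then show "(\<lambda>m. v y ^ m / (1 - v y ^ m)) \<longlonglongrightarrow> 0" by simp
    show "\<forall>\<^sub>F m in sequentially. v (y ^ m / (1 + y ^ m)) \<le> v y ^ m / (1 - v y ^ m)"
      using eventually_gt_at_top[of 0]
    proof eventually_elim
      fix m :: nat assume "0 < m"
      then have gt: "0 < 1 - v y ^ m" using y absval_nonneg[OF v, of y] by (simp add: power_less_one_iff)
      have ge: "1 - v y ^ m \<le> v (1 + y ^ m)"
        using absval_diff[OF v, of "1 + y ^ m" "y ^ m"] by (simp add: p absval_1[OF v])
      have "v (y ^ m / (1 + y ^ m)) = v y ^ m / v (1 + y ^ m)"
        by (simp add: absval_divide[OF v] p)
      also have "\<dots> \<le> v y ^ m / (1 - v y ^ m)"
        using ge gt absval_nonneg[OF v] by (intro divide_left_mono) auto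
      finally show "v (y ^ m / (1 + y ^ m)) \<le> v y ^ m / (1 - v y ^ m)" .
    qed
  qed (auto simp: absval_nonneg[OF v])
qed

text \<open>
  \<open>e\<close> is independent over the completion of \<open>\<rat>\<close>, expressed without reference to the completion.
\<close>

definition stably_independent :: "('a::field_char_0 \<Rightarrow> real) \<Rightarrow> nat \<Rightarrow> (nat \<Rightarrow> 'a) \<Rightarrow> bool" where
  "stably_independent v k e \<longleftrightarrow>
     (\<exists>c>0. \<forall>q. \<forall>j<k. c * v (of_rat (q j)) \<le> v (\<Sum>i<k. of_rat (q i) * e i))"

text \<open>The greatest element is meaningful since such families have at most \<open>n\<close>
  members at a place above \<open>a\<close>. The number agrees with the local degree, but is defined
  inside the field.\<close>

definition place_degree :: "('a::field_char_0 \<Rightarrow> real) \<Rightarrow> nat" where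
  "place_degree v = (GREATEST k. \<exists>e. stably_independent v k e)"

locale valued_rat_basis = rat_basis n b coord
  for n and b :: "nat \<Rightarrow> 'a::field_char_0" and coord +
  fixes a :: "rat \<Rightarrow> real"
  assumes a: "absolute_value a" and nontrivial: "\<exists>q. 1 < a q"
begin

lemmas a_nonneg = absval_nonneg[OF a]

abbreviation V :: "('a \<Rightarrow> real) set" where "V \<equiv> places_over a"

lemma V_absval: "v \<in> V \<Longrightarrow> absolute_value v"
  and V_of_rat: "v \<in> V \<Longrightarrow> v (of_rat q) = a q"
  by (simp_all add: places_over_def)

lemmas V_nonneg = absval_nonneg[OF V_absval]
  and V_mult = absval_mult[OF V_absval]
  and V_add = absval_add[OF V_absval]
  and V_diff = absval_diff[OF V_absval]
  and V_0 = absval_0[OF V_absval]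
  and V_pos = absval_pos[OF V_absval]
  and V_power = absval_power[OF V_absval]
  and V_inverse = absval_inverse[OF V_absval]

lemma V_scale: "v \<in> V \<Longrightarrow> v (of_rat q * x) = a q * v x"
  by (simp add: V_mult V_of_rat)

lemma V_sum_scale_le:
  assumes "v \<in> V" shows "v (\<Sum>i\<in>A. of_rat (q i) * x i) \<le> (\<Sum>i\<in>A. a (q i) * v (x i))"
  using absval_sum_le[OF V_absval[OF assms], of "\<lambda>i. of_rat (q i) * x i" A]
  by (simp only: V_scale[OF assms])

text \<open>Powers of one element of value \<open>Q > 1\<close> meet every size up to the factor
  \<open>Q\<close>. A bounded gap is all one can ask for, the \<open>p\<close>-adic values being
  discrete.\<close>

lemma rat_scaling:
  obtains Q where "1 < Q" "\<And>s. 0 < s \<Longrightarrow> \<exists>q. q \<noteq> 0 \<and> a q < s \<and> s \<le> a q * Q"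
proof -
  obtain q0 where q0: "1 < a q0" using nontrivial by blast
  have ne: "q0 \<noteq> 0" using q0 absval_0[OF a] by auto
  have "\<exists>q. q \<noteq> 0 \<and> a q < s \<and> s \<le> a q * a q0" if s: "0 < s" for s
  proof -
    define k where "k = \<lceil>log (a q0) s\<rceil> - 1"
    define q where "q = q0 powi k"
    have aq: "a q = a q0 powr k"
      using q0 by (simp add: q_def power_int_def powr_real_of_int absval_power[OF a] absval_inverse[OF a]
          power_inverse powr_minus)
    have k: "real_of_int k < log (a q0) s" "log (a q0) s \<le> real_of_int k + 1"
      unfolding k_def by linarith+
    have "a q < a q0 powr log (a q0) s" unfolding aq using k q0 by (intro powr_less_mono)
    moreover have "a q0 powr log (a q0) s \<le> a q0 powr (real_of_int k + 1)"
      using k q0 by (intro powr_mono) auto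
    moreover have "a q0 powr (real_of_int k + 1) = a q * a q0"
      using q0 unfolding aq by (simp add: powr_add)
    moreover have "a q0 powr log (a q0) s = s" using q0 s by simp
    ultimately show ?thesis using ne by (intro exI[of _ q]) (simp add: q_def)
  qed
  then show thesis using that[OF q0] by blast
qed

text \<open>The sum \<open>N\<close> of the absolute values of the coordinates is submultiplicative
  up to the size \<open>K\<close> of the structure constants, the coordinates of the
  \<open>b i * b j\<close>. A large multiple of \<open>N\<close> repairs this and has value at least
  1 at 1.\<close>

lemma basis_seminorm:
  obtains M C where "algebra_seminorm a M" "0 < C" "\<And>i x. i < n \<Longrightarrow> a (coord i x) \<le> C * M x"
proof -
  define N where "N x = (\<Sum>i<n. a (coord i x))" for x
  define K where "K = (\<Sum>i<n. \<Sum>j<n. N (b i * b j))"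
  have N0: "0 \<le> N x" for x by (simp add: N_def sum_nonneg a_nonneg)
  have coord_le: "a (coord i x) \<le> N x" if "i < n" for i x
    unfolding N_def using that by (intro member_le_sum) (auto simp: a_nonneg)
  have N_add: "N (x + y) \<le> N x + N y" for x y
    unfolding N_def sum.distrib[symmetric]
    by (intro sum_mono) (simp add: coord_add absval_add[OF a])
  have N_scale: "N (of_rat q * x) = a q * N x" for q x
    by (simp add: N_def coord_scale absval_mult[OF a] sum_distrib_left)
  have N_sum: "N (\<Sum>i\<in>A. of_rat (q i) * x i) \<le> (\<Sum>i\<in>A. a (q i) * N (x i))" for A q x
  proof (induction A rule: infinite_finite_induct)
    case (insert i A)
    then show ?case
      using N_add[of "of_rat (q i) * x i" "\<Sum>i\<in>A. of_rat (q i) * x i"] by (simp add: N_scale)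
  qed (simp_all add: N_def coord_0 absval_0[OF a])
  have K: "N (b i * b j) \<le> K" if "i < n" "j < n" for i j
  proof -
    have "N (b i * b j) \<le> (\<Sum>j<n. N (b i * b j))" using that N0 by (intro member_le_sum) auto
    also have "\<dots> \<le> K" unfolding K_def using that N0
      by (intro member_le_sum[of i _ "\<lambda>i. \<Sum>j<n. N (b i * b j)"]) (auto intro: sum_nonneg)
    finally show ?thesis .
  qed
  have N_mult: "N (x * y) \<le> K * (N x * N y)" for x y
  proof -
    have "x * y = (\<Sum>i<n. of_rat (coord i x) * b i) * (\<Sum>j<n. of_rat (coord j y) * b j)"
      by (simp only: expand)
    also have "\<dots> = (\<Sum>i<n. \<Sum>j<n. of_rat (coord i x) * b i * (of_rat (coord j y) * b j))"
      by (rule sum_product)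
    also have "\<dots> = (\<Sum>i<n. of_rat (coord i x) * (\<Sum>j<n. of_rat (coord j y) * (b i * b j)))"
      unfolding sum_distrib_left by (intro sum.cong refl) (simp only: mult_ac)
    finally have "N (x * y) \<le> (\<Sum>i<n. a (coord i x) * N (\<Sum>j<n. of_rat (coord j y) * (b i * b j)))"
      using N_sum by simp
    also have "\<dots> \<le> (\<Sum>i<n. a (coord i x) * (\<Sum>j<n. a (coord j y) * N (b i * b j)))"
      by (intro sum_mono mult_left_mono N_sum a_nonneg)
    also have "\<dots> \<le> (\<Sum>i<n. a (coord i x) * (\<Sum>j<n. a (coord j y) * K))"
      by (intro sum_mono mult_left_mono a_nonneg K) auto
    also have "\<dots> = (\<Sum>i<n. a (coord i x) * (N y * K))"
      by (simp add: N_def sum_distrib_right)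
    also have "\<dots> = K * (N x * N y)"
      by (subst sum_distrib_right[symmetric]) (simp add: N_def mult_ac)
    finally show ?thesis .
  qed
  have "N 1 \<noteq> 0"
  proof
    assume "N 1 = 0"
    then have "coord i 1 = 0" if "i < n" for i
      using coord_le[OF that, of 1] absval_eq_0[OF a] a_nonneg[of "coord i 1"] by (metis order.antisym)
    then have "1 = (0::'a)" by (intro eqI) (simp add: coord_0)
    then show False by simp
  qed
  then have N1: "0 < N 1" using N0[of 1] by simp
  define C where "C = K + 1 / N 1"
  have K0: "0 \<le> K" by (simp add: K_def N0 sum_nonneg)
  have C: "0 < C" "K \<le> C" "1 \<le> C * N 1" using N1 K0 by (simp_all add: C_def add_nonneg_pos distrib_right)
  define M where "M x = C * N x" for x
  have "algebra_seminorm a M"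
    unfolding algebra_seminorm_def
  proof (intro conjI allI)
    fix x y q
    show "0 \<le> M x" using C N0 by (simp add: M_def)
    show "M (x + y) \<le> M x + M y" using C N_add[of x y] by (simp add: M_def flip: distrib_left)
    have "C * N (x * y) \<le> C * (K * (N x * N y))" using C N_mult by (intro mult_left_mono) auto
    also have "\<dots> \<le> C * (C * (N x * N y))"
      using C N0 by (intro mult_left_mono mult_right_mono) auto
    finally show "M (x * y) \<le> M x * M y" by (simp add: M_def mult_ac)
    show "M (of_rat q * x) = a q * M x" by (simp add: M_def N_scale)
  qed (use C in \<open>simp add: M_def\<close>)
  moreover have "a (coord i x) \<le> (1 / C) * M x" if "i < n" for i x
    using coord_le[OF that, of x] C by (simp add: M_def)
  ultimately show thesis using that C by (metis zero_less_divide_1_iff)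
qed

text \<open>If \<open>M (y ^ m)\<close> were \<open>O(t ^ m)\<close>, the matrix of multiplication
  by \<open>y ^ m\<close> would have entries of that order, and its determinant would force
  \<open>a (field_norm y) \<le> t ^ n\<close>. So the powers of \<open>y\<close> outgrow those of
  \<open>t\<close>, and a place below the seminorm forced for \<open>inverse y\<close> has value at
  most \<open>1 / t\<close> there.\<close>

lemma place_above_norm:
  assumes y: "y \<noteq> 0" and t: "0 < t" "t ^ n < a (field_norm y)"
  shows "\<exists>v\<in>V. t \<le> v y"
proof -
  obtain M C where M: "algebra_seminorm a M" and C: "0 < C"
    and coord_le: "\<And>i x. i < n \<Longrightarrow> a (coord i x) \<le> C * M x" using basis_seminorm by blast
  have "\<exists>m. B * t ^ m < M (y ^ m)" for B
  proof (rule ccontr)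
    assume "\<not> (\<exists>m. B * t ^ m < M (y ^ m))"
    then have B: "M (y ^ m) \<le> B * t ^ m" for m by (simp add: not_less)
    define D where "D = (\<Sum>j<n. M (b j))"
    have D: "M (b j) \<le> D" if "j < n" for j
      unfolding D_def using that by (intro member_le_sum) (auto simp: seminorm_nonneg[OF a M])
    have "a (field_norm y) ^ m \<le> fact n * (C * B * D) ^ n * (t ^ n) ^ m" for m
    proof -
      have "a (field_norm y) ^ m = a (det (mult_mat (y ^ m)))"
        by (simp add: field_norm_power absval_power[OF a] flip: field_norm_def)
      also have "\<dots> \<le> fact n * (\<Prod>i<n. C * (B * t ^ m * D))"
      proof (rule absval_det_le[OF a])
        fix i j assume ij: "i < n" "j < n"
        have "a (mult_mat (y ^ m) $$ (i, j)) \<le> C * M (y ^ m * b j)"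
          using ij coord_le by (simp add: mult_mat_def)
        also have "\<dots> \<le> C * (M (y ^ m) * M (b j))"
          using C seminorm_mult[OF a M] by (intro mult_left_mono) auto
        also have "\<dots> \<le> C * (B * t ^ m * D)"
          using C B D[OF ij(2)] seminorm_nonneg[OF a M]
          by (intro mult_left_mono mult_mono) (auto intro: order_trans)
        finally show "a (mult_mat (y ^ m) $$ (i, j)) \<le> C * (B * t ^ m * D)" .
      qed simp
      also have "\<dots> = fact n * (C * B * D) ^ n * (t ^ n) ^ m"
        by (simp add: power_mult_distrib mult_ac flip: power_mult)
      finally show ?thesis .
    qed
    then have "a (field_norm y) \<le> t ^ n"
      using t by (rule_tac le_if_powers_le[OF a_nonneg]) auto
    then show False using t by simp
  qed
  then obtain M' where M': "algebra_seminorm a M'" "M' (inverse y) \<le> 1 / t"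
    using seminorm_forcing[OF a M y t(1)] by blast
  obtain v where v: "v \<in> V" "\<And>x. v x \<le> M' x" using place_below_seminorm[OF a M'(1)] by blast
  have "inverse (v y) \<le> 1 / t"
    using v(2)[of "inverse y"] M'(2) unfolding V_inverse[OF v(1)] by (rule order_trans)
  then have "t \<le> v y" using V_pos[OF v(1) y] t(1) by (simp add: field_simps)
  then show ?thesis using v(1) by blast
qed

lemma V_nonempty: "V \<noteq> {}"
  using place_above_norm[of 1 "1/2"] dim_pos by (auto simp: field_norm_1 absval_1[OF a] power_one_over)

lemma stably_independent_V:
  "v \<in> V \<Longrightarrow> stably_independent v k e \<longleftrightarrow>
     (\<exists>c>0. \<forall>q. \<forall>j<k. c * a (q j) \<le> v (\<Sum>i<k. of_rat (q i) * e i))"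
  by (simp add: stably_independent_def V_of_rat)

lemma stably_independent_le: 
  assumes v: "v \<in> V" and e: "stably_independent v k e" shows "k \<le> n"
proof (rule ccontr)
  assume "\<not> k \<le> n"
  then obtain q j where q: "j < k" "q j \<noteq> 0" "(\<Sum>j<k. of_rat (q j) * e j) = 0"
    using exists_linear_relation[of k e] by (metis not_le)
  obtain c where "0 < c" "c * a (q j) \<le> v (\<Sum>j<k. of_rat (q j) * e j)"
    using e q(1) unfolding stably_independent_V[OF v] by blast
  then show False using q absval_pos[OF a q(2)] by (simp add: V_0[OF v] mult_le_0_iff)
qed

lemma place_degree_greatest:
  assumes v: "v \<in> V"
  shows "\<exists>e. stably_independent v (place_degree v) e"
    and "stably_independent v k e \<Longrightarrow> k \<le> place_degree v"
proof -
  have "stably_independent v 0 e" for e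
    by (auto simp: stably_independent_def intro: exI[of _ 1])
  then show "\<exists>e. stably_independent v (place_degree v) e"
    unfolding place_degree_def
    using GreatestI_nat[of "\<lambda>k. \<exists>e. stably_independent v k e" 0 n] stably_independent_le[OF v] by blast
  show "stably_independent v k e \<Longrightarrow> k \<le> place_degree v"
    unfolding place_degree_def
    using Greatest_le_nat[of "\<lambda>k. \<exists>e. stably_independent v k e" k n] stably_independent_le[OF v] by blast
qed

lemma place_degree_pos: assumes v: "v \<in> V" shows "0 < place_degree v"
proof -
  have "stably_independent v 1 (\<lambda>_. 1)"
    unfolding stably_independent_V[OF v] by (auto simp: V_of_rat[OF v] intro!: exI[of _ 1])
  then show ?thesis using place_degree_greatest(2)[OF v] by fastforce
qed

text \<open>
  By maximality: if \<open>x\<close> had positive distance from the span of \<open>e\<close>, the family could be extended.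
\<close>

lemma stably_independent_dense:
  assumes v: "v \<in> V" and e: "stably_independent v (place_degree v) e" and "0 < \<delta>"
  shows "\<exists>q. v (x - (\<Sum>i<place_degree v. of_rat (q i) * e i)) < \<delta>"
proof (rule ccontr)
  let ?d = "place_degree v"
  assume "\<not> ?thesis"
  then have far: "\<delta> \<le> v (x - (\<Sum>i<?d. of_rat (q i) * e i))" for q by (simp add: not_less)
  obtain c where c: "0 < c" and indep: "\<And>q j. j < ?d \<Longrightarrow> c * a (q j) \<le> v (\<Sum>i<?d. of_rat (q i) * e i)"
    using e unfolding stably_independent_V[OF v] by blast
  define e' where "e' = e(?d := x)"
  \<comment> \<open>The new coefficient is controlled by the distance \<open>\<delta>\<close> to the
    span, hence is at most \<open>1 / \<delta>\<close> times the value of the combination;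
    subtracting its term costs the old coefficients the factor
    \<open>1 + v x / \<delta>\<close>.\<close>
  define c' where "c' = min \<delta> (c * \<delta> / (\<delta> + v x))"
  have "0 < \<delta> + v x" using \<open>0 < \<delta>\<close> V_nonneg[OF v, of x] by simp
  then have c': "0 < c'" using c \<open>0 < \<delta>\<close> by (simp add: c'_def)
  have "c' * a (q j) \<le> v (\<Sum>i<Suc ?d. of_rat (q i) * e' i)" if j: "j < Suc ?d" for q j
  proof -
    define s where "s = (\<Sum>i<?d. of_rat (q i) * e i)"
    define t where "t = s + of_rat (q ?d) * x"
    have t: "(\<Sum>i<Suc ?d. of_rat (q i) * e' i) = t" by (simp add: t_def s_def e'_def)
    have last: "\<delta> * a (q ?d) \<le> v t"
    proof (cases "q ?d = 0")
      case False
      have "(\<Sum>i<?d. of_rat (- q i / q ?d) * e i) = - s / of_rat (q ?d)"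
        by (simp add: s_def of_rat_divide of_rat_minus sum_negf sum_divide_distrib)
      then have "t = of_rat (q ?d) * (x - (\<Sum>i<?d. of_rat (- q i / q ?d) * e i))"
        using False by (simp add: t_def field_simps)
      then have "v t = a (q ?d) * v (x - (\<Sum>i<?d. of_rat (- q i / q ?d) * e i))"
        by (simp only: V_scale[OF v])
      moreover have "a (q ?d) * \<delta> \<le> a (q ?d) * v (x - (\<Sum>i<?d. of_rat (- q i / q ?d) * e i))"
        by (intro mult_left_mono far a_nonneg)
      ultimately show ?thesis by (simp only: mult.commute)
    qed (simp add: absval_0[OF a] V_nonneg[OF v])
    show ?thesis
    proof (cases "j = ?d")
      case True
      have "c' * a (q j) \<le> \<delta> * a (q j)" by (intro mult_right_mono a_nonneg) (simp add: c'_def)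
      then show ?thesis using last True t by simp
    next
      case False
      then have "c * a (q j) \<le> v s" unfolding s_def using j indep by simp
      also have "\<dots> = v (t - of_rat (q ?d) * x)" by (simp add: t_def)
      also have "\<dots> \<le> v t + a (q ?d) * v x" using V_diff[OF v, of t "of_rat (q ?d) * x"]
          by (simp only: V_scale[OF v])
      also have "\<dots> \<le> v t + v t / \<delta> * v x"
        using last \<open>0 < \<delta>\<close> V_nonneg[OF v] by (intro add_left_mono mult_right_mono) (auto simp: field_simps)
      finally have "c * a (q j) \<le> v t * ((\<delta> + v x) / \<delta>)" using \<open>0 < \<delta>\<close> by (simp add: field_simps)
      then have "c * \<delta> / (\<delta> + v x) * a (q j) \<le> v t"
        using \<open>0 < \<delta>\<close> \<open>0 < \<delta> + v x\<close> by (simp add: field_simps)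
      moreover have "c' * a (q j) \<le> c * \<delta> / (\<delta> + v x) * a (q j)"
        by (intro mult_right_mono a_nonneg) (simp add: c'_def)
      ultimately show ?thesis using t by simp
    qed
  qed
  then have "stably_independent v (Suc ?d) e'" unfolding stably_independent_V[OF v] using c' by blast
  then show False using place_degree_greatest(2)[OF v] by fastforce
qed

subsection \<open>Weak approximation\<close>

text \<open>Distinct places differ at some \<open>x\<close>, and inversion arranges
  \<open>w x < v x\<close>. A high power widens the ratio beyond the gap \<open>Q\<close> between
  available rational sizes, so a rational multiple has 1 strictly between its two values.\<close>

lemma separate_two_places:
  assumes v: "v \<in> V" and w: "w \<in> V" and "v \<noteq> w"
  obtains x where "1 < v x" "w x < 1"
proof -
  obtain x where x: "x \<noteq> 0" "w x < v x"
  proof -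
    obtain x where ne: "v x \<noteq> w x" using \<open>v \<noteq> w\<close> by blast
    then have "x \<noteq> 0" using V_0 v w by metis
    show thesis
    proof (cases "w x < v x")
      case True
      then show thesis using that \<open>x \<noteq> 0\<close> by blast
    next
      case False
      then have "w (inverse x) < v (inverse x)"
        using ne V_pos[OF v \<open>x \<noteq> 0\<close>] by (simp add: V_inverse v w)
      then show thesis using that[of "inverse x"] \<open>x \<noteq> 0\<close> by simp
    qed
  qed
  obtain Q where Q: "1 < Q" "\<And>s. 0 < s \<Longrightarrow> \<exists>q. q \<noteq> 0 \<and> a q < s \<and> s \<le> a q * Q"
    using rat_scaling by blast
  have wx: "0 < w x" using V_pos[OF w x(1)] .
  obtain m where m: "Q < (v x / w x) ^ m" using real_arch_pow[of "v x / w x" Q] x wx by auto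
  obtain q where q: "a q < 1 / w x ^ m" "1 / w x ^ m \<le> a q * Q"
    using Q(2)[of "1 / w x ^ m"] wx by auto
  have "1 \<le> a q * Q * w x ^ m" using q(2) wx by (simp add: field_simps)
  moreover have aq: "0 < a q"
    using calculation a_nonneg[of q] by (cases "a q = 0") auto
  moreover have "Q * w x ^ m < v x ^ m" using m wx by (simp add: power_divide field_simps)
  ultimately have "1 < a q * v x ^ m"
    by (metis (no_types, lifting) le_less_trans mult.assoc mult_strict_left_mono)
  moreover have "a q * w x ^ m < 1" using q(1) wx by (simp add: field_simps)
  ultimately show thesis using that[of "of_rat q * x ^ m"] by (simp add: V_scale V_power v w)
qed

text \<open>To add \<open>z\<close>, take \<open>x\<close> separating \<open>v\<close> from
  \<open>z\<close>. If \<open>y\<close> is at most 1 at \<open>z\<close>, a high power of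
  \<open>y\<close> times \<open>x\<close> works. Otherwise \<open>y\<close> is large at both
  \<open>v\<close> and \<open>z\<close>, and the switch \<open>y ^ m / (1 + y ^ m)\<close>
  suppresses \<open>x\<close> on \<open>W\<close> while leaving its values at \<open>v\<close> and
  \<open>z\<close> unchanged in the limit.\<close>

lemma isolate_place:
  assumes "finite W" "W \<subseteq> V" "v \<in> V" "v \<notin> W"
  shows "\<exists>y. 1 < v y \<and> (\<forall>w\<in>W. w y < 1)"
  using assms
proof (induction W)
  case empty
  obtain q where "1 < a q" using nontrivial by blast
  then show ?case using V_of_rat[OF \<open>v \<in> V\<close>] by (intro exI[of _ "of_rat q"]) simp
next
  case (insert z W)
  then obtain y where y: "1 < v y" "\<And>w. w \<in> W \<Longrightarrow> w y < 1" by auto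
  have z: "z \<in> V" and v: "v \<in> V" and W: "\<And>w. w \<in> W \<Longrightarrow> w \<in> V" using insert by auto
  obtain x where x: "1 < v x" "z x < 1" using separate_two_places[OF v z] insert by auto
  show ?case
  proof (cases "z y \<le> 1")
    case True
    have "\<forall>\<^sub>F m in sequentially. \<forall>w\<in>W. w (y ^ m * x) < 1"
    proof (intro eventually_ball_finite ballI insert.hyps(1))
      fix w assume w: "w \<in> W"
      have "(\<lambda>m. w y ^ m * w x) \<longlonglongrightarrow> 0 * w x"
        using y(2)[OF w] V_nonneg[OF W[OF w]] by (intro tendsto_intros LIMSEQ_realpow_zero) auto
      then have "(\<lambda>m. w (y ^ m * x)) \<longlonglongrightarrow> 0"
        using w W by (simp add: V_mult V_power)
      then show "\<forall>\<^sub>F m in sequentially. w (y ^ m * x) < 1" by (rule order_tendstoD) simp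
    qed
    then obtain m where m: "\<forall>w\<in>W. w (y ^ m * x) < 1"
      by (auto dest!: eventually_happens simp: eventually_sequentially)
    have "1 * 1 < v y ^ m * v x" using y(1) x(1)
      by (intro mult_le_less_imp_less) auto
    moreover have "z y ^ m * z x < 1"
    proof -
      have "z y ^ m * z x \<le> 1 * z x"
        using True V_nonneg[OF z] by (intro mult_right_mono power_le_one) auto
      then show ?thesis using x by simp
    qed
    ultimately show ?thesis using m z v by (intro exI[of _ "y ^ m * x"]) (simp add: V_mult V_power)
  next
    case False
    define u where "u m = y ^ m / (1 + y ^ m)" for m
    have big: "(\<lambda>m. w (u m * x)) \<longlonglongrightarrow> w x" if "w \<in> V" "1 < w y" for w
    proof -
      have "(\<lambda>m. w (u m * x) - w x) \<longlonglongrightarrow> 0"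
      proof (rule tendsto_0_le[where K = 1])
        show "(\<lambda>m. w (u m - 1) * w x) \<longlonglongrightarrow> 0"
          using tendsto_mult_right[OF absval_power_limits(1)[OF V_absval[OF that(1)] that(2)], of "w x"]
          by (simp add: u_def)
        have "norm (w (u m * x) - w x) \<le> w (u m - 1) * w x" for m
        proof -
          have "w (u m - 1) * w x = w (u m * x - x)"
            using that by (simp add: algebra_simps flip: V_mult)
          moreover have "w (u m * x) \<le> w (u m * x - x) + w x" "w x \<le> w (u m * x - x) + w (u m * x)"
            using V_add[OF that(1), of "u m * x - x" x] V_diff[OF that(1), of "u m * x" "u m * x - x"] by simp_all
          ultimately show ?thesis by simp
        qed
        then show "\<forall>\<^sub>F m in sequentially. norm (w (u m * x) - w x) \<le> norm (w (u m - 1) * w x) * 1"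
          by (intro always_eventually allI) (metis abs_ge_self mult.right_neutral order_trans real_norm_def)
      qed
      then show ?thesis by (simp add: LIM_zero_iff)
    qed
    have "\<forall>\<^sub>F m in sequentially. 1 < v (u m * x)"
      using big[OF v y(1)] x(1) by (rule order_tendstoD)
    moreover have "\<forall>\<^sub>F m in sequentially. z (u m * x) < 1"
      using big[OF z] False x(2) by (intro order_tendstoD(2)) auto
    moreover have "\<forall>\<^sub>F m in sequentially. \<forall>w\<in>W. w (u m * x) < 1"
    proof (intro eventually_ball_finite ballI insert.hyps(1))
      fix w assume w: "w \<in> W"
      have "(\<lambda>m. w (u m) * w x) \<longlonglongrightarrow> 0 * w x"
        unfolding u_def using absval_power_limits(2)[OF V_absval[OF W[OF w]] y(2)[OF w]] by (intro tendsto_intros)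
      then show "\<forall>\<^sub>F m in sequentially. w (u m * x) < 1"
        using w W by (intro order_tendstoD(2)[of _ 0]) (auto simp: V_mult)
    qed
    ultimately have "\<forall>\<^sub>F m in sequentially. 1 < v (u m * x) \<and> z (u m * x) < 1 \<and> (\<forall>w\<in>W. w (u m * x) < 1)"
      by eventually_elim auto
    then obtain m where "1 < v (u m * x) \<and> z (u m * x) < 1 \<and> (\<forall>w\<in>W. w (u m * x) < 1)"
      by (auto dest!: eventually_happens simp: eventually_sequentially)
    then show ?thesis by auto
  qed
qed

text \<open>The switch of an element that is large at \<open>v\<close> and small at the rest of
  \<open>W\<close>.\<close>

lemma weak_approximation:
  assumes W: "finite W" "W \<subseteq> V" and v: "v \<in> W" and "0 < \<delta>"
  obtains u where "v (u - 1) < \<delta>" "\<And>w. w \<in> W \<Longrightarrow> w \<noteq> v \<Longrightarrow> w u < \<delta>"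
proof -
  obtain y where y: "1 < v y" "\<And>w. w \<in> W - {v} \<Longrightarrow> w y < 1"
    using isolate_place[of "W - {v}" v] W v by auto
  define u where "u m = y ^ m / (1 + y ^ m)" for m
  have "\<forall>\<^sub>F m in sequentially. v (u m - 1) < \<delta>"
    using absval_power_limits(1)[of v y] V_absval W v y(1) \<open>0 < \<delta>\<close> unfolding u_def
    by (intro order_tendstoD(2)) auto
  moreover have "\<forall>\<^sub>F m in sequentially. \<forall>w\<in>W - {v}. w (u m) < \<delta>"
  proof (intro eventually_ball_finite ballI)
    fix w assume "w \<in> W - {v}"
    then show "\<forall>\<^sub>F m in sequentially. w (u m) < \<delta>"
      using absval_power_limits(2)[of w y] V_absval W y(2) \<open>0 < \<delta>\<close> unfolding u_def
      by (intro order_tendstoD(2)) auto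
  qed (use W in auto)
  ultimately have "\<forall>\<^sub>F m in sequentially. v (u m - 1) < \<delta> \<and> (\<forall>w\<in>W - {v}. w (u m) < \<delta>)"
    by eventually_elim auto
  then obtain m where "v (u m - 1) < \<delta> \<and> (\<forall>w\<in>W - {v}. w (u m) < \<delta>)"
    by (auto dest!: eventually_happens simp: eventually_sequentially)
  then show thesis using that by blast
qed

end

section \<open>Families adapted to finitely many places\<close>

context valued_rat_basis
begin

text \<open>Each place is repeated once for each local dimension, so products over this set carry
  the exponents \<open>place_degree v\<close>.\<close>

definition place_index :: "('a \<Rightarrow> real) set \<Rightarrow> (('a \<Rightarrow> real) \<times> nat) set" where
  "place_index W = (SIGMA v:W. {..<place_degree v})"

text \<open>Up to \<open>\<epsilon>\<close>, \<open>f (v, l)\<close> is the element of the product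
  of the completions over \<open>W\<close> with component \<open>e v l\<close> at \<open>v\<close>
  and 0 elsewhere.\<close>

definition approximating ::
  "('a \<Rightarrow> real) set \<Rightarrow> (('a \<Rightarrow> real) \<Rightarrow> nat \<Rightarrow> 'a) \<Rightarrow> real \<Rightarrow> (('a \<Rightarrow> real) \<times> nat \<Rightarrow> 'a) \<Rightarrow> bool" where
  "approximating W e \<epsilon> f \<longleftrightarrow>
     (\<forall>(v, l)\<in>place_index W. v (f (v, l) - e v l) \<le> \<epsilon> \<and> (\<forall>w\<in>W. w \<noteq> v \<longrightarrow> w (f (v, l)) \<le> \<epsilon>))"

lemma finite_place_index: "finite W \<Longrightarrow> finite (place_index W)"
  by (simp add: place_index_def)

lemma card_place_index: "finite W \<Longrightarrow> card (place_index W) = (\<Sum>v\<in>W. place_degree v)"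
  by (simp add: place_index_def)

lemma exists_approximating:
  assumes W: "finite W" "W \<subseteq> V" and "0 < \<epsilon>"
  shows "\<exists>f. approximating W e \<epsilon> f"
proof -
  have "\<exists>x. v (x - e v l) \<le> \<epsilon> \<and> (\<forall>w\<in>W. w \<noteq> v \<longrightarrow> w x \<le> \<epsilon>)" if v: "v \<in> W" for v l
  proof -
    \<comment> \<open>The summand 1 keeps \<open>B\<close> positive, so the switch may be asked for
      precision \<open>\<epsilon> / B\<close>.\<close>
    define B where "B = 1 + (\<Sum>w\<in>W. w (e v l))"
    have le: "w (e v l) \<le> B" if "w \<in> W" for w
    proof -
      have "w (e v l) \<le> (\<Sum>w\<in>W. w (e v l))"
        using that W V_nonneg by (intro member_le_sum) auto
      then show ?thesis by (simp add: B_def)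
    qed
    have "0 \<le> (\<Sum>w\<in>W. w (e v l))" using W V_nonneg by (intro sum_nonneg) auto
    then have B: "0 < B" by (simp add: B_def)
    obtain u where u: "v (u - 1) < \<epsilon> / B" "\<And>w. w \<in> W \<Longrightarrow> w \<noteq> v \<Longrightarrow> w u < \<epsilon> / B"
      using weak_approximation[OF W v, of "\<epsilon> / B"] B \<open>0 < \<epsilon>\<close> by auto
    have bound: "w (z * e v l) \<le> \<epsilon>" if "w \<in> W" "w z < \<epsilon> / B" for w z
    proof -
      have wV: "w \<in> V" using that W by blast
      have "w (z * e v l) = w z * w (e v l)" by (rule V_mult[OF wV])
      also have "\<dots> \<le> \<epsilon> / B * B"
        using that le[OF that(1)] V_nonneg[OF wV] B \<open>0 < \<epsilon>\<close> by (intro mult_mono) auto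
      finally show ?thesis using B by simp
    qed
    have "v (u * e v l - e v l) \<le> \<epsilon>" using bound[OF v u(1)] by (simp add: algebra_simps)
    then show ?thesis using bound u(2) by (intro exI[of _ "u * e v l"]) blast
  qed
  then obtain F where "\<And>v l. v \<in> W \<Longrightarrow> v (F v l - e v l) \<le> \<epsilon> \<and> (\<forall>w\<in>W. w \<noteq> v \<longrightarrow> w (F v l) \<le> \<epsilon>)"
    by metis
  then have "approximating W e \<epsilon> (\<lambda>(v, l). F v l)"
    by (auto simp: approximating_def place_index_def)
  then show ?thesis by blast
qed

lemma approximating_perturbation:
  assumes W: "finite W" "W \<subseteq> V" and f: "approximating W e \<epsilon> f" and v: "v \<in> W"
  shows "v ((\<Sum>l<place_degree v. of_rat (q (v, l)) * e v l) - (\<Sum>p\<in>place_index W. of_rat (q p) * f p))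
    \<le> \<epsilon> * (\<Sum>p\<in>place_index W. a (q p))"
proof -
  have vV: "v \<in> V" using v W by blast
  \<comment> \<open>\<open>E\<close> is the ideal family as seen from \<open>v\<close>: the vectors
    \<open>e v l\<close> in the block of \<open>v\<close>, and 0 in all other blocks.\<close>
  define E where "E p = (if fst p = v then e v (snd p) else 0)" for p
  have "(\<Sum>p\<in>place_index W. of_rat (q p) * E p) = (\<Sum>p\<in>Pair v ` {..<place_degree v}. of_rat (q p) * E p)"
    using W v by (intro sum.mono_neutral_right) (auto simp: place_index_def E_def)
  also have "\<dots> = (\<Sum>l<place_degree v. of_rat (q (v, l)) * e v l)"
    by (subst sum.reindex) (auto simp: E_def inj_on_def)
  finally have eq: "(\<Sum>l<place_degree v. of_rat (q (v, l)) * e v l) - (\<Sum>p\<in>place_index W. of_rat (q p) * f p)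
      = (\<Sum>p\<in>place_index W. of_rat (q p) * (E p - f p))"
    by (simp add: right_diff_distrib sum_subtractf)
  have "v (E p - f p) \<le> \<epsilon>" if "p \<in> place_index W" for p
  proof (cases "fst p = v")
    case True
    then show ?thesis
      using f that absval_diff_commute[OF V_absval[OF vV], of "f p" "e v (snd p)"]
      by (auto simp: approximating_def E_def)
  next
    case False
    then show ?thesis
      using f that v absval_minus[OF V_absval[OF vV], of "f p"] by (auto simp: approximating_def E_def)
  qed
  then have "(\<Sum>p\<in>place_index W. a (q p) * v (E p - f p)) \<le> (\<Sum>p\<in>place_index W. a (q p) * \<epsilon>)"
    by (intro sum_mono mult_left_mono a_nonneg)
  then show ?thesis
    unfolding eq sum_distrib_left using V_sum_scale_le[OF vV, where A = "place_index W" and q = q and x = "\<lambda>p. E p - f p"]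
    by (simp add: mult.commute)
qed

definition separating :: "('a \<Rightarrow> real) set \<Rightarrow> (('a \<Rightarrow> real) \<Rightarrow> nat \<Rightarrow> 'a) \<Rightarrow> real \<Rightarrow> bool" where
  "separating W e c \<longleftrightarrow> 0 < c \<and> (\<forall>v\<in>W. stably_independent v (place_degree v) (e v) \<and>
     (\<forall>q. \<forall>l<place_degree v. c * a (q l) \<le> v (\<Sum>i<place_degree v. of_rat (q i) * e v i)))"

lemma exists_separating:
  assumes W: "finite W" "W \<subseteq> V"
  obtains e c where "separating W e c"
proof -
  have "\<exists>e c. 0 < c \<and> stably_independent v (place_degree v) e \<and>
      (\<forall>q. \<forall>l<place_degree v. c * a (q l) \<le> v (\<Sum>i<place_degree v. of_rat (q i) * e i))"
    if "v \<in> W" for v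
    using place_degree_greatest(1)[of v] stably_independent_V[of v] that W by blast
  then obtain e C where eC: "\<And>v. v \<in> W \<Longrightarrow> 0 < C v \<and> stably_independent v (place_degree v) (e v) \<and>
      (\<forall>q. \<forall>l<place_degree v. C v * a (q l) \<le> v (\<Sum>i<place_degree v. of_rat (q i) * e v i))"
    by metis
  \<comment> \<open>The inserted 1 keeps the minimum defined for empty \<open>W\<close>.\<close>
  define c where "c = Min (insert 1 (C ` W))"
  have c: "0 < c" unfolding c_def using W eC by (subst Min_gr_iff) auto
  have le: "c \<le> C v" if "v \<in> W" for v unfolding c_def using W that by (intro Min_le) auto
  have "c * a (q l) \<le> v (\<Sum>i<place_degree v. of_rat (q i) * e v i)" if "v \<in> W" "l < place_degree v" for v q l
    using eC[OF that(1)] that(2) mult_right_mono[OF le[OF that(1)] a_nonneg[of "q l"]] order_trans by blast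
  then have "separating W e c" using c eC by (simp add: separating_def)
  then show thesis using that by blast
qed

text \<open>The error involves the coefficients at all places, not only those at \<open>v\<close>,
  so it can be absorbed only after summation over the whole index set.\<close>

lemma approximating_coefficient:
  assumes W: "finite W" "W \<subseteq> V" and f: "approximating W e \<epsilon> f" and e: "separating W e c"
    and p: "(v, l) \<in> place_index W"
  shows "c * a (q (v, l)) \<le> v (\<Sum>p\<in>place_index W. of_rat (q p) * f p) + \<epsilon> * (\<Sum>p\<in>place_index W. a (q p))"
proof -
  have v: "v \<in> W" "l < place_degree v" and vV: "v \<in> V" using p W by (auto simp: place_index_def)
  define x where "x = (\<Sum>p\<in>place_index W. of_rat (q p) * f p)"
  define s where "s = (\<Sum>l<place_degree v. of_rat (q (v, l)) * e v l)"
  have "\<forall>q. \<forall>l<place_degree v. c * a (q l) \<le> v (\<Sum>i<place_degree v. of_rat (q i) * e v i)"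
    using e v(1) by (simp add: separating_def)
  from spec[OF this, of "\<lambda>l. q (v, l)"] v(2) have "c * a (q (v, l)) \<le> v s" by (simp add: s_def)
  also have "v s \<le> v x + v (s - x)" using V_add[OF vV, of x "s - x"] by simp
  also have "v (s - x) \<le> \<epsilon> * (\<Sum>p\<in>place_index W. a (q p))"
    unfolding s_def x_def by (rule approximating_perturbation[OF W f v(1)])
  finally show ?thesis by (simp add: x_def)
qed

text \<open>In the sum of the coefficient bounds the total error is at most half of the left-hand
  side, because \<open>\<epsilon>\<close> is small relative to \<open>c\<close> and the number of
  indices.\<close>

lemma approximating_coefficient_sum:
  assumes W: "finite W" "W \<subseteq> V" and f: "approximating W e \<epsilon> f" and e: "separating W e c"
    and \<epsilon>: "real (card (place_index W)) * \<epsilon> \<le> c / 2"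
  shows "(\<Sum>p\<in>place_index W. a (q p))
    \<le> 2 / c * (\<Sum>p\<in>place_index W. fst p (\<Sum>p\<in>place_index W. of_rat (q p) * f p))"
proof -
  let ?I = "place_index W"
  define T where "T = (\<Sum>p\<in>?I. a (q p))"
  define x where "x = (\<Sum>p\<in>?I. of_rat (q p) * f p)"
  have c: "0 < c" using e by (simp add: separating_def)
  have T0: "0 \<le> T" unfolding T_def by (intro sum_nonneg a_nonneg)
  have "c * a (q p) \<le> fst p x + \<epsilon> * T" if "p \<in> ?I" for p
    using approximating_coefficient[OF W f e, of "fst p" "snd p" q] that by (simp add: x_def T_def)
  then have "(\<Sum>p\<in>?I. c * a (q p)) \<le> (\<Sum>p\<in>?I. fst p x + \<epsilon> * T)" by (rule sum_mono)
  then have "c * T \<le> (\<Sum>p\<in>?I. fst p x) + real (card ?I) * \<epsilon> * T"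
    by (simp add: T_def sum.distrib mult.assoc flip: sum_distrib_left)
  also have "\<dots> \<le> (\<Sum>p\<in>?I. fst p x) + c / 2 * T"
    using \<epsilon> T0 by (intro add_left_mono mult_right_mono)
  finally show ?thesis using c by (simp add: T_def x_def field_simps)
qed

lemma approximating_independent:
  assumes W: "finite W" "W \<subseteq> V" and f: "approximating W e \<epsilon> f" and e: "separating W e c"
    and \<epsilon>: "real (card (place_index W)) * \<epsilon> \<le> c / 2"
    and zero: "(\<Sum>p\<in>place_index W. of_rat (q p) * f p) = 0" and p: "p \<in> place_index W"
  shows "q p = 0"
proof -
  have "(\<Sum>p\<in>place_index W. fst p (0::'a)) = 0"
    using W V_0 by (intro sum.neutral) (auto simp: place_index_def)
  then have "(\<Sum>p\<in>place_index W. a (q p)) \<le> 0"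
    using approximating_coefficient_sum[OF W f e \<epsilon>, of q] unfolding zero by simp
  then have "a (q p) \<le> 0"
    using member_le_sum[OF p, of "\<lambda>p. a (q p)"] finite_place_index[OF W(1)] a_nonneg by force
  then show ?thesis using absval_eq_0[OF a] a_nonneg by (metis order.antisym)
qed

lemma small_epsilon:
  assumes "separating W e c" obtains \<epsilon> where "0 < \<epsilon>" "real (card (place_index W)) * \<epsilon> \<le> c / 2"
proof
  have c: "0 < c" using assms by (simp add: separating_def)
  then show "0 < c / (2 * (1 + real (card (place_index W))))" by (simp add: add_pos_nonneg)
  show "real (card (place_index W)) * (c / (2 * (1 + real (card (place_index W))))) \<le> c / 2"
    using c by (simp add: field_simps add_pos_nonneg)
qed

text \<open>An approximating family has as many members as the degrees add up to, and for small
  \<open>\<epsilon>\<close> it is independent over the rationals, so the dimension of the field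
  bounds its size.\<close>

lemma sum_place_degree_le:
  assumes W: "finite W" "W \<subseteq> V"
  shows "(\<Sum>v\<in>W. place_degree v) \<le> n"
proof (rule ccontr)
  let ?I = "place_index W"
  assume "\<not> ?thesis"
  then have gt: "n < card ?I" using W by (simp add: card_place_index)
  obtain e c where e: "separating W e c" using exists_separating[OF W] by blast
  obtain \<epsilon> where \<epsilon>: "0 < \<epsilon>" "real (card ?I) * \<epsilon> \<le> c / 2" using small_epsilon[OF e] by blast
  obtain f where f: "approximating W e \<epsilon> f" using exists_approximating[OF W \<epsilon>(1)] by blast
  obtain h where h: "bij_betw h {..<card ?I} ?I"
    using ex_bij_betw_nat_finite[OF finite_place_index[OF W(1)]] by (auto simp: lessThan_atLeast0)
  obtain q j where q: "j < card ?I" "q j \<noteq> 0" "(\<Sum>j<card ?I. of_rat (q j) * f (h j)) = 0"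
    using exists_linear_relation[OF gt, of "\<lambda>j. f (h j)"] by blast
  define g where "g = inv_into {..<card ?I} h"
  have gh: "g (h j) = j" if "j < card ?I" for j
    unfolding g_def using h that by (simp add: bij_betw_def)
  have "(\<Sum>p\<in>?I. of_rat (q (g p)) * f p) = (\<Sum>j<card ?I. of_rat (q (g (h j))) * f (h j))"
    by (rule sum.reindex_bij_betw[OF h, symmetric])
  also have "\<dots> = 0" using q(3) gh by simp
  finally have "q (g (h j)) = 0"
    using approximating_independent[OF W f e \<epsilon>(2), of "\<lambda>p. q (g p)" "h j"] h q(1)
    by (auto simp: bij_betw_def)
  then show False using q gh by simp
qed

text \<open>Every place contributes degree at least 1, so \<open>n + 1\<close> places would exceed
  the total.\<close>

lemma finite_V: "finite V"
proof (rule ccontr)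
  assume "infinite V"
  then obtain W where W: "finite W" "card W = Suc n" "W \<subseteq> V" by (metis infinite_arbitrarily_large)
  have "card W = (\<Sum>v\<in>W. 1)" by simp
  also have "\<dots> \<le> (\<Sum>v\<in>W. place_degree v)"
  proof (rule sum_mono)
    fix v assume "v \<in> W"
    then have "v \<in> V" using W by blast
    from place_degree_pos[OF this] show "1 \<le> place_degree v" by simp
  qed
  also have "\<dots> \<le> n" using sum_place_degree_le W by blast
  finally show False using W by simp
qed

section \<open>The maximum of the places as a norm on the field\<close>

definition max_place :: "'a \<Rightarrow> real" where
  "max_place x = Max ((\<lambda>v. v x) ` V)"

lemma max_place_ge: "v \<in> V \<Longrightarrow> v x \<le> max_place x"
  unfolding max_place_def using finite_V by (intro Max_ge) auto

lemma max_place_attained: obtains v where "v \<in> V" "max_place x = v x"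
proof -
  have "max_place x \<in> (\<lambda>v. v x) ` V"
    unfolding max_place_def using finite_V V_nonempty by (intro Max_in) auto
  then show thesis using that by auto
qed

lemma max_place_leI: "(\<And>v. v \<in> V \<Longrightarrow> v x \<le> B) \<Longrightarrow> max_place x \<le> B"
  by (metis max_place_attained)

lemma max_place_nonneg: "0 \<le> max_place x"
  using max_place_attained[of x] V_nonneg by metis

lemma max_place_add: "max_place (x + y) \<le> max_place x + max_place y"
proof (rule max_place_leI)
  fix v assume v: "v \<in> V"
  show "v (x + y) \<le> max_place x + max_place y"
    using V_add[OF v, of x y] max_place_ge[OF v, of x] max_place_ge[OF v, of y] by linarith
qed

lemma max_place_mult_le: "max_place (x * y) \<le> max_place x * max_place y"
proof (rule max_place_leI)
  fix v assume v: "v \<in> V"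
  show "v (x * y) \<le> max_place x * max_place y"
    unfolding V_mult[OF v]
    by (intro mult_mono max_place_ge[OF v] V_nonneg[OF v] max_place_nonneg)
qed

lemma max_place_scale: "max_place (of_rat q * x) = a q * max_place x"
proof (rule antisym)
  show "max_place (of_rat q * x) \<le> a q * max_place x"
    using max_place_ge a_nonneg by (intro max_place_leI) (simp add: V_scale mult_left_mono)
  obtain v where "v \<in> V" "max_place x = v x" using max_place_attained .
  then show "a q * max_place x \<le> max_place (of_rat q * x)"
    using max_place_ge[of v "of_rat q * x"] by (simp add: V_scale)
qed

lemma max_place_of_rat: "max_place (of_rat q) = a q"
  using max_place_attained[of "of_rat q"] V_of_rat by metis

text \<open>Otherwise some \<open>t\<close> slightly above \<open>max_place y\<close> still has
  \<open>t ^ n\<close> below the value of the norm, and the construction of places yields one at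
  which \<open>y\<close> has value at least \<open>t\<close>. That construction inverts
  \<open>y\<close>, so \<open>y = 0\<close> is treated apart.\<close>

lemma field_norm_le_max_place: "a (field_norm y) \<le> max_place y ^ n"
proof (cases "y = 0")
  case True
  have "field_norm y * field_norm y = 0 \<Longrightarrow> ?thesis"
    using absval_0[OF a] max_place_nonneg[of y] by simp
  moreover have "field_norm (0::'a) = 0"
  proof -
    have "mult_mat 0 = 0\<^sub>m n n" by (intro eq_matI) (auto simp: mult_mat_def coord_0)
    then show ?thesis using dim_pos by (simp add: field_norm_def)
  qed
  ultimately show ?thesis using True by simp
next
  case y: False
  show ?thesis
  proof (rule ccontr)
    assume "\<not> ?thesis"
    then have lt: "max_place y ^ n < a (field_norm y)" by simp
    have "\<exists>t>max_place y. t ^ n < a (field_norm y)"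
    proof -
      have "((\<lambda>t. t ^ n) \<longlongrightarrow> max_place y ^ n) (at_right (max_place y))"
        by (intro tendsto_intros)
      then have "\<forall>\<^sub>F t in at_right (max_place y). t ^ n < a (field_norm y)"
        using lt by (rule order_tendstoD)
      then have "\<forall>\<^sub>F t in at_right (max_place y). t > max_place y \<and> t ^ n < a (field_norm y)"
        using eventually_at_right_less by eventually_elim auto
      then show ?thesis using eventually_happens trivial_limit_at_right_real by blast
    qed
    then obtain t where t: "max_place y < t" "t ^ n < a (field_norm y)" by blast
    obtain v where "v \<in> V" "t \<le> v y"
      using place_above_norm[OF y _ t(2)] t(1) max_place_nonneg[of y] by auto
    then show False using t(1) max_place_ge[of v y] by simp
  qed
qed

text \<open>
  The trace is a coefficient of the polynomial \<open>q \<mapsto> N (q + y)\<close>; for \<open>y\<close> scaled to have size about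
  \<open>1\<close> its values at \<open>0, \<dots>, n\<close> are bounded by the previous lemma.
\<close>

lemma field_trace_bound:
  obtains C where "\<And>y. a (field_trace y) \<le> C * max_place y"
proof -
  obtain C where C: "\<And>P B k. degree P \<le> n \<Longrightarrow> (\<And>i. i \<le> n \<Longrightarrow> a (poly P (of_nat i)) \<le> B) \<Longrightarrow>
      a (coeff P k) \<le> C * B" using poly_coeff_bound_by_values[OF a, of n] by blast
  obtain Q where Q: "1 < Q" "\<And>s. 0 < s \<Longrightarrow> \<exists>q. q \<noteq> 0 \<and> a q < s \<and> s \<le> a q * Q"
    using rat_scaling by blast
  define B where "B = C * (real n + 1) ^ n"
  have small: "a (field_trace y) \<le> B" if y: "max_place y \<le> 1" for y
  proof -
    obtain P where P: "degree P \<le> n" "coeff P (n - 1) = field_trace y"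
        "\<And>q. poly P q = field_norm (of_rat q + y)"
      using field_norm_shift_poly by metis
    have "a (poly P (of_nat i)) \<le> (real n + 1) ^ n" if i: "i \<le> n" for i
    proof -
      have "a (poly P (of_nat i)) \<le> max_place (of_rat (of_nat i) + y) ^ n"
        unfolding P(3) by (rule field_norm_le_max_place)
      also have "\<dots> \<le> (real n + 1) ^ n"
      proof (intro power_mono max_place_nonneg)
        have "max_place (of_rat (of_nat i) + y) \<le> a (of_nat i) + max_place y"
          using max_place_add[of "of_rat (of_nat i)" y] unfolding max_place_of_rat .
        moreover have "a (of_nat i) \<le> real n" using absval_of_nat_le[OF a, of i] i by linarith
        ultimately show "max_place (of_rat (of_nat i) + y) \<le> real n + 1" using y by linarith
      qed
      finally show ?thesis .
    qed
    then show ?thesis using C[OF P(1), of _ "n - 1"] unfolding P(2) B_def by blast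
  qed
  have "a (field_trace y) \<le> B * Q * max_place y" for y
  proof (cases "y = 0")
    case True
    have "field_trace 0 = 0" using field_trace_scale[of 0 0] by simp
    moreover have "max_place 0 = 0" using max_place_of_rat[of 0] absval_0[OF a] by simp
    ultimately show ?thesis using True absval_0[OF a] by simp
  next
    case False
    have "0 < max_place y"
      using V_nonempty V_pos[OF _ False] max_place_ge by (metis all_not_in_conv less_le_trans)
    then have pos: "0 < 1 / max_place y" by simp
    \<comment> \<open>Rational scaling brings \<open>y\<close> to a maximum between
      \<open>1 / Q\<close> and 1, so the bound for small elements loses only the factor
      \<open>Q\<close>.\<close>
    then obtain q where q: "q \<noteq> 0" "a q < 1 / max_place y" "1 / max_place y \<le> a q * Q"
      using Q(2) by blast
    have "a q * max_place y \<le> 1" using q(2) pos by (simp add: field_simps)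
    then have "a q * a (field_trace y) \<le> B"
      using small[of "of_rat q * y"] by (simp add: max_place_scale field_trace_scale absval_mult[OF a])
    moreover have B0: "0 \<le> B" using calculation a_nonneg by (metis mult_nonneg_nonneg order_trans)
    have aq: "0 < a q" using absval_pos[OF a q(1)] .
    ultimately have "a (field_trace y) \<le> B * (1 / a q)" by (simp add: field_simps)
    also have "1 / a q \<le> Q * max_place y" using q(3) aq \<open>0 < max_place y\<close> by (simp add: field_simps)
    finally show ?thesis using B0 by (simp add: mult_left_mono mult.assoc)
  qed
  then show thesis using that by blast
qed

text \<open>Coordinates are fixed combinations of the traces of \<open>b i * x\<close>, and traces
  are dominated by \<open>max_place\<close>. This is the half of norm equivalence from which the
  degrees are bounded below.\<close>

lemma coord_bound:
  obtains C where "0 < C" "\<And>i x. i < n \<Longrightarrow> a (coord i x) \<le> C * max_place x"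
proof -
  obtain C where C: "\<And>y. a (field_trace y) \<le> C * max_place y" using field_trace_bound by blast
  obtain W where W: "\<And>x j. j < n \<Longrightarrow> coord j x = (\<Sum>i<n. W j i * field_trace (b i * x))"
    using coord_eq_trace_combination by blast
  have C0: "0 \<le> C"
    using C[of 1] a_nonneg[of "field_trace 1"] max_place_of_rat[of 1] absval_1[OF a] by simp
  define K where "K = (\<Sum>j<n. \<Sum>i<n. a (W j i) * (C * max_place (b i)))"
  have nn: "0 \<le> a (W j i) * (C * max_place (b i))" for i j
    using C0 a_nonneg max_place_nonneg by simp
  have "a (coord j x) \<le> (K + 1) * max_place x" if j: "j < n" for j x
  proof -
    have "a (coord j x) \<le> (\<Sum>i<n. a (W j i * field_trace (b i * x)))"
      unfolding W[OF j] by (rule absval_sum_le[OF a])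
    also have "\<dots> \<le> (\<Sum>i<n. a (W j i) * (C * max_place (b i)) * max_place x)"
    proof (rule sum_mono)
      fix i
      have "a (field_trace (b i * x)) \<le> C * (max_place (b i) * max_place x)"
        using C[of "b i * x"] mult_left_mono[OF max_place_mult_le[of "b i" x] C0] by linarith
      then show "a (W j i * field_trace (b i * x)) \<le> a (W j i) * (C * max_place (b i)) * max_place x"
        using mult_left_mono[OF _ a_nonneg[of "W j i"]] by (simp add: absval_mult[OF a] mult.assoc)
    qed
    also have "\<dots> = (\<Sum>i<n. a (W j i) * (C * max_place (b i))) * max_place x"
      by (rule sum_distrib_right[symmetric])
    also have "\<dots> \<le> (K + 1) * max_place x"
    proof (intro mult_right_mono max_place_nonneg)
      have "(\<Sum>i<n. a (W j i) * (C * max_place (b i))) \<le> K"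
        unfolding K_def using j nn
        by (intro member_le_sum[of j _ "\<lambda>j. \<Sum>i<n. a (W j i) * (C * max_place (b i))"] sum_nonneg) auto
      then show "(\<Sum>i<n. a (W j i) * (C * max_place (b i))) \<le> K + 1" by simp
    qed
    finally show ?thesis .
  qed
  moreover have "0 < K + 1" using nn by (auto simp: K_def intro!: add_nonneg_pos sum_nonneg)
  ultimately show thesis using that by blast
qed

text \<open>Suppose the total degree is below \<open>n\<close>. Each \<open>b j\<close> is
  approximated at all places at once by a rational combination \<open>y j\<close> of a family with
  fewer than \<open>n\<close> members, so the \<open>y j\<close> satisfy a nontrivial relation
  \<open>q\<close>. Then \<open>x\<close>, the same combination of the \<open>b j\<close>, is a
  combination of the small differences \<open>b j - y j\<close>, smaller than
  \<open>coord_bound\<close> allows for its coordinates \<open>q j\<close>.\<close>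

theorem sum_place_degree: "(\<Sum>v\<in>V. place_degree v) = n"
proof (rule antisym)
  let ?I = "place_index V"
  show "(\<Sum>v\<in>V. place_degree v) \<le> n" using sum_place_degree_le finite_V by blast
  show "n \<le> (\<Sum>v\<in>V. place_degree v)"
  proof (rule ccontr)
    assume "\<not> ?thesis"
    then have lt: "card ?I < n" by (simp add: card_place_index finite_V)
    obtain C where C: "0 < C" "\<And>i x. i < n \<Longrightarrow> a (coord i x) \<le> C * max_place x" using coord_bound by blast
    \<comment> \<open>Summing \<open>n\<close> coordinate bounds gives a total
      \<open>T \<le> n * C * \<delta> * T\<close>, and this \<open>\<delta>\<close> makes the factor
      one half.\<close>
    define \<delta> where "\<delta> = 1 / (2 * real n * C)"
    have \<delta>: "0 < \<delta>" using C(1) dim_pos by (simp add: \<delta>_def)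
    obtain e c where e: "separating V e c" using exists_separating finite_V by blast
    have "\<exists>r. \<forall>v\<in>V. v (b j - (\<Sum>l<place_degree v. of_rat (r (v, l)) * e v l)) < \<delta> / 2" for j
    proof -
      have "\<exists>q. v (b j - (\<Sum>l<place_degree v. of_rat (q l) * e v l)) < \<delta> / 2" if "v \<in> V" for v
        using stably_independent_dense[OF that, of "e v" "\<delta> / 2" "b j"] e that \<delta>
        by (auto simp: separating_def)
      then obtain s where "\<And>v. v \<in> V \<Longrightarrow> v (b j - (\<Sum>l<place_degree v. of_rat (s v l) * e v l)) < \<delta> / 2"
        by metis
      then show ?thesis by (intro exI[of _ "\<lambda>(v, l). s v l"]) simp
    qed
    then obtain r where r: "\<And>j v. v \<in> V \<Longrightarrow>
        v (b j - (\<Sum>l<place_degree v. of_rat (r j (v, l)) * e v l)) < \<delta> / 2" by metis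
    define R where "R = (\<Sum>j<n. \<Sum>p\<in>?I. a (r j p))"
    have R: "(\<Sum>p\<in>?I. a (r j p)) \<le> R" if "j < n" for j
      unfolding R_def using that
      by (intro member_le_sum[of j _ "\<lambda>j. \<Sum>p\<in>?I. a (r j p)"] sum_nonneg a_nonneg) auto
    have R0: "0 \<le> R" unfolding R_def by (intro sum_nonneg a_nonneg)
    \<comment> \<open>The family \<open>f\<close> is chosen after the coefficients \<open>r\<close>,
      so its precision may depend on their total size \<open>R\<close>; together with the local
      approximation error \<open>\<delta> / 2\<close> this gives \<open>\<delta>\<close>.\<close>
    define \<epsilon> where "\<epsilon> = \<delta> / (2 * (R + 1))"
    have \<epsilon>: "0 < \<epsilon>" "\<epsilon> * R \<le> \<delta> / 2" using \<delta> R0 by (simp_all add: \<epsilon>_def field_simps)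
    obtain f where f: "approximating V e \<epsilon> f" using exists_approximating[OF finite_V _ \<epsilon>(1)] by blast
    define y where "y j = (\<Sum>p\<in>?I. of_rat (r j p) * f p)" for j
    have near: "max_place (b j - y j) \<le> \<delta>" if j: "j < n" for j
    proof (rule max_place_leI)
      fix v assume v: "v \<in> V"
      define s where "s = (\<Sum>l<place_degree v. of_rat (r j (v, l)) * e v l)"
      have "v (s - y j) \<le> \<epsilon> * (\<Sum>p\<in>?I. a (r j p))"
        unfolding s_def y_def by (rule approximating_perturbation[OF finite_V order_refl f v])
      also have "\<dots> \<le> \<epsilon> * R" using \<epsilon>(1) R[OF j] by (intro mult_left_mono) auto
      finally have "v (s - y j) \<le> \<delta> / 2" using \<epsilon>(2) by simp
      moreover have "v (b j - s) < \<delta> / 2" unfolding s_def by (rule r[OF v])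
      moreover have "v (b j - y j) \<le> v (b j - s) + v (s - y j)" using V_add[OF v, of "b j - s" "s - y j"] by simp
      ultimately show "v (b j - y j) \<le> \<delta>" by linarith
    qed
    obtain h where h: "bij_betw h {..<card ?I} ?I"
      using ex_bij_betw_nat_finite[OF finite_place_index[OF finite_V]] by (auto simp: lessThan_atLeast0)
    obtain q where q: "\<exists>j<n. q j \<noteq> 0" "\<forall>i<card ?I. (\<Sum>j<n. r j (h i) * q j) = 0"
      using exists_nontrivial_kernel[OF lt, of "\<lambda>i j. r j (h i)"] by blast
    have q': "(\<Sum>j<n. q j * r j p) = 0" if "p \<in> ?I" for p
    proof -
      obtain i where "i < card ?I" "p = h i" using h \<open>p \<in> ?I\<close> by (auto simp: bij_betw_def)
      then show ?thesis using q(2) by (simp add: mult.commute)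
    qed
    have "(\<Sum>j<n. of_rat (q j) * y j) = (\<Sum>p\<in>?I. of_rat (\<Sum>j<n. q j * r j p) * f p)"
      unfolding y_def sum_distrib_left by (subst sum.swap) (simp add: of_rat_sum of_rat_mult sum_distrib_right mult.assoc)
    also have "\<dots> = 0" using q' by simp
    finally have "(\<Sum>j<n. of_rat (q j) * b j) = (\<Sum>j<n. of_rat (q j) * (b j - y j))"
      by (simp add: right_diff_distrib sum_subtractf)
    moreover define x where "x = (\<Sum>j<n. of_rat (q j) * b j)"
    ultimately have x: "x = (\<Sum>j<n. of_rat (q j) * (b j - y j))" by simp
    define T where "T = (\<Sum>j<n. a (q j))"
    have "max_place x \<le> T * \<delta>"
    proof (rule max_place_leI)
      fix v assume v: "v \<in> V"
      have "v x \<le> (\<Sum>j<n. a (q j) * v (b j - y j))" unfolding x by (rule V_sum_scale_le[OF v])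
      also have "\<dots> \<le> (\<Sum>j<n. a (q j) * \<delta>)"
        using near max_place_ge[OF v] by (intro sum_mono mult_left_mono a_nonneg) (auto intro: order_trans)
      finally show "v x \<le> T * \<delta>" by (simp add: T_def sum_distrib_right)
    qed
    moreover have "a (q i) \<le> C * max_place x" if "i < n" for i
      using C(2)[OF that, of x] coord_eqI[of q x i] that by (simp add: x_def)
    ultimately have "a (q i) \<le> C * (T * \<delta>)" if "i < n" for i
      using that C(1) by (meson less_imp_le mult_left_mono order_trans)
    then have "T \<le> (\<Sum>i<n. C * (T * \<delta>))" unfolding T_def[of] by (intro sum_mono) auto
    also have "\<dots> = T / 2" using C(1) dim_pos by (simp add: \<delta>_def field_simps)
    finally have "T \<le> 0" by simp
    obtain j where j: "j < n" "q j \<noteq> 0" using q(1) by blast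
    have "a (q j) \<le> T" unfolding T_def using j by (intro member_le_sum) (auto simp: a_nonneg)
    then show False using \<open>T \<le> 0\<close> absval_pos[OF a j(2)] by simp
  qed
qed

text \<open>In an approximating basis the row of index \<open>(v, l)\<close> of the multiplication
  matrix of \<open>y\<close> is bounded by \<open>K\<close> times \<open>v y\<close>. The basis and
  \<open>\<epsilon>\<close> vary with \<open>y\<close> but \<open>K\<close> does not, so the
  resulting estimate can be applied to all powers of \<open>x\<close>.\<close>

lemma norm_le_prod_places:
  assumes x: "x \<noteq> 0"
  shows "a (field_norm x) \<le> (\<Prod>v\<in>V. v x ^ place_degree v)"
proof -
  let ?I = "place_index V"
  note W = finite_V order_refl[of V]
  have card: "card ?I = n" by (simp add: card_place_index finite_V sum_place_degree)
  obtain e c where e: "separating V e c" using exists_separating finite_V by blast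
  have c: "0 < c" using e by (simp add: separating_def)
  obtain h where h: "bij_betw h {..<n} ?I"
    using ex_bij_betw_nat_finite[OF finite_place_index[OF finite_V]] by (auto simp: lessThan_atLeast0 card)
  have hI: "h j \<in> ?I" if "j < n" for j using h that by (auto simp: bij_betw_def)
  obtain \<epsilon>0 where \<epsilon>0: "0 < \<epsilon>0" "real n * \<epsilon>0 \<le> c / 2" using small_epsilon[OF e] unfolding card by blast
  \<comment> \<open>\<open>F\<close> bounds the members of every approximating family with
    \<open>\<epsilon> \<le> 1\<close> at all places: such a vector is within 1 of the given
    \<open>e\<close> at its own place and within 1 of 0 elsewhere.\<close>
  define F where "F = 1 + (\<Sum>v\<in>V. \<Sum>p\<in>?I. v (e (fst p) (snd p)))"
  have F1: "1 \<le> F" unfolding F_def using V_nonneg by (auto intro!: sum_nonneg)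
  define K where "K = 2 * F / c"
  have K: "0 < K" using F1 c by (simp add: K_def)
  have power_bound: "a (field_norm y) \<le> fact n * K ^ n * (\<Prod>v\<in>V. v y ^ place_degree v)" if y: "y \<noteq> 0" for y
  proof -
    define S where "S = (\<Sum>p\<in>?I. fst p y)"
    define m where "m = Min ((\<lambda>v. v y) ` V)"
    have m: "m \<le> v y" if "v \<in> V" for v unfolding m_def using finite_V that by (intro Min_le) auto
    have m0: "0 < m" unfolding m_def using finite_V V_nonempty V_pos[OF _ y] by (subst Min_gr_iff) auto
    have S0: "0 \<le> S" unfolding S_def using V_nonneg by (intro sum_nonneg) (auto simp: place_index_def)
    \<comment> \<open>The error \<open>\<epsilon>\<close> times the sum of coefficients must not
      exceed \<open>v y * F\<close> at any place, hence the bound \<open>m * F\<close> with the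
      least value \<open>m\<close> of \<open>y\<close>; the sum itself is at most
      \<open>2 / c * (S * F)\<close>. Adding 1 keeps the denominator positive.\<close>
    define \<epsilon> where "\<epsilon> = min (min 1 \<epsilon>0) (m * F / (2 / c * (S * F) + 1))"
    have den: "0 < 2 / c * (S * F) + 1" using c S0 F1 by (intro add_nonneg_pos mult_nonneg_nonneg) auto
    have \<epsilon>: "0 < \<epsilon>" "\<epsilon> \<le> 1" "real n * \<epsilon> \<le> c / 2" "\<epsilon> * (2 / c * (S * F)) \<le> m * F"
    proof -
      show "0 < \<epsilon>" using \<epsilon>0 m0 F1 den by (simp add: \<epsilon>_def)
      show "\<epsilon> \<le> 1" by (simp add: \<epsilon>_def)
      have "real n * \<epsilon> \<le> real n * \<epsilon>0" by (intro mult_left_mono) (auto simp: \<epsilon>_def)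
      then show "real n * \<epsilon> \<le> c / 2" using \<epsilon>0(2) by simp
      have "\<epsilon> * (2 / c * (S * F)) \<le> \<epsilon> * (2 / c * (S * F) + 1)"
        using \<open>0 < \<epsilon>\<close> by (intro mult_left_mono) auto
      also have "\<dots> \<le> m * F / (2 / c * (S * F) + 1) * (2 / c * (S * F) + 1)"
        using den by (intro mult_right_mono) (auto simp: \<epsilon>_def)
      finally show "\<epsilon> * (2 / c * (S * F)) \<le> m * F" using den by simp
    qed
    have \<epsilon>c: "real (card ?I) * \<epsilon> \<le> c / 2" using \<epsilon>(3) by (simp add: card)
    obtain f where f: "approximating V e \<epsilon> f" using exists_approximating[OF W \<epsilon>(1)] by blast
    have fF: "v (f p) \<le> F" if v: "v \<in> V" and p: "p \<in> ?I" for v p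
    proof (cases "fst p = v")
      case True
      have "v (e (fst p) (snd p)) \<le> (\<Sum>p\<in>?I. v (e (fst p) (snd p)))"
        using V_nonneg[OF v] finite_place_index[OF finite_V] p by (intro member_le_sum) auto
      also have "\<dots> \<le> (\<Sum>v\<in>V. \<Sum>p\<in>?I. v (e (fst p) (snd p)))"
        using v finite_V V_nonneg
        by (intro member_le_sum[of v _ "\<lambda>v. \<Sum>p\<in>?I. v (e (fst p) (snd p))"]) (auto intro: sum_nonneg)
      finally have "1 + v (e (fst p) (snd p)) \<le> F" by (simp add: F_def)
      moreover have "v (f p - e (fst p) (snd p)) \<le> \<epsilon>"
        using f p True by (auto simp: approximating_def)
      moreover have "v (f p) \<le> v (f p - e (fst p) (snd p)) + v (e (fst p) (snd p))"
        using V_add[OF v, of "f p - e (fst p) (snd p)" "e (fst p) (snd p)"] by simp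
      ultimately show ?thesis using \<epsilon>(2) by linarith
    next
      case False
      then have "v (f p) \<le> \<epsilon>" using f p v by (auto simp: approximating_def)
      then show ?thesis using \<epsilon>(2) F1 by linarith
    qed
    define g where "g = inv_into {..<n} h"
    have gh: "g (h j) = j" if "j < n" for j
      unfolding g_def using h that by (simp add: bij_betw_def)
    have reindex: "(\<Sum>p\<in>?I. of_rat (q (g p)) * f p) = (\<Sum>j<n. of_rat (q j) * f (h j))" for q
      using sum.reindex_bij_betw[OF h, of "\<lambda>p. of_rat (q (g p)) * f p"] gh by simp
    obtain coord' where B': "rat_basis n (\<lambda>j. f (h j)) coord'"
    proof (rule independent_family_rat_basis)
      fix q assume "(\<Sum>j<n. of_rat (q j) * f (h j)) = 0"
      then have "(\<Sum>p\<in>?I. of_rat (q (g p)) * f p) = 0" by (simp add: reindex)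
      then have "q (g (h j)) = 0" if "j < n" for j
        using approximating_independent[OF W f e \<epsilon>c, of "\<lambda>p. q (g p)"] hI[OF that] by blast
      then show "\<forall>j<n. q j = 0" using gh by simp
    qed blast
    interpret B': rat_basis n "\<lambda>j. f (h j)" coord' by (rule B')
    have "a (field_norm y) \<le> fact n * (\<Prod>i<n. K * fst (h i) y)"
      unfolding field_norm_basis_independent[OF B']
    proof (rule absval_det_le[OF a])
      fix i j assume ij: "i < n" "j < n"
      obtain v l where vl: "h i = (v, l)" by force
      have v: "v \<in> V" and vlI: "(v, l) \<in> ?I" using hI[OF ij(1)] vl by (auto simp: place_index_def)
      define z where "z = y * f (h j)"
      have ex: "(\<Sum>p\<in>?I. of_rat (coord' (g p) z) * f p) = z"
        unfolding reindex[of "\<lambda>i. coord' i z"] by (rule B'.expand)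
      define T where "T = (\<Sum>p\<in>?I. a (coord' (g p) z))"
      have zle: "w z \<le> w y * F" if "w \<in> V" for w
        unfolding z_def V_mult[OF that] using fF[OF that hI[OF ij(2)]] V_nonneg[OF that]
        by (intro mult_left_mono) auto
      have "T \<le> 2 / c * (\<Sum>p\<in>?I. fst p z)"
        using approximating_coefficient_sum[OF W f e \<epsilon>c, of "\<lambda>p. coord' (g p) z"] unfolding ex T_def .
      also have "\<dots> \<le> 2 / c * (\<Sum>p\<in>?I. fst p y * F)"
        using c zle by (intro mult_left_mono sum_mono) (auto simp: place_index_def)
      finally have T: "T \<le> 2 / c * (S * F)" by (simp add: S_def sum_distrib_right)
      have "c * a (coord' (g (v, l)) z) \<le> v z + \<epsilon> * T"
        using approximating_coefficient[OF W f e vlI, of "\<lambda>p. coord' (g p) z"] unfolding ex T_def .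
      also have "\<epsilon> * T \<le> \<epsilon> * (2 / c * (S * F))" using T \<epsilon>(1) by (intro mult_left_mono) auto
      also have "\<dots> \<le> m * F" by (rule \<epsilon>(4))
      also have "\<dots> \<le> v y * F" using m[OF v] F1 by (intro mult_right_mono) auto
      finally have "c * a (coord' (g (v, l)) z) \<le> 2 * (v y * F)" using zle[OF v] by linarith
      moreover have "g (v, l) = i" using gh[OF ij(1)] vl by simp
      ultimately show "a (mat n n (\<lambda>(i, j). coord' i (y * f (h j))) $$ (i, j)) \<le> K * fst (h i) y"
        using ij c vl by (simp add: K_def z_def field_simps)
    qed simp
    also have "(\<Prod>i<n. K * fst (h i) y) = K ^ n * (\<Prod>p\<in>?I. fst p y)"
      using prod.reindex_bij_betw[OF h, of "\<lambda>p. fst p y"] by (simp add: prod.distrib)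
    also have "(\<Prod>p\<in>?I. fst p y) = (\<Prod>v\<in>V. \<Prod>l<place_degree v. v y)"
      unfolding place_index_def using finite_V by (subst prod.Sigma) (auto simp: case_prod_beta)
    finally show ?thesis by (simp add: mult.assoc)
  qed
  show ?thesis
  proof (rule le_if_powers_le[OF a_nonneg])
    show "0 < (\<Prod>v\<in>V. v x ^ place_degree v)" using V_pos[OF _ x] by (intro prod_pos) auto
    fix m
    have "a (field_norm x) ^ m = a (field_norm (x ^ m))" by (simp add: field_norm_power absval_power[OF a])
    also have "\<dots> \<le> fact n * K ^ n * (\<Prod>v\<in>V. v (x ^ m) ^ place_degree v)"
      using x by (intro power_bound) simp
    also have "(\<Prod>v\<in>V. v (x ^ m) ^ place_degree v) = (\<Prod>v\<in>V. v x ^ place_degree v) ^ m"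
      unfolding prod_power_distrib by (intro prod.cong) (auto simp: V_power mult.commute simp flip: power_mult)
    finally show "a (field_norm x) ^ m \<le> fact n * K ^ n * (\<Prod>v\<in>V. v x ^ place_degree v) ^ m" .
  qed
qed

theorem local_norm_formula:
  assumes x: "x \<noteq> 0"
  shows "(\<Prod>v\<in>V. v x ^ place_degree v) = a (field_norm x)"
proof (rule antisym)
  let ?P = "\<lambda>x. \<Prod>v\<in>V. v x ^ place_degree v"
  show "a (field_norm x) \<le> ?P x" by (rule norm_le_prod_places[OF x])
  have N: "a (field_norm x) * a (field_norm (inverse x)) = 1"
    using field_norm_inverse[OF x] absval_1[OF a] by (simp flip: absval_mult[OF a])
  have P: "?P x * ?P (inverse x) = 1"
    unfolding prod.distrib[symmetric] using V_pos[OF _ x]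
    by (intro prod.neutral ballI) (simp add: V_inverse less_imp_neq[THEN not_sym] flip: power_mult_distrib)
  have "0 \<le> ?P x" using V_nonneg by (intro prod_nonneg) simp
  have "?P x = ?P x * a (field_norm x) * a (field_norm (inverse x))" using N by (simp only: mult.assoc mult_1_right)
  also have "\<dots> \<le> ?P x * a (field_norm x) * ?P (inverse x)"
    using x \<open>0 \<le> ?P x\<close> a_nonneg by (intro mult_left_mono norm_le_prod_places mult_nonneg_nonneg) auto
  also have "\<dots> = a (field_norm x) * (?P x * ?P (inverse x))" by (simp only: mult_ac)
  also have "\<dots> = a (field_norm x)" by (simp only: P mult_1_right)
  finally show "?P x \<le> a (field_norm x)" .
qed

end

section \<open>Local degrees\<close>

context
  fixes v :: "'a::field_char_0 \<Rightarrow> real"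
  assumes v: "absolute_value v"
begin

lemma cauchy_seqsI: "(\<And>e. 0 < e \<Longrightarrow> \<exists>N. \<forall>m\<ge>N. \<forall>n\<ge>N. v (x m - x n) < e) \<Longrightarrow> x \<in> cauchy_seqs v"
  by (simp add: cauchy_seqs_def)

lemma cauchy_seqsD: "x \<in> cauchy_seqs v \<Longrightarrow> 0 < e \<Longrightarrow> \<exists>N. \<forall>m\<ge>N. \<forall>n\<ge>N. v (x m - x n) < e"
  by (simp add: cauchy_seqs_def)

lemma null_seqs_iff: "x \<in> null_seqs v \<longleftrightarrow> (\<forall>e>0. \<exists>N. \<forall>n\<ge>N. v (x n) < e)"
  by (simp add: null_seqs_def LIMSEQ_iff absval_nonneg[OF v])

lemma const_cauchy: "(\<lambda>_. c) \<in> cauchy_seqs v"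
  by (simp add: cauchy_seqs_def absval_0[OF v])

lemma cauchy_bounded:
  assumes "x \<in> cauchy_seqs v" obtains B where "0 < B" "\<And>n. v (x n) \<le> B"
proof -
  obtain N where N: "\<And>m n. m \<ge> N \<Longrightarrow> n \<ge> N \<Longrightarrow> v (x m - x n) < 1"
    using cauchy_seqsD[OF assms, of 1] by auto
  define B where "B = 1 + (\<Sum>n\<le>N. v (x n))"
  have nn: "0 \<le> (\<Sum>n\<le>N. v (x n))" by (simp add: sum_nonneg absval_nonneg[OF v])
  have le: "v (x n) \<le> (\<Sum>n\<le>N. v (x n))" if "n \<le> N" for n
    using that by (intro member_le_sum) (auto simp: absval_nonneg[OF v])
  have "v (x n) \<le> B" for n
  proof (cases "n \<le> N")
    case True
    then show ?thesis using le by (simp add: B_def add_increasing)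
  next
    case False
    then have "v (x n - x N) < 1" using N by simp
    then show ?thesis using absval_add[OF v, of "x n - x N" "x N"] le[of N] by (simp add: B_def)
  qed
  then show thesis using that[of B] nn by (simp add: B_def)
qed

lemma cauchy_add:
  assumes x: "x \<in> cauchy_seqs v" and y: "y \<in> cauchy_seqs v"
  shows "(\<lambda>n. x n + y n) \<in> cauchy_seqs v"
proof (rule cauchy_seqsI)
  fix e :: real assume "0 < e"
  then obtain N N' where N: "\<forall>m\<ge>N. \<forall>n\<ge>N. v (x m - x n) < e / 2" "\<forall>m\<ge>N'. \<forall>n\<ge>N'. v (y m - y n) < e / 2"
    using cauchy_seqsD[OF x] cauchy_seqsD[OF y] half_gt_zero by blast
  have "v (x m + y m - (x n + y n)) < e" if "m \<ge> max N N'" "n \<ge> max N N'" for m n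
  proof -
    have "v (x m + y m - (x n + y n)) \<le> v (x m - x n) + v (y m - y n)"
      using absval_add[OF v, of "x m - x n" "y m - y n"] by (simp add: algebra_simps)
    then show ?thesis using N that by (smt (verit) field_sum_of_halves max.bounded_iff)
  qed
  then show "\<exists>N. \<forall>m\<ge>N. \<forall>n\<ge>N. v (x m + y m - (x n + y n)) < e" by blast
qed

lemma cauchy_mult:
  assumes x: "x \<in> cauchy_seqs v" and y: "y \<in> cauchy_seqs v"
  shows "(\<lambda>n. x n * y n) \<in> cauchy_seqs v"
proof (rule cauchy_seqsI)
  fix e :: real assume e: "0 < e"
  obtain B where B: "0 < B" "\<And>n. v (x n) \<le> B" using cauchy_bounded[OF x] by blast
  obtain C where C: "0 < C" "\<And>n. v (y n) \<le> C" using cauchy_bounded[OF y] by blast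
  obtain N where N: "\<And>m n. m \<ge> N \<Longrightarrow> n \<ge> N \<Longrightarrow> v (x m - x n) < e / (2 * C)"
    using cauchy_seqsD[OF x, of "e / (2 * C)"] e C by auto
  obtain N' where N': "\<And>m n. m \<ge> N' \<Longrightarrow> n \<ge> N' \<Longrightarrow> v (y m - y n) < e / (2 * B)"
    using cauchy_seqsD[OF y, of "e / (2 * B)"] e B by auto
  have "v (x m * y m - x n * y n) < e" if mn: "m \<ge> max N N'" "n \<ge> max N N'" for m n
  proof -
    have "x m * y m - x n * y n = x m * (y m - y n) + (x m - x n) * y n" by (simp add: algebra_simps)
    then have "v (x m * y m - x n * y n) \<le> v (x m) * v (y m - y n) + v (x m - x n) * v (y n)"
      using absval_add[OF v, of "x m * (y m - y n)" "(x m - x n) * y n"] by (simp add: absval_mult[OF v])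
    also have "\<dots> \<le> B * v (y m - y n) + v (x m - x n) * C"
      using B C by (intro add_mono mult_left_mono mult_right_mono absval_nonneg[OF v]) auto
    also have "\<dots> < B * (e / (2 * B)) + e / (2 * C) * C"
      using B C N N' mn by (intro add_strict_mono mult_strict_left_mono mult_strict_right_mono) auto
    finally show ?thesis using B C by simp
  qed
  then show "\<exists>N. \<forall>m\<ge>N. \<forall>n\<ge>N. v (x m * y m - x n * y n) < e" by blast
qed

lemma cauchy_uminus: "x \<in> cauchy_seqs v \<Longrightarrow> (\<lambda>n. - x n) \<in> cauchy_seqs v"
  using cauchy_mult[OF const_cauchy[of "-1"]] by simp

lemma null_add: "x \<in> null_seqs v \<Longrightarrow> y \<in> null_seqs v \<Longrightarrow> (\<lambda>n. x n + y n) \<in> null_seqs v"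
proof -
  assume "x \<in> null_seqs v" "y \<in> null_seqs v"
  then have "(\<lambda>n. v (x n) + v (y n)) \<longlonglongrightarrow> 0"
    unfolding null_seqs_def by (auto intro: tendsto_add_zero)
  then have "(\<lambda>n. v (x n + y n)) \<longlonglongrightarrow> 0"
    by (rule tendsto_sandwich[OF always_eventually always_eventually tendsto_const, rotated 2])
      (simp_all add: absval_nonneg[OF v] absval_add[OF v])
  then show ?thesis by (simp add: null_seqs_def)
qed

lemma null_cauchy: assumes "x \<in> null_seqs v" shows "x \<in> cauchy_seqs v"
proof (rule cauchy_seqsI)
  fix e :: real assume "0 < e"
  then obtain N where N: "\<And>n. n \<ge> N \<Longrightarrow> v (x n) < e / 2"
    using assms unfolding null_seqs_iff by (metis half_gt_zero)
  have "v (x m - x n) < e" if "m \<ge> N" "n \<ge> N" for m n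
    using N[OF that(1)] N[OF that(2)] absval_diff[OF v, of "x m" "x n"] by simp
  then show "\<exists>N. \<forall>m\<ge>N. \<forall>n\<ge>N. v (x m - x n) < e" by blast
qed

lemma null_mult: assumes x: "x \<in> cauchy_seqs v" and y: "y \<in> null_seqs v"
  shows "(\<lambda>n. x n * y n) \<in> null_seqs v"
proof -
  obtain B where B: "0 < B" "\<And>n. v (x n) \<le> B" using cauchy_bounded[OF x] by blast
  have "(\<lambda>n. B * v (y n)) \<longlonglongrightarrow> 0"
    using y unfolding null_seqs_def by (auto intro: tendsto_mult_right_zero)
  then have "(\<lambda>n. v (x n * y n)) \<longlonglongrightarrow> 0"
  proof (rule tendsto_sandwich[OF always_eventually always_eventually tendsto_const, rotated 2])
    show "\<forall>n. v (x n * y n) \<le> B * v (y n)"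
      using B absval_nonneg[OF v] by (auto simp: absval_mult[OF v] intro: mult_right_mono)
  qed (simp add: absval_nonneg[OF v])
  then show ?thesis by (simp add: null_seqs_def)
qed

text \<open>A Cauchy sequence that is not a null sequence is eventually bounded away from zero.\<close>

lemma cauchy_inverse:
  assumes x: "x \<in> cauchy_seqs v" and nn: "x \<notin> null_seqs v"
  shows "(\<lambda>n. inverse (x n)) \<in> cauchy_seqs v" "(\<lambda>n. x n * inverse (x n) - 1) \<in> null_seqs v"
proof -
  obtain e where e: "0 < e" "\<And>N. \<exists>n\<ge>N. e \<le> v (x n)"
    using nn unfolding null_seqs_iff by (meson not_less)
  obtain N where N: "\<And>m n. m \<ge> N \<Longrightarrow> n \<ge> N \<Longrightarrow> v (x m - x n) < e / 2"
    using cauchy_seqsD[OF x, of "e / 2"] e by auto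
  obtain k where k: "k \<ge> N" "e \<le> v (x k)" using e by blast
  have big: "e / 2 \<le> v (x n)" if "n \<ge> N" for n
    using N[OF k(1) that] k(2) absval_add[OF v, of "x k - x n" "x n"] by simp
  have ne: "x n \<noteq> 0" if "n \<ge> N" for n using big[OF that] e absval_0[OF v] by auto
  show "(\<lambda>n. inverse (x n)) \<in> cauchy_seqs v"
  proof (rule cauchy_seqsI)
    fix d :: real assume d: "0 < d"
    obtain M where M: "\<And>m n. m \<ge> M \<Longrightarrow> n \<ge> M \<Longrightarrow> v (x m - x n) < d * (e / 2 * (e / 2))"
      using cauchy_seqsD[OF x, of "d * (e / 2 * (e / 2))"] d e by auto
    have "v (inverse (x m) - inverse (x n)) < d" if mn: "m \<ge> max M N" "n \<ge> max M N" for m n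
    proof -
      have "inverse (x m) - inverse (x n) = (x n - x m) * inverse (x m * x n)"
        using ne mn by (simp add: field_simps)
      then have "v (inverse (x m) - inverse (x n)) = v (x n - x m) / (v (x m) * v (x n))"
        by (simp add: absval_mult[OF v] absval_inverse[OF v] divide_inverse)
      also have "\<dots> \<le> v (x n - x m) / (e / 2 * (e / 2))"
        using big mn e absval_nonneg[OF v]
        by (intro divide_left_mono mult_mono mult_pos_pos) (auto intro: less_le_trans[of 0 "e / 2"])
      also have "\<dots> < d" using M[of n m] mn e by (simp add: field_simps)
      finally show ?thesis .
    qed
    then show "\<exists>N. \<forall>m\<ge>N. \<forall>n\<ge>N. v (inverse (x m) - inverse (x n)) < d" by blast
  qed
  show "(\<lambda>n. x n * inverse (x n) - 1) \<in> null_seqs v"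
    unfolding null_seqs_iff using ne absval_0[OF v] by (auto intro!: exI[of _ N])
qed

lemma cauchy_ring_cring: "cring (cauchy_ring v)"
proof (rule cringI)
  show "abelian_group (cauchy_ring v)"
  proof (rule abelian_groupI)
    fix x assume "x \<in> carrier (cauchy_ring v)"
    then show "\<exists>y\<in>carrier (cauchy_ring v). y \<oplus>\<^bsub>cauchy_ring v\<^esub> x = \<zero>\<^bsub>cauchy_ring v\<^esub>"
      by (intro bexI[of _ "\<lambda>n. - x n"]) (auto simp: cauchy_ring_def cauchy_uminus)
  qed (auto simp: cauchy_ring_def cauchy_add const_cauchy add_ac)
  show "comm_monoid (cauchy_ring v)"
    by (rule comm_monoidI) (auto simp: cauchy_ring_def cauchy_mult const_cauchy mult_ac)
qed (auto simp: cauchy_ring_def distrib_right)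

interpretation R: cring "cauchy_ring v" by (rule cauchy_ring_cring)

lemma cauchy_ring_minus: "x \<in> cauchy_seqs v \<Longrightarrow> \<ominus>\<^bsub>cauchy_ring v\<^esub> x = (\<lambda>n. - x n)"
  by (rule R.minus_equality) (auto simp: cauchy_ring_def cauchy_uminus)

lemma null_ideal: "ideal (null_seqs v) (cauchy_ring v)"
proof (rule idealI[OF R.ring_axioms])
  show "subgroup (null_seqs v) (add_monoid (cauchy_ring v))"
  proof (rule R.add.subgroupI)
    show "null_seqs v \<subseteq> carrier (cauchy_ring v)" using null_cauchy by (auto simp: cauchy_ring_def)
    show "null_seqs v \<noteq> {}"
      using absval_0[OF v] by (auto simp: null_seqs_def intro!: exI[of _ "\<lambda>_. 0"])
    fix x y assume x: "x \<in> null_seqs v"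
    then show "\<ominus>\<^bsub>cauchy_ring v\<^esub> x \<in> null_seqs v"
      using null_cauchy by (simp add: cauchy_ring_minus) (simp add: null_seqs_def absval_minus[OF v])
    assume "y \<in> null_seqs v"
    then show "x \<oplus>\<^bsub>cauchy_ring v\<^esub> y \<in> null_seqs v"
      using x by (simp add: cauchy_ring_def null_add)
  qed
next
  fix x y assume x: "x \<in> null_seqs v" "y \<in> carrier (cauchy_ring v)"
  then show "y \<otimes>\<^bsub>cauchy_ring v\<^esub> x \<in> null_seqs v"
    using null_mult by (simp add: cauchy_ring_def)
  then show "x \<otimes>\<^bsub>cauchy_ring v\<^esub> y \<in> null_seqs v"
    by (simp add: cauchy_ring_def mult.commute)
qed

interpretation I: ideal "null_seqs v" "cauchy_ring v" by (rule null_ideal)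

interpretation Q: cring "completion v"
  unfolding completion_def by (rule I.quotient_is_cring[OF cauchy_ring_cring])

abbreviation seq_class :: "(nat \<Rightarrow> 'a) \<Rightarrow> (nat \<Rightarrow> 'a) set" where
  "seq_class x \<equiv> null_seqs v +>\<^bsub>cauchy_ring v\<^esub> x"

interpretation H: ring_hom_ring "cauchy_ring v" "completion v" seq_class
  unfolding completion_def by (rule I.rcos_ring_hom_ring)

lemma carrier_completion: "carrier (completion v) = seq_class ` cauchy_seqs v"
  by (auto simp: completion_def FactRing_def A_RCOSETS_defs a_r_coset_def[symmetric] cauchy_ring_def
      a_r_coset_def r_coset_def)

lemma seq_class_eq_iff:
  assumes "x \<in> cauchy_seqs v" "y \<in> cauchy_seqs v"
  shows "seq_class x = seq_class y \<longleftrightarrow> (\<lambda>n. x n - y n) \<in> null_seqs v"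
  using R.quotient_eq_iff_same_a_r_cos[OF null_ideal, of x y] assms
  by (simp add: a_minus_def cauchy_ring_minus) (simp add: cauchy_ring_def)

lemma seq_class_eq_zero_iff:
  assumes "x \<in> cauchy_seqs v"
  shows "seq_class x = \<zero>\<^bsub>completion v\<^esub> \<longleftrightarrow> x \<in> null_seqs v"
  using seq_class_eq_iff[OF assms const_cauchy[of 0]] H.hom_zero by (simp add: cauchy_ring_def)

lemma rat_completion_eq: "rat_completion v = seq_class ` {x \<in> cauchy_seqs v. range x \<subseteq> \<rat>}"
  by (auto simp: rat_completion_def)

lemma rat_completion_subfield: "subfield (rat_completion v) (completion v)"
proof -
  have sub: "subring (rat_completion v) (completion v)"
  proof (rule Q.subringI)
    show "rat_completion v \<subseteq> carrier (completion v)"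
      by (auto simp: rat_completion_eq carrier_completion)
    show "\<one>\<^bsub>completion v\<^esub> \<in> rat_completion v"
      using H.hom_one const_cauchy[of 1] by (auto simp: rat_completion_eq cauchy_ring_def)
  next
    fix h assume "h \<in> rat_completion v"
    then obtain x where x: "x \<in> cauchy_seqs v" "range x \<subseteq> \<rat>" "h = seq_class x"
      by (auto simp: rat_completion_eq)
    have "\<ominus>\<^bsub>completion v\<^esub> h = seq_class (\<lambda>n. - x n)"
      using H.hom_a_inv[of x] x by (simp add: cauchy_ring_minus) (simp add: cauchy_ring_def)
    moreover have "range (\<lambda>n. - x n) \<subseteq> \<rat>" using x(2) by (auto intro: Rats_minus_iff[THEN iffD2])
    ultimately show "\<ominus>\<^bsub>completion v\<^esub> h \<in> rat_completion v"
      using cauchy_uminus[OF x(1)] by (auto simp: rat_completion_eq)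
  next
    fix h1 h2 assume "h1 \<in> rat_completion v" "h2 \<in> rat_completion v"
    then obtain x y where x: "x \<in> cauchy_seqs v" "range x \<subseteq> \<rat>" "h1 = seq_class x"
      and y: "y \<in> cauchy_seqs v" "range y \<subseteq> \<rat>" "h2 = seq_class y"
      by (auto simp: rat_completion_eq)
    have "h1 \<otimes>\<^bsub>completion v\<^esub> h2 = seq_class (\<lambda>n. x n * y n)"
      using H.hom_mult[of x y] x y by (simp add: cauchy_ring_def)
    moreover have "range (\<lambda>n. x n * y n) \<subseteq> \<rat>" using x(2) y(2) by (auto intro!: Rats_mult)
    ultimately show "h1 \<otimes>\<^bsub>completion v\<^esub> h2 \<in> rat_completion v"
      using cauchy_mult[OF x(1) y(1)] by (auto simp: rat_completion_eq)
    have "h1 \<oplus>\<^bsub>completion v\<^esub> h2 = seq_class (\<lambda>n. x n + y n)"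
      using H.hom_add[of x y] x y by (simp add: cauchy_ring_def)
    moreover have "range (\<lambda>n. x n + y n) \<subseteq> \<rat>" using x(2) y(2) by (auto intro!: Rats_add)
    ultimately show "h1 \<oplus>\<^bsub>completion v\<^esub> h2 \<in> rat_completion v"
      using cauchy_add[OF x(1) y(1)] by (auto simp: rat_completion_eq)
  qed
  have ne: "\<one>\<^bsub>completion v\<^esub> \<noteq> \<zero>\<^bsub>completion v\<^esub>"
  proof -
    have "(\<lambda>_. 1) \<notin> null_seqs v" using absval_1[OF v] by (simp add: null_seqs_def LIMSEQ_const_iff)
    then show ?thesis
      using seq_class_eq_zero_iff[OF const_cauchy[of 1]] H.hom_one by (simp add: cauchy_ring_def)
  qed
  show ?thesis
  proof (rule Q.subfieldI)
    show "subcring (rat_completion v) (completion v)" by (rule Q.subcringI'[OF sub])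
    interpret S: ring "completion v\<lparr>carrier := rat_completion v\<rparr>" by (rule Q.subring_is_ring[OF sub])
    show "Units (completion v\<lparr>carrier := rat_completion v\<rparr>) = rat_completion v - {\<zero>\<^bsub>completion v\<^esub>}"
    proof (intro equalityI subsetI)
      fix h assume h: "h \<in> Units (completion v\<lparr>carrier := rat_completion v\<rparr>)"
      then obtain g where g: "g \<in> rat_completion v" "g \<otimes>\<^bsub>completion v\<^esub> h = \<one>\<^bsub>completion v\<^esub>"
        and hK: "h \<in> rat_completion v"
        by (auto simp: Units_def)
      have "h \<noteq> \<zero>\<^bsub>completion v\<^esub>"
      proof
        assume "h = \<zero>\<^bsub>completion v\<^esub>"
        then have "g \<otimes>\<^bsub>completion v\<^esub> h = \<zero>\<^bsub>completion v\<^esub>"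
          using g(1) subringE(1)[OF sub] by auto
        then show False using g(2) ne by simp
      qed
      then show "h \<in> rat_completion v - {\<zero>\<^bsub>completion v\<^esub>}" using hK by simp
    next
      fix h assume h: "h \<in> rat_completion v - {\<zero>\<^bsub>completion v\<^esub>}"
      then obtain x where x: "x \<in> cauchy_seqs v" "range x \<subseteq> \<rat>" "h = seq_class x"
        by (auto simp: rat_completion_eq)
      have nn: "x \<notin> null_seqs v" using h x seq_class_eq_zero_iff by auto
      note inv = cauchy_inverse[OF x(1) nn]
      \<comment> \<open>\<open>inverse 0 = 0\<close> may occur at finitely many indices; the product
        with \<open>x\<close> then differs from 1 there only, which changes nothing modulo null
        sequences.\<close>
      define g where "g = seq_class (\<lambda>n. inverse (x n))"
      have "g \<in> rat_completion v"
        using inv(1) x(2) by (auto simp: g_def rat_completion_eq image_subset_iff intro!: imageI Rats_inverse)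
      moreover have "h \<otimes>\<^bsub>completion v\<^esub> g = seq_class (\<lambda>n. x n * inverse (x n))"
        using H.hom_mult[of x "\<lambda>n. inverse (x n)"] x inv(1) by (simp add: cauchy_ring_def g_def)
      moreover have "seq_class (\<lambda>n. x n * inverse (x n)) = seq_class (\<lambda>_. 1)"
        using seq_class_eq_iff[OF cauchy_mult[OF x(1) inv(1)] const_cauchy[of 1]] inv(2) by simp
      moreover have "seq_class (\<lambda>_. 1) = \<one>\<^bsub>completion v\<^esub>"
        using H.hom_one by (simp add: cauchy_ring_def)
      ultimately have hg: "g \<in> rat_completion v" "h \<otimes>\<^bsub>completion v\<^esub> g = \<one>\<^bsub>completion v\<^esub>" by simp_all
      moreover have "g \<otimes>\<^bsub>completion v\<^esub> h = \<one>\<^bsub>completion v\<^esub>"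
        using hg h subringE(1)[OF sub] Q.m_comm[of g h] by auto
      ultimately show "h \<in> Units (completion v\<lparr>carrier := rat_completion v\<rparr>)"
        using h by (auto simp: Units_def)
    qed
  qed
qed

text \<open>\<open>combine\<close> stops at the end of the shorter list, hence the minimum.\<close>

lemma cauchy_ring_combine:
  "R.combine qs us n = (\<Sum>i<min (length qs) (length us). (qs ! i) n * (us ! i) n)"
proof (induction qs us rule: R.combine.induct)
  case (1 q qs u us)
  then show ?case
    by (simp add: sum.lessThan_Suc_shift del: sum.lessThan_Suc) (simp add: cauchy_ring_def)
qed ((simp, simp add: cauchy_ring_def)+)

text \<open>The lower bound defining stable independence passes to limits. For a combination that is
  a null sequence it makes the coefficient sequences null, whence independence. For the difference
  of two terms of an approximating sequence it makes the coefficient sequences Cauchy, so that the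
  limit of the combinations lies in the span.\<close>

lemma local_degree_eqI:
  assumes indep: "stably_independent v d e"
    and dense: "\<And>x \<delta>. 0 < \<delta> \<Longrightarrow> \<exists>q. v (x - (\<Sum>i<d. of_rat (q i) * e i)) < \<delta>"
  shows "local_degree v = d"
proof -
  let ?K = "rat_completion v" and ?L = "carrier (completion v)"
  note K = rat_completion_subfield
  obtain c where c: "0 < c" and ind: "\<And>q j. j < d \<Longrightarrow> c * v (of_rat (q j)) \<le> v (\<Sum>i<d. of_rat (q i) * e i)"
    using indep by (auto simp: stably_independent_def)
  define es where "es = map (\<lambda>i (_::nat). e i) [0..<d]"
  define us where "us = map seq_class es"
  have es: "set es \<subseteq> carrier (cauchy_ring v)"
    by (auto simp: es_def cauchy_ring_def const_cauchy)
  have us: "set us \<subseteq> ?L" using es by (auto simp: us_def)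
  have len: "length us = d" "length es = d" by (simp_all add: us_def es_def)
  have comb: "Q.combine (map seq_class qs) us = seq_class (\<lambda>n. \<Sum>i<d. (qs ! i) n * e i)"
    if "set qs \<subseteq> cauchy_seqs v" "length qs = d" for qs
  proof -
    have "Q.combine (map seq_class qs) us = seq_class (R.combine qs es)"
      unfolding us_def using that es by (intro H.combine_hom) (auto simp: cauchy_ring_def)
    also have "R.combine qs es = (\<lambda>n. \<Sum>i<d. (qs ! i) n * e i)"
      by (rule ext) (simp add: cauchy_ring_combine that(2) len es_def)
    finally show ?thesis .
  qed
  have sums: "(\<lambda>n. \<Sum>i<k. (qs i) n * e i) \<in> cauchy_seqs v" if "\<And>i. i < k \<Longrightarrow> qs i \<in> cauchy_seqs v" for qs k
    using that
  proof (induction k)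
    case (Suc k)
    then show ?case using cauchy_add[OF _ cauchy_mult[OF _ const_cauchy[of "e k"]]] by simp
  qed (simp add: const_cauchy)
  have "Q.independent ?K us"
  proof (rule ccontr)
    assume "\<not> Q.independent ?K us"
    then obtain Ks where Ks: "length Ks = length us" "Q.combine Ks us = \<zero>\<^bsub>completion v\<^esub>"
      "set Ks \<subseteq> ?K" "set Ks \<noteq> {\<zero>\<^bsub>completion v\<^esub>}"
      by (rule Q.dependent_imp_non_trivial_combine[OF K us])
    have "\<exists>q. q \<in> cauchy_seqs v \<and> range q \<subseteq> \<rat> \<and> Ks ! i = seq_class q" if "i < d" for i
    proof -
      have "Ks ! i \<in> ?K" using Ks(1,3) that len nth_mem[of i Ks] by auto
      then show ?thesis by (auto simp: rat_completion_eq)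
    qed
    then obtain q where q: "\<And>i. i < d \<Longrightarrow> q i \<in> cauchy_seqs v \<and> range (q i) \<subseteq> \<rat> \<and> Ks ! i = seq_class (q i)"
      by metis
    have "Ks = map seq_class (map q [0..<d])"
      using Ks(1) len q by (intro nth_equalityI) auto
    then have "Q.combine Ks us = seq_class (\<lambda>n. \<Sum>i<d. q i n * e i)"
      using comb[of "map q [0..<d]"] q by (auto simp: image_subset_iff)
    then have null: "(\<lambda>n. \<Sum>i<d. q i n * e i) \<in> null_seqs v"
      using Ks(2) seq_class_eq_zero_iff[OF sums[of d q]] q by simp
    have "q j \<in> null_seqs v" if j: "j < d" for j
    proof -
      have le: "c * v (q j n) \<le> v (\<Sum>i<d. q i n * e i)" for n
      proof -
        have "\<exists>r. q i n = of_rat r" if "i < d" for i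
          using q[OF that] by (meson Rats_cases range_subsetD)
        then obtain r where r: "\<And>i. i < d \<Longrightarrow> q i n = of_rat (r i)" by metis
        show ?thesis using ind[OF j, of r] r j by simp
      qed
      have "(\<lambda>n. v (\<Sum>i<d. q i n * e i) / c) \<longlonglongrightarrow> 0 / c"
        using null c by (intro tendsto_divide) (auto simp: null_seqs_def)
      then have lim: "(\<lambda>n. v (\<Sum>i<d. q i n * e i) / c) \<longlonglongrightarrow> 0" by simp
      have "(\<lambda>n. v (q j n)) \<longlonglongrightarrow> 0"
      proof (rule tendsto_sandwich[OF _ _ tendsto_const lim])
        have "v (q j n) \<le> v (\<Sum>i<d. q i n * e i) / c" for n
          using le[of n] c by (simp add: field_simps)
        then show "\<forall>\<^sub>F n in sequentially. v (q j n) \<le> v (\<Sum>i<d. q i n * e i) / c" by simp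
      qed (simp add: absval_nonneg[OF v])
      then show ?thesis by (simp add: null_seqs_def)
    qed
    then have "Ks ! j = \<zero>\<^bsub>completion v\<^esub>" if "j < d" for j using q that seq_class_eq_zero_iff by metis
    then have "set Ks \<subseteq> {\<zero>\<^bsub>completion v\<^esub>}" using Ks(1) len by (auto simp: set_conv_nth)
    \<comment> \<open>The nontriviality condition on \<open>Ks\<close> also admits the empty list.
      That is the case \<open>d = 0\<close>, excluded because the empty family is
      independent.\<close>
    then have "Ks = []" using Ks(4) by (cases Ks) auto
    then have "us = []" using Ks(1) by simp
    then show False using \<open>\<not> Q.independent ?K us\<close> by simp
  qed
  moreover have "Q.Span ?K us = ?L"
  proof
    show "Q.Span ?K us \<subseteq> ?L" by (rule Q.Span_in_carrier[OF subfieldE(3)[OF K] us])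
    show "?L \<subseteq> Q.Span ?K us"
    proof
      fix z assume "z \<in> ?L"
      then obtain x where x: "x \<in> cauchy_seqs v" "z = seq_class x" by (auto simp: carrier_completion)
      have "\<exists>q. v (x n - (\<Sum>i<d. of_rat (q i) * e i)) < inverse (real (Suc n))" for n
        by (rule dense) simp
      then obtain q where q: "\<And>n. v (x n - (\<Sum>i<d. of_rat (q n i) * e i)) < inverse (real (Suc n))"
        by metis
      define y where "y n = (\<Sum>i<d. of_rat (q n i) * e i)" for n
      have le: "v (x n - y n) \<le> inverse (real (Suc n))" for n
        unfolding y_def by (rule less_imp_le[OF q])
      have "(\<lambda>n. v (x n - y n)) \<longlonglongrightarrow> 0"
        by (rule tendsto_sandwich[OF always_eventually always_eventually tendsto_const LIMSEQ_inverse_real_of_nat])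
          (intro allI absval_nonneg[OF v] le)+
      then have xy: "(\<lambda>n. x n - y n) \<in> null_seqs v" by (simp add: null_seqs_def)
      have y: "y \<in> cauchy_seqs v"
        using cauchy_add[OF x(1) cauchy_uminus[OF null_cauchy[OF xy]]] by simp
      define Q where "Q i n = (of_rat (q n i) :: 'a)" for i n
      have Qc: "Q i \<in> cauchy_seqs v" if i: "i < d" for i
      proof (rule cauchy_seqsI)
        fix \<delta> :: real assume "0 < \<delta>"
        then obtain N where N: "\<And>m n. m \<ge> N \<Longrightarrow> n \<ge> N \<Longrightarrow> v (y m - y n) < c * \<delta>"
          using cauchy_seqsD[OF y, of "c * \<delta>"] c by auto
        have "v (Q i m - Q i n) < \<delta>" if "m \<ge> N" "n \<ge> N" for m n
        proof -
          have "c * v (Q i m - Q i n) = c * v (of_rat (q m i - q n i))" by (simp add: Q_def of_rat_diff)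
          also have "\<dots> \<le> v (\<Sum>k<d. of_rat (q m k - q n k) * e k)" by (rule ind[OF i])
          also have "(\<Sum>k<d. of_rat (q m k - q n k) * e k) = y m - y n"
            by (simp add: y_def of_rat_diff left_diff_distrib sum_subtractf)
          also have "v \<dots> < c * \<delta>" by (rule N[OF that])
          finally show ?thesis using c by simp
        qed
        then show "\<exists>N. \<forall>m\<ge>N. \<forall>n\<ge>N. v (Q i m - Q i n) < \<delta>" by blast
      qed
      have "z = seq_class y" using seq_class_eq_iff[OF x(1) y] xy x(2) by simp
      also have "y = (\<lambda>n. \<Sum>i<d. (map Q [0..<d] ! i) n * e i)" by (simp add: y_def Q_def fun_eq_iff)
      also have "seq_class \<dots> = Q.combine (map seq_class (map Q [0..<d])) us"
        using comb[of "map Q [0..<d]"] Qc by (auto simp: image_subset_iff)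
      also have "\<dots> \<in> Q.Span ?K us"
      proof -
        have "seq_class (Q i) \<in> ?K" if "i < d" for i
        proof -
          have "range (Q i) \<subseteq> \<rat>" by (auto simp: Q_def)
          then show ?thesis unfolding rat_completion_eq using Qc[OF that] by simp
        qed
        then have "set (map seq_class (map Q [0..<d])) \<subseteq> ?K" by auto
        then show ?thesis unfolding Q.Span_eq_combine_set[OF K us] by blast
      qed
      finally show "z \<in> Q.Span ?K us" .
    qed
  qed
  ultimately have "Q.dimension d ?K ?L" using Q.dimensionI[OF K, of us] len by simp
  then show ?thesis unfolding local_degree_def by (rule Q.dimI[OF K])
qed

end

lemma (in valued_rat_basis) local_degree_eq_place_degree:
  assumes w: "w \<in> V" shows "local_degree w = place_degree w"
proof -
  obtain e where e: "stably_independent w (place_degree w) e" using place_degree_greatest(1)[OF w] by blast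
  show ?thesis
    by (rule local_degree_eqI[OF V_absval[OF w] e]) (rule stably_independent_dense[OF w e])
qed

section \<open>The product formula\<close>

text \<open>\<open>P\<close> may contain primes that do not divide \<open>x\<close>; they occur with
  exponent 0. This allows one set of primes for numerator and denominator.\<close>

lemma prod_prime_powers_int:
  fixes x :: int
  assumes x: "x \<noteq> 0" and P: "finite P" "\<And>p. p \<in> P \<Longrightarrow> Factorial_Ring.prime (p::nat)"
    and dvd: "\<And>p. Factorial_Ring.prime p \<Longrightarrow> int p dvd x \<Longrightarrow> p \<in> P"
  shows "(\<Prod>p\<in>P. real p ^ multiplicity (int p) x) = \<bar>real_of_int x\<bar>"
proof -
  have "prime_factors x \<subseteq> int ` P"
  proof
    fix q assume "q \<in> prime_factors x"
    then have q: "Factorial_Ring.prime q" "q dvd x" by auto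
    then have eq: "int (nat q) = q" using prime_ge_0_int by auto
    have "Factorial_Ring.prime (int (nat q))" unfolding eq by (rule q(1))
    then have "Factorial_Ring.prime (nat q)" by (simp only: prime_nat_int_transfer)
    moreover have "int (nat q) dvd x" unfolding eq by (rule q(2))
    ultimately have "nat q \<in> P" by (rule dvd)
    then show "q \<in> int ` P" by (rule image_eqI[of q int "nat q" P, OF eq[symmetric]])
  qed
  moreover have "multiplicity q x = 0" if "q \<in> int ` P - prime_factors x" for q
    using that P(2) x by (auto simp: prime_factors_multiplicity)
  ultimately have "(\<Prod>q\<in>int ` P. q ^ multiplicity q x) = (\<Prod>q\<in>prime_factors x. q ^ multiplicity q x)"
    using P(1) by (intro prod.mono_neutral_right) auto
  also have "\<dots> = \<bar>x\<bar>" using prod_prime_factors[OF x] by simp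
  finally have "(\<Prod>p\<in>P. int p ^ multiplicity (int p) x) = \<bar>x\<bar>"
    by (simp add: prod.reindex)
  then have "real_of_int (\<Prod>p\<in>P. int p ^ multiplicity (int p) x) = \<bar>real_of_int x\<bar>" by simp
  then show ?thesis by simp
qed

text \<open>\<open>padic_abs\<close> reads off the reduced fraction; cross-multiplying shows that
  any other fraction gives the same exponent.\<close>

lemma padic_abs_fraction:
  assumes p: "Factorial_Ring.prime p" and xy: "x \<noteq> 0" "y \<noteq> 0"
  shows "padic_abs p (of_int x / of_int y) = real p powi (int (multiplicity (int p) y) - int (multiplicity (int p) x))"
proof -
  define q :: rat where "q = of_int x / of_int y"
  obtain c d where cd: "quotient_of q = (c, d)" by force
  have d: "0 < d" using quotient_of_denom_pos[OF cd] .
  have qcd: "q = of_int c / of_int d" using quotient_of_div[OF cd] .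
  have q0: "q \<noteq> 0" using xy by (simp add: q_def)
  then have c: "c \<noteq> 0" using qcd by auto
  have "rat_of_int (x * d) = rat_of_int (c * y)"
    using xy d qcd unfolding q_def by (simp add: field_simps)
  then have "x * d = c * y" by (simp only: of_int_eq_iff)
  then have "multiplicity (int p) (x * d) = multiplicity (int p) (c * y)" by simp
  moreover have pe: "prime_elem (int p)" using p by (simp add: prime_imp_prime_elem)
  ultimately have "multiplicity (int p) x + multiplicity (int p) d = multiplicity (int p) c + multiplicity (int p) y"
    using xy c d by (simp add: prime_elem_multiplicity_mult_distrib)
  then have "int (multiplicity (int p) d) - int (multiplicity (int p) c) = int (multiplicity (int p) y) - int (multiplicity (int p) x)"
    by linarith
  then show ?thesis using q0 unfolding padic_abs_def q_def[symmetric] cd by simp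
qed

lemma rat_as_fraction: obtains x y where "(q::rat) = of_int x / of_int y" "y > 0"
proof -
  obtain x y where "quotient_of q = (x, y)" by force
  then show thesis using that quotient_of_div quotient_of_denom_pos by blast
qed

lemma padic_absolute_value:
  assumes p: "Factorial_Ring.prime p"
  shows "absolute_value (padic_abs p)"
proof -
  have pe: "prime_elem (int p)" using p by (simp add: prime_imp_prime_elem)
  have p1: "1 < real p" using p prime_gt_1_nat by simp
  have pos: "0 < padic_abs p q" if "q \<noteq> 0" for q using that p1 by (simp add: padic_abs_def)
  have zero: "padic_abs p 0 = 0" by (simp add: padic_abs_def)
  have mult: "padic_abs p (q * r) = padic_abs p q * padic_abs p r" for q r
  proof (cases "q = 0 \<or> r = 0")
    case False
    obtain x y where q: "q = of_int x / of_int y" "y > 0" by (rule rat_as_fraction)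
    obtain z w where r: "r = of_int z / of_int w" "w > 0" by (rule rat_as_fraction)
    have nz: "x \<noteq> 0" "z \<noteq> 0" "y \<noteq> 0" "w \<noteq> 0" using False q r by auto
    have "q * r = of_int (x * z) / of_int (y * w)" by (simp add: q r)
    then have "padic_abs p (q * r) = real p powi (int (multiplicity (int p) (y * w)) - int (multiplicity (int p) (x * z)))"
      using padic_abs_fraction[OF p, of "x * z" "y * w"] nz by simp
    also have "\<dots> = real p powi ((int (multiplicity (int p) y) - int (multiplicity (int p) x)) +
        (int (multiplicity (int p) w) - int (multiplicity (int p) z)))"
      using nz pe by (simp add: prime_elem_multiplicity_mult_distrib algebra_simps)
    also have "\<dots> = padic_abs p q * padic_abs p r"
      using p1 nz by (subst power_int_add) (auto simp: q r padic_abs_fraction[OF p])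
    finally show ?thesis .
  qed (auto simp: zero)
  have add: "padic_abs p (q + r) \<le> padic_abs p q + padic_abs p r" for q r
  proof (cases "q = 0 \<or> r = 0 \<or> q + r = 0")
    case True
    then show ?thesis using zero pos by (metis add.left_neutral add.right_neutral add_nonneg_nonneg less_eq_real_def)
  next
    case False
    obtain x y where q: "q = of_int x / of_int y" "y > 0" by (rule rat_as_fraction)
    obtain z w where r: "r = of_int z / of_int w" "w > 0" by (rule rat_as_fraction)
    define s where "s = x * w"
    define t where "t = z * y"
    define d where "d = y * w"
    have q': "q = of_int s / of_int d" and r': "r = of_int t / of_int d"
      using q r by (simp_all add: s_def t_def d_def)
    have d: "d \<noteq> 0" using q r by (simp add: d_def)
    have sum: "q + r = of_int (s + t) / of_int d" by (simp add: q' r' add_divide_distrib)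
    have nz: "s \<noteq> 0" "t \<noteq> 0" "s + t \<noteq> 0" using False q' r' sum by auto
    let ?m = "multiplicity (int p)"
    \<comment> \<open>Over a common denominator this is the ultrametric inequality, of which the
      triangle inequality is a weak form.\<close>
    have "min (?m s) (?m t) \<le> ?m (s + t)"
    proof (rule multiplicity_geI)
      show "int p ^ min (?m s) (?m t) dvd s + t" by (intro dvd_add multiplicity_dvd') auto
    qed (use nz pe in auto)
    then have "?m s \<le> ?m (s + t) \<or> ?m t \<le> ?m (s + t)" by linarith
    then have "padic_abs p (q + r) \<le> padic_abs p q \<or> padic_abs p (q + r) \<le> padic_abs p r"
      unfolding sum unfolding q' r' padic_abs_fraction[OF p nz(1) d] padic_abs_fraction[OF p nz(2) d] padic_abs_fraction[OF p nz(3) d]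
      using p1 by (auto intro!: power_int_increasing)
    then show ?thesis using pos[of q] pos[of r] False by auto
  qed
  show ?thesis
    unfolding absolute_value_def
  proof (intro conjI allI)
    fix q r
    show "0 \<le> padic_abs p q" using pos[of q] zero by (cases "q = 0") auto
    show "padic_abs p q = 0 \<longleftrightarrow> q = 0" by (metis pos zero less_irrefl)
  qed (rule mult add)+
qed

text \<open>The value at \<open>p\<close> tells the \<open>p\<close>-adic absolute value from all
  others, so the sets of places above different primes are disjoint.\<close>

lemma padic_abs_prime:
  assumes p: "Factorial_Ring.prime p" and r: "Factorial_Ring.prime r"
  shows "padic_abs p (of_nat r) = (if r = p then 1 / real p else 1)"
proof -
  have "multiplicity (int p) (int r) = (if r = p then 1 else 0)"
    using p r by (auto simp: prime_multiplicity_other prime_imp_prime_elem)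
  moreover have "r \<noteq> 0" using r by (metis not_prime_0)
  ultimately show ?thesis
    using padic_abs_fraction[OF p, of "int r" 1] by (simp add: power_int_minus inverse_eq_divide)
qed

definition arch_abs :: "rat \<Rightarrow> real" where
  "arch_abs q = \<bar>of_rat q\<bar>"

lemma arch_absolute_value: "absolute_value arch_abs"
proof -
  have "arch_abs (x + y) \<le> arch_abs x + arch_abs y" for x y
    unfolding arch_abs_def of_rat_add by (rule abs_triangle_ineq)
  then show ?thesis by (auto simp: absolute_value_def arch_abs_def of_rat_mult abs_mult)
qed

lemma arch_abs_large: "\<exists>q. 1 < arch_abs q"
  by (intro exI[of _ 2]) (simp add: arch_abs_def)

lemma padic_abs_large:
  assumes p: "Factorial_Ring.prime p" shows "\<exists>q. 1 < padic_abs p q"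
proof
  have "padic_abs p (inverse (of_nat p)) = real p"
    using absval_inverse[OF padic_absolute_value[OF p], of "of_nat p"] padic_abs_prime[OF p p] by simp
  then show "1 < padic_abs p (inverse (of_nat p))" using prime_gt_1_nat[OF p] by simp
qed

lemma finite_padic_support:
  assumes "q \<noteq> 0" shows "finite {p. Factorial_Ring.prime p \<and> padic_abs p q \<noteq> 1}"
proof -
  obtain x y where q: "q = of_int x / of_int y" "y > 0" by (rule rat_as_fraction)
  have nz: "x \<noteq> 0" "y \<noteq> 0" using assms q by auto
  have "{p. Factorial_Ring.prime p \<and> padic_abs p q \<noteq> 1} \<subseteq> {p. int p dvd x * y}"
  proof (safe, rule ccontr)
    fix p assume p: "Factorial_Ring.prime p" "padic_abs p q \<noteq> 1" "\<not> int p dvd x * y"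
    then have "multiplicity (int p) x = 0" "multiplicity (int p) y = 0"
      by (auto intro!: not_dvd_imp_multiplicity_0)
    then show False using padic_abs_fraction[OF p(1) nz] p(2) by (simp add: q)
  qed
  also have "\<dots> \<subseteq> {..nat \<bar>x * y\<bar>}"
  proof
    fix p assume "p \<in> {p. int p dvd x * y}"
    then have "int p \<le> \<bar>x * y\<bar>" using nz dvd_imp_le_int[of "x * y" "int p"] by simp
    then show "p \<in> {..nat \<bar>x * y\<bar>}" by simp
  qed
  finally show ?thesis using finite_subset finite_atMost by blast
qed

lemma rational_product_formula:
  assumes q: "q \<noteq> 0" and P: "finite P" "\<And>p. p \<in> P \<Longrightarrow> Factorial_Ring.prime p"
    and supp: "\<And>p. Factorial_Ring.prime p \<Longrightarrow> padic_abs p q \<noteq> 1 \<Longrightarrow> p \<in> P"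
  shows "ln (arch_abs q) + (\<Sum>p\<in>P. ln (padic_abs p q)) = 0"
proof -
  obtain x y where qxy: "q = of_int x / of_int y" "y > 0" by (rule rat_as_fraction)
  have nz: "x \<noteq> 0" "y \<noteq> 0" using q qxy by auto
  \<comment> \<open>The fraction need not be reduced, so a prime may divide both parts and still
    have \<open>padic_abs p q = 1\<close>. The sum is extended to \<open>P \<union> D\<close> to
    account for such primes.\<close>
  define D where "D = {p. Factorial_Ring.prime p \<and> int p dvd x * y}"
  have "D \<subseteq> {..nat \<bar>x * y\<bar>}"
  proof
    fix p assume "p \<in> D"
    then have "int p \<le> \<bar>x * y\<bar>" using nz dvd_imp_le_int[of "x * y" "int p"] by (simp add: D_def)
    then show "p \<in> {..nat \<bar>x * y\<bar>}" by simp
  qed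
  then have fin: "finite (P \<union> D)" using P(1) finite_subset by blast
  have prime: "Factorial_Ring.prime p" if "p \<in> P \<union> D" for p using that P(2) by (auto simp: D_def)
  have p0: "0 < real p" if "p \<in> P \<union> D" for p using prime[OF that] prime_gt_0_nat by simp
  have num: "(\<Prod>p\<in>P \<union> D. real p ^ multiplicity (int p) x) = \<bar>real_of_int x\<bar>"
    and den: "(\<Prod>p\<in>P \<union> D. real p ^ multiplicity (int p) y) = \<bar>real_of_int y\<bar>"
    using prod_prime_powers_int[OF nz(1) fin prime] prod_prime_powers_int[OF nz(2) fin prime]
    by (simp_all add: D_def)
  have ln_mult_sum: "(\<Sum>p\<in>P \<union> D. real (multiplicity (int p) z) * ln (real p)) = ln \<bar>real_of_int z\<bar>"
    if "(\<Prod>p\<in>P \<union> D. real p ^ multiplicity (int p) z) = \<bar>real_of_int z\<bar>" for z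
  proof -
    have "ln \<bar>real_of_int z\<bar> = (\<Sum>p\<in>P \<union> D. ln (real p ^ multiplicity (int p) z))"
      unfolding that[symmetric] using fin p0 by (intro ln_prod) auto
    then show ?thesis using p0 by (simp add: ln_realpow)
  qed
  have "(\<Sum>p\<in>P. ln (padic_abs p q)) = (\<Sum>p\<in>P \<union> D. ln (padic_abs p q))"
  proof (intro sum.mono_neutral_left fin ballI)
    fix p assume "p \<in> P \<union> D - P"
    then have "padic_abs p q = 1" using supp prime by blast
    then show "ln (padic_abs p q) = 0" by simp
  qed simp
  also have "\<dots> = (\<Sum>p\<in>P \<union> D. real (multiplicity (int p) y) * ln (real p) - real (multiplicity (int p) x) * ln (real p))"
  proof (rule sum.cong[OF refl])
    fix p assume p: "p \<in> P \<union> D"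
    show "ln (padic_abs p q) = real (multiplicity (int p) y) * ln (real p) - real (multiplicity (int p) x) * ln (real p)"
      unfolding qxy(1) padic_abs_fraction[OF prime[OF p] nz] using p0[OF p]
      by (subst powr_real_of_int'[symmetric]) (simp_all add: left_diff_distrib)
  qed
  also have "\<dots> = ln \<bar>real_of_int y\<bar> - ln \<bar>real_of_int x\<bar>"
    by (simp add: sum_subtractf ln_mult_sum[OF num] ln_mult_sum[OF den])
  also have "\<dots> = - ln (arch_abs q)"
    using nz by (simp add: arch_abs_def qxy(1) of_rat_divide ln_div)
  finally show ?thesis by simp
qed

lemma exists_rat_basis:
  assumes "number_field TYPE('a::field_char_0)"
  obtains b :: "nat \<Rightarrow> 'a::field_char_0" and coord where "rat_basis (field_degree TYPE('a::field_char_0)) b coord"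
proof -
  obtain B :: "'a set" where B: "finite_dimensional_vector_space rat_scale B"
    using assms by (auto simp: number_field_def)
  interpret vs: finite_dimensional_vector_space rat_scale B by (rule B)
  define n where "n = field_degree TYPE('a)"
  have n: "n = card B" by (simp add: n_def field_degree_def)
  have fin: "finite B" by (rule vs.finite_Basis)
  obtain b where b: "bij_betw b {..<n} B"
    using ex_bij_betw_nat_finite[OF fin] by (auto simp: n lessThan_atLeast0)
  define coord where "coord i x = vs.representation B x (b i)" for i x
  have e: "(\<Sum>i<n. of_rat (coord i x) * b i) = x" for x
  proof -
    have "(\<Sum>i<n. of_rat (coord i x) * b i) = (\<Sum>y\<in>B. of_rat (vs.representation B x y) * y)"
      unfolding coord_def by (rule sum.reindex_bij_betw[OF b])
    also have "\<dots> = x"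
      using vs.independent_Basis vs.span_Basis fin by (intro vs.sum_representation_eq) auto
    finally show ?thesis .
  qed
  have "rat_basis n b coord"
  proof
    fix c x i assume c: "(\<Sum>i<n. of_rat (c i) * b i) = x" and i: "i < n"
    define g where "g = inv_into {..<n} b"
    have g: "g (b j) = j" if "j < n" for j using b that by (simp add: g_def bij_betw_def)
    have "(\<Sum>y\<in>B. of_rat (coord (g y) x - c (g y)) * y) = (\<Sum>j<n. of_rat (coord (g (b j)) x - c (g (b j))) * b j)"
      by (rule sum.reindex_bij_betw[OF b, symmetric])
    also have "\<dots> = (\<Sum>j<n. of_rat (coord j x) * b j) - (\<Sum>j<n. of_rat (c j) * b j)"
      by (simp add: g of_rat_diff left_diff_distrib sum_subtractf)
    also have "\<dots> = 0" using e c by simp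
    finally have "coord (g (b i)) x - c (g (b i)) = 0"
      using vs.independentD[OF vs.independent_Basis fin order_refl, of "\<lambda>y. coord (g y) x - c (g y)" "b i"] b i
      by (auto simp: bij_betw_def)
    then show "coord i x = c i" using g[OF i] by simp
  qed (rule e)
  then show thesis using that unfolding n_def by blast
qed

lemma arch_places_over: "{v. archimedean_place v} = places_over arch_abs"
  by (simp add: archimedean_place_def places_over_def arch_abs_def)

lemma places_eq: "places = places_over arch_abs \<union> (\<Union>p\<in>{p. Factorial_Ring.prime p}. places_over (padic_abs p))"
  by (auto simp: places_def archimedean_place_def nonarchimedean_place_def places_over_def arch_abs_def)

lemma place_data:
  fixes v :: "'a::field_char_0 \<Rightarrow> real"
  assumes k: "number_field TYPE('a)" and v: "v \<in> places"
  shows "absolute_value v" and "0 < local_degree v"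
proof -
  obtain b :: "nat \<Rightarrow> 'a" and coord where basis: "rat_basis (field_degree TYPE('a)) b coord"
    using exists_rat_basis[OF k] by blast
  have pos: "absolute_value v \<and> 0 < local_degree v"
    if props: "absolute_value a" "\<exists>q. 1 < a q" "v \<in> places_over a" for a
  proof -
    interpret valued_rat_basis "field_degree TYPE('a)" b coord a
      using basis props by (simp add: valued_rat_basis_def valued_rat_basis_axioms_def)
    show ?thesis
      using V_absval[OF props(3)] place_degree_pos[OF props(3)]
      by (simp add: local_degree_eq_place_degree[OF props(3)])
  qed
  from v have "absolute_value v \<and> 0 < local_degree v"
    unfolding places_eq using pos[OF arch_absolute_value arch_abs_large] pos[OF padic_absolute_value padic_abs_large]
    by blast
  then show "absolute_value v" "0 < local_degree v" by simp_all
qed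

lemma field_degree_pos:
  assumes "number_field TYPE('a::field_char_0)" shows "0 < field_degree TYPE('a)"
proof -
  obtain b :: "nat \<Rightarrow> 'a" and coord where "rat_basis (field_degree TYPE('a)) b coord"
    using exists_rat_basis[OF assms] by blast
  then show ?thesis by (rule rat_basis.dim_pos)
qed

lemma exists_archimedean_place:
  assumes k: "number_field TYPE('a::field_char_0)"
  shows "{v :: 'a \<Rightarrow> real. archimedean_place v} \<noteq> {}"
proof -
  obtain b :: "nat \<Rightarrow> 'a" and coord where basis: "rat_basis (field_degree TYPE('a)) b coord"
    using exists_rat_basis[OF k] by blast
  interpret valued_rat_basis "field_degree TYPE('a)" b coord arch_abs
    using basis arch_absolute_value arch_abs_large
    by (simp add: valued_rat_basis_def valued_rat_basis_axioms_def)
  show ?thesis unfolding arch_places_over by (rule V_nonempty)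
qed

text \<open>The exponent in \<open>normalized_abs\<close> is positive, so its value is 1 only where
  \<open>v x\<close> is 1.\<close>

lemma S_unit_absval:
  fixes x :: "'a::field_char_0"
  assumes k: "number_field TYPE('a)" and x: "x \<in> carrier (S_units S)" and v: "v \<in> places - S"
  shows "v x = 1"
proof -
  have x0: "x \<noteq> 0" and one: "normalized_abs v x = 1" using x v by (auto simp: S_units_def)
  have "v x powr (real (local_degree v) / real (field_degree TYPE('a))) = 1"
    using one by (simp add: normalized_abs_def)
  moreover have "0 < v x" using place_data(1)[OF k] v absval_pos x0 by blast
  moreover have "0 < real (local_degree v) / real (field_degree TYPE('a))"
    using place_data(2)[OF k] field_degree_pos[OF k] v by simp
  ultimately show ?thesis by (metis less_irrefl powr_eq_one_iff_gen)
qed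

text \<open>Places are grouped by their restriction to the rationals. A complete group contributes
  \<open>ln (a N)\<close> for the norm \<open>N\<close> of \<open>x\<close>, and these terms add up
  to 0 by the rational product formula. The groups meeting \<open>S\<close> are completed by places
  outside \<open>S\<close>, which contribute \<open>ln 1\<close>.\<close>

theorem S_unit_product_formula:
  fixes x :: "'a::field_char_0"
  assumes k: "number_field TYPE('a)"
    and S: "finite S" "S \<subseteq> places" "{v. archimedean_place v} \<subseteq> S"
    and x: "x \<in> carrier (S_units S)"
  shows "(\<Sum>v\<in>S. real (local_degree v) * ln (v x)) = 0"
proof -
  have x0: "x \<noteq> 0" using x by (simp add: S_units_def)
  obtain b :: "nat \<Rightarrow> 'a" and coord where basis: "rat_basis (field_degree TYPE('a)) b coord"
    using exists_rat_basis[OF k] by blast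
  interpret B: rat_basis "field_degree TYPE('a)" b coord by (rule basis)
  define N where "N = B.field_norm x"
  define V where "V a = (places_over a :: ('a \<Rightarrow> real) set)" for a
  have local: "finite (V a) \<and> (\<Sum>v\<in>V a. real (local_degree v) * ln (v x)) = ln (a N)"
    if a: "absolute_value a" "\<exists>q. 1 < a q" for a
  proof -
    interpret valued_rat_basis "field_degree TYPE('a)" b coord a
      using basis a by (simp add: valued_rat_basis_def valued_rat_basis_axioms_def)
    have pos: "0 < v x" if "v \<in> V a" for v using V_pos[of v x] that x0 by (simp add: V_def)
    have "ln (a N) = ln (\<Prod>v\<in>V a. v x ^ place_degree v)"
      using local_norm_formula[OF x0] by (simp add: N_def V_def)
    also have "\<dots> = (\<Sum>v\<in>V a. ln (v x ^ place_degree v))"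
      using finite_V pos by (intro ln_prod) (fastforce simp: V_def)+
    also have "\<dots> = (\<Sum>v\<in>V a. real (local_degree v) * ln (v x))"
      using local_degree_eq_place_degree by (intro sum.cong refl) (simp add: V_def ln_realpow)
    finally show ?thesis using finite_V by (simp add: V_def)
  qed
  have N0: "N \<noteq> 0" using B.field_norm_inverse[OF x0] by (auto simp: N_def)
  define P0 where "P0 = {p. Factorial_Ring.prime p \<and> S \<inter> V (padic_abs p) \<noteq> {}}"
  have disj: "p = r" if "v \<in> V (padic_abs p)" "v \<in> V (padic_abs r)"
    and p: "Factorial_Ring.prime p" and r: "Factorial_Ring.prime r" for v p r
  proof (rule ccontr)
    assume "p \<noteq> r"
    have "padic_abs p (of_nat p) = padic_abs r (of_nat p)"
      using that by (simp add: V_def places_over_def)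
    then show False using padic_abs_prime[OF p p] padic_abs_prime[OF r p] \<open>p \<noteq> r\<close> prime_gt_1_nat[OF p] by simp
  qed
  have disj_arch: "v \<notin> V (padic_abs p)" if "v \<in> V arch_abs" "Factorial_Ring.prime p" for v p
  proof
    assume "v \<in> V (padic_abs p)"
    then have "padic_abs p (of_nat p) = arch_abs (of_nat p)"
      using that(1) by (simp add: V_def places_over_def)
    then have "1 / real p = real p"
      using padic_abs_prime[OF that(2) that(2)] by (simp add: arch_abs_def)
    then have "real p * real p = 1" using prime_gt_0_nat[OF that(2)] by (simp add: field_simps)
    then have "p * p = 1" by (metis of_nat_1 of_nat_eq_iff of_nat_mult)
    then show False using prime_gt_1_nat[OF that(2)] by simp
  qed
  \<comment> \<open>Each place of \<open>S\<close> lies above at most one prime, so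
    \<open>P0\<close> is contained in an image of \<open>S\<close>.\<close>
  have "finite P0"
  proof -
    define f where "f v = (THE p. Factorial_Ring.prime p \<and> v \<in> V (padic_abs p))" for v
    have "p \<in> f ` S" if p: "p \<in> P0" for p
    proof -
      obtain v where v: "v \<in> S" "v \<in> V (padic_abs p)" "Factorial_Ring.prime p"
        using p by (auto simp: P0_def)
      have "f v = p" unfolding f_def using v disj by (intro the_equality) auto
      then show ?thesis using v(1) by blast
    qed
    then show ?thesis using S(1) by (meson finite_imageI finite_subset subsetI)
  qed
  \<comment> \<open>Besides the primes below \<open>S\<close>, the rational product formula for
    \<open>N\<close> involves those at which \<open>N\<close> has nontrivial value.\<close>
  define P where "P = P0 \<union> {p. Factorial_Ring.prime p \<and> padic_abs p N \<noteq> 1}"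
  have P: "finite P" using \<open>finite P0\<close> finite_padic_support[OF N0] by (simp add: P_def)
  have prime: "Factorial_Ring.prime p" if "p \<in> P" for p using that by (auto simp: P_def P0_def)
  define W where "W = V arch_abs \<union> (\<Union>p\<in>P. V (padic_abs p))"
  let ?g = "\<lambda>v. real (local_degree v) * ln (v x)"
  note arch = local[OF arch_absolute_value arch_abs_large]
  have padic: "finite (V (padic_abs p))" "(\<Sum>v\<in>V (padic_abs p). ?g v) = ln (padic_abs p N)" if "p \<in> P" for p
    using local[OF padic_absolute_value padic_abs_large, of p] prime[OF that] by simp_all
  have SW: "S \<subseteq> W"
  proof
    fix v assume v: "v \<in> S"
    then consider "v \<in> V arch_abs" | p where "Factorial_Ring.prime p" "v \<in> V (padic_abs p)"
      using S(2) unfolding places_eq V_def by blast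
    then show "v \<in> W"
    proof cases
      case 2
      then have "p \<in> P" using v by (auto simp: P_def P0_def)
      then show ?thesis using 2 by (auto simp: W_def)
    qed (simp add: W_def)
  qed
  have "(\<Sum>v\<in>S. ?g v) = (\<Sum>v\<in>W. ?g v)"
  proof (rule sum.mono_neutral_left)
    show "finite W" unfolding W_def using arch padic P prime by auto
    have "W \<subseteq> places" unfolding W_def places_eq using prime by (auto simp: V_def)
    then have W': "W - S \<subseteq> places - S" by blast
    show "\<forall>v\<in>W - S. ?g v = 0"
    proof
      fix v assume "v \<in> W - S"
      then have "v x = 1" using W' S_unit_absval[OF k x, of v] by blast
      then show "?g v = 0" by simp
    qed
  qed (rule SW)
  also have "\<dots> = (\<Sum>v\<in>V arch_abs. ?g v) + (\<Sum>v\<in>(\<Union>p\<in>P. V (padic_abs p)). ?g v)"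
    unfolding W_def using arch padic P prime disj_arch by (intro sum.union_disjoint) auto
  also have "(\<Sum>v\<in>(\<Union>p\<in>P. V (padic_abs p)). ?g v) = (\<Sum>p\<in>P. \<Sum>v\<in>V (padic_abs p). ?g v)"
  proof (rule sum.UNION_disjoint[OF P])
    show "\<forall>p\<in>P. finite (V (padic_abs p))" using padic(1) by blast
    show "\<forall>p\<in>P. \<forall>r\<in>P. p \<noteq> r \<longrightarrow> V (padic_abs p) \<inter> V (padic_abs r) = {}"
    proof (intro ballI impI equals0I)
      fix p r v assume "p \<in> P" "r \<in> P" "p \<noteq> r" "v \<in> V (padic_abs p) \<inter> V (padic_abs r)"
      then show False using disj[of v p r] prime by simp
    qed
  qed
  also have "\<dots> = (\<Sum>p\<in>P. ln (padic_abs p N))" using padic(2) by (intro sum.cong refl)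
  also have "(\<Sum>v\<in>V arch_abs. ?g v) = ln (arch_abs N)" using arch by simp
  also have "ln (arch_abs N) + (\<Sum>p\<in>P. ln (padic_abs p N)) = 0"
    by (rule rational_product_formula[OF N0 P prime]) (auto simp: P_def)
  finally show ?thesis .
qed

section \<open>A determinant inequality\<close>

text \<open>Columns of the incidence matrix of a directed graph with one vertex removed:
  \<open>i\<close> and \<open>k\<close> are unrestricted, so an end outside \<open>{..<n}\<close>
  stands for the removed vertex, and \<open>i = k\<close> gives the zero column.\<close>

definition incidence_column :: "nat \<Rightarrow> (nat \<Rightarrow> real) \<Rightarrow> bool" where
  "incidence_column n f \<longleftrightarrow> (\<exists>i k. \<forall>m<n. f m = of_bool (m = i) - of_bool (m = k))"

text \<open>Deleting row \<open>i0\<close> sends the vertex \<open>i0\<close> to the outside index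
  \<open>n\<close>.\<close>

lemma incidence_column_delete:
  assumes f: "incidence_column (Suc n) f"
  shows "incidence_column n (\<lambda>m. f (if m < i0 then m else Suc m))"
proof -
  obtain i k where f: "\<And>m. m < Suc n \<Longrightarrow> f m = of_bool (m = i) - of_bool (m = k)"
    using f by (auto simp: incidence_column_def)
  define del where "del i = (if i = i0 then n else if i < i0 then i else i - 1)" for i
  have "((if m < i0 then m else Suc m) = i) = (m = del i)" if "m < n" for m i
    using that by (auto simp: del_def)
  then have "\<forall>m<n. f (if m < i0 then m else Suc m) = of_bool (m = del i) - of_bool (m = del k)"
    using f by auto
  then show ?thesis unfolding incidence_column_def by blast
qed

text \<open>
  Incidence matrices of directed graphs are totally unimodular: either some column has at most one
  nonzero entry, or all column sums vanish.
\<close>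

lemma det_incidence_le_1:
  fixes A :: "real mat"
  assumes "A \<in> carrier_mat n n" "\<And>j. j < n \<Longrightarrow> incidence_column n (\<lambda>i. A $$ (i, j))"
  shows "\<bar>det A\<bar> \<le> 1"
  using assms
proof (induction n arbitrary: A)
  case 0
  then show ?case by simp
next
  case (Suc n)
  note A = Suc.prems(1)
  have "\<forall>j. \<exists>i k. j < Suc n \<longrightarrow> (\<forall>m<Suc n. A $$ (m, j) = of_bool (m = i) - of_bool (m = k))"
    using Suc.prems(2) by (auto simp: incidence_column_def)
  then obtain s t where st: "\<And>j m. j < Suc n \<Longrightarrow> m < Suc n \<Longrightarrow> A $$ (m, j) = of_bool (m = s j) - of_bool (m = t j)"
    by metis
  have cof: "\<bar>cofactor A i j\<bar> \<le> 1" if ij: "i < Suc n" "j < Suc n" for i j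
  proof -
    have "\<bar>det (mat_delete A i j)\<bar> \<le> 1"
    proof (rule Suc.IH)
      show "mat_delete A i j \<in> carrier_mat n n" using mat_delete_carrier[OF A] by simp
      fix j' assume j': "j' < n"
      have "incidence_column n (\<lambda>m. A $$ (if m < i then m else Suc m, if j' < j then j' else Suc j'))"
        using incidence_column_delete[OF Suc.prems(2)[of "if j' < j then j' else Suc j'"], of i] j' by simp
      then show "incidence_column n (\<lambda>m. mat_delete A i j $$ (m, j'))"
        using A j' unfolding incidence_column_def by (simp add: mat_delete_def)
    qed
    then show ?thesis by (simp add: cofactor_def abs_mult power_abs)
  qed
  show ?case
  proof (cases "\<exists>j<Suc n. s j \<ge> Suc n \<or> t j \<ge> Suc n \<or> s j = t j")
    case True
    then obtain j where j: "j < Suc n" "s j \<ge> Suc n \<or> t j \<ge> Suc n \<or> s j = t j" by blast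
    have "\<exists>i0. \<forall>i<Suc n. i \<noteq> i0 \<longrightarrow> A $$ (i, j) = 0"
      using j st[OF j(1)] by (cases "s j < Suc n") fastforce+
    then obtain i0 where i0: "\<And>i. i < Suc n \<Longrightarrow> i \<noteq> i0 \<Longrightarrow> A $$ (i, j) = 0" by blast
    have det: "det A = (\<Sum>i<Suc n. A $$ (i, j) * cofactor A i j)"
      by (rule laplace_expansion_column[OF A j(1)])
    show ?thesis
    proof (cases "i0 < Suc n")
      case True
      have "det A = (\<Sum>i\<in>{i0}. A $$ (i, j) * cofactor A i j)"
        unfolding det using True i0 by (intro sum.mono_neutral_right) auto
      then have "\<bar>det A\<bar> = \<bar>A $$ (i0, j)\<bar> * \<bar>cofactor A i0 j\<bar>" by (simp add: abs_mult)
      also have "\<dots> \<le> 1 * 1"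
        using st[OF j(1) True] cof[OF True j(1)] by (intro mult_mono) auto
      finally show ?thesis by simp
    next
      case False
      then have "det A = 0" unfolding det using i0 by (intro sum.neutral) auto
      then show ?thesis by simp
    qed
  next
    case False
    \<comment> \<open>Every column now has one entry 1 and one entry -1, so the all-ones vector is
      in the kernel of the transpose.\<close>
    define u where "u = vec (Suc n) (\<lambda>_. 1::real)"
    have "transpose_mat A *\<^sub>v u = 0\<^sub>v (Suc n)"
    proof (rule eq_vecI)
      fix j assume "j < dim_vec (0\<^sub>v (Suc n) :: real vec)"
      then have j: "j < Suc n" by simp
      have "(transpose_mat A *\<^sub>v u) $ j = (\<Sum>m<Suc n. A $$ (m, j))"
        using A j by (simp add: scalar_prod_def u_def atLeast0LessThan)
      also have "\<dots> = (\<Sum>m<Suc n. of_bool (m = s j) - of_bool (m = t j))"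
        using st[OF j] by (intro sum.cong) auto
      also have "\<dots> = 0"
        using False j unfolding sum_subtractf by (auto simp: of_bool_def not_le simp del: sum.lessThan_Suc)
      finally show "(transpose_mat A *\<^sub>v u) $ j = 0\<^sub>v (Suc n) $ j" using j by simp
    qed (use A in simp)
    moreover have "u \<noteq> 0\<^sub>v (Suc n)"
    proof
      assume "u = 0\<^sub>v (Suc n)"
      then have "u $ 0 = 0\<^sub>v (Suc n) $ 0" by simp
      then show False by (simp add: u_def)
    qed
    moreover have "u \<in> carrier_vec (Suc n)" by (simp add: u_def)
    ultimately have "\<exists>u. u \<in> carrier_vec (Suc n) \<and> u \<noteq> 0\<^sub>v (Suc n) \<and> transpose_mat A *\<^sub>v u = 0\<^sub>v (Suc n)"
      by blast
    moreover have "transpose_mat A \<in> carrier_mat (Suc n) (Suc n)" using A by simp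
    ultimately have "det (transpose_mat A) = 0" using det_0_iff_vec_prod_zero by blast
    then show ?thesis using det_transpose[OF A] by simp
  qed
qed

text \<open>
  A column \<open>x\<close>, extended by \<open>x\<^sub>n = - \<Sum>x\<close>, is a combination of incidence columns whose nonnegative
  weights (a product transport plan) have total mass at most \<open>h\<close>.
\<close>

lemma incidence_decomposition:
  fixes x :: "nat \<Rightarrow> real"
  assumes pos: "(\<Sum>i<n. max 0 (x i)) \<le> h" and neg: "(\<Sum>i<n. max 0 (- x i)) \<le> h"
  obtains w :: "nat \<Rightarrow> nat \<Rightarrow> real" where "\<And>i k. 0 \<le> w i k" "(\<Sum>i\<le>n. \<Sum>k\<le>n. w i k) \<le> h"
    "\<And>m. m < n \<Longrightarrow> x m = (\<Sum>i\<le>n. \<Sum>k\<le>n. w i k * (of_bool (m = i) - of_bool (m = k)))"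
proof -
  define y where "y i = (if i = n then - (\<Sum>i<n. x i) else x i)" for i
  define p where "p i = max 0 (y i)" for i
  define q where "q i = max 0 (- y i)" for i
  define T where "T = (\<Sum>i\<le>n. p i)"
  have pq: "p i - q i = y i" "0 \<le> p i" "0 \<le> q i" for i by (auto simp: p_def q_def)
  have "(\<Sum>i\<le>n. y i) = 0" by (simp add: y_def lessThan_Suc_atMost[symmetric])
  then have T': "T = (\<Sum>i\<le>n. q i)"
    unfolding T_def using pq(1) by (metis (mono_tags, lifting) eq_iff_diff_eq_0 sum.cong sum_subtractf)
  have T0: "0 \<le> T" unfolding T_def by (intro sum_nonneg pq)
  \<comment> \<open>\<open>T\<close> is both the positive and the negative mass of \<open>y\<close>.
    According to the sign of the added entry \<open>y n\<close>, one of the two involves the entries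
    of \<open>x\<close> alone, and the matching hypothesis applies.\<close>
  have Th: "T \<le> h"
  proof (cases "0 \<le> (\<Sum>i<n. x i)")
    case True
    then have "T = (\<Sum>i<n. max 0 (x i))"
      by (simp add: T_def p_def y_def lessThan_Suc_atMost[symmetric])
    then show ?thesis using pos by simp
  next
    case False
    then have "T = (\<Sum>i<n. max 0 (- x i))"
      by (simp add: T' q_def y_def lessThan_Suc_atMost[symmetric])
    then show ?thesis using neg by simp
  qed
  show thesis
  proof (cases "T = 0")
    case True
    have "p i = 0" "q i = 0" if "i \<le> n" for i
      using True that sum_nonneg_eq_0_iff[of "{..n}" p] sum_nonneg_eq_0_iff[of "{..n}" q] pq T'
      by (auto simp: T_def)
    then have "x m = 0" if "m < n" for m using pq(1)[of m] that by (simp add: y_def)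
    then show thesis using that[of "\<lambda>_ _. 0"] Th T0 by simp
  next
    case False
    define w where "w i k = p i * q k / T" for i k
    have row: "(\<Sum>k\<le>n. w i k) = p i" for i
      using False by (simp add: w_def T' flip: sum_distrib_left sum_divide_distrib)
    have col: "(\<Sum>i\<le>n. w i k) = q k" for k
      using False by (simp add: w_def T_def flip: sum_distrib_right sum_divide_distrib)
    show thesis
    proof (rule that[of w])
      show "0 \<le> w i k" for i k using pq T0 by (simp add: w_def)
      show "(\<Sum>i\<le>n. \<Sum>k\<le>n. w i k) \<le> h" using Th by (simp add: row T_def)
      fix m assume m: "m < n"
      have "(\<Sum>i\<le>n. \<Sum>k\<le>n. w i k * (of_bool (m = i) - of_bool (m = k)))
          = (\<Sum>i\<le>n. \<Sum>k\<le>n. w i k * of_bool (m = i)) - (\<Sum>i\<le>n. \<Sum>k\<le>n. w i k * of_bool (m = k))"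
        by (simp add: right_diff_distrib sum_subtractf)
      also have "(\<Sum>i\<le>n. \<Sum>k\<le>n. w i k * of_bool (m = i)) = (\<Sum>i\<le>n. if m = i then p i else 0)"
        by (intro sum.cong) (auto simp: row)
      also have "(\<Sum>i\<le>n. \<Sum>k\<le>n. w i k * of_bool (m = k)) = (\<Sum>k\<le>n. if m = k then q k else 0)"
        by (subst sum.swap, intro sum.cong) (auto simp: col)
      also have "(\<Sum>i\<le>n. if m = i then p i else 0) - (\<Sum>k\<le>n. if m = k then q k else 0) = p m - q m"
        using m by (simp add: sum.delta')
      finally show "x m = (\<Sum>i\<le>n. \<Sum>k\<le>n. w i k * (of_bool (m = i) - of_bool (m = k)))"
        using pq(1)[of m] m by (simp add: y_def)
    qed
  qed
qed

text \<open>Laplace expansion along column \<open>t\<close>: its cofactors do not see that column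
  and may be computed with zeros in it.\<close>

lemma det_column_linear:
  fixes c :: "nat \<Rightarrow> nat \<Rightarrow> 'r::comm_ring_1"
  assumes t: "t < n"
  obtains K where "\<And>f. det (mat n n (\<lambda>(i, j). (c(t := f)) j i)) = (\<Sum>i<n. f i * K i)"
proof -
  define A where "A f = mat n n (\<lambda>(i, j). (c(t := f)) j i)" for f
  define C where "C i = cofactor (A (\<lambda>_. 0)) i t" for i
  have eq: "det (A f) = (\<Sum>i<n. f i * C i)" for f
  proof -
    have "det (A f) = (\<Sum>i<n. A f $$ (i, t) * cofactor (A f) i t)"
      by (rule laplace_expansion_column[OF _ t]) (simp add: A_def)
    also have "\<dots> = (\<Sum>i<n. f i * C i)"
    proof (intro sum.cong refl)
      fix i assume i: "i \<in> {..<n}"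
      have "mat_delete (A f) i t = mat_delete (A (\<lambda>_. 0)) i t"
        by (intro eq_matI) (auto simp: mat_delete_def A_def)
      then show "A f $$ (i, t) * cofactor (A f) i t = f i * C i"
        using i t by (simp add: cofactor_def A_def C_def)
    qed
    finally show ?thesis .
  qed
  show thesis by (rule that[of C]) (use eq in \<open>simp add: A_def\<close>)
qed

text \<open>Induction on the number \<open>t\<close> of columns that are still general. By linearity
  the last of these is replaced by incidence columns of total weight at most its bound
  \<open>h\<close>; when none is left, the determinant is that of an incidence matrix.\<close>

lemma abs_det_le_prod_aux:
  fixes c :: "nat \<Rightarrow> nat \<Rightarrow> real"
  assumes "t \<le> n"
    and "\<And>j. j < t \<Longrightarrow> (\<Sum>i<n. max 0 (c j i)) \<le> h j" "\<And>j. j < t \<Longrightarrow> (\<Sum>i<n. max 0 (- c j i)) \<le> h j"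
    and "\<And>j. t \<le> j \<Longrightarrow> j < n \<Longrightarrow> incidence_column n (c j)"
  shows "\<bar>det (mat n n (\<lambda>(i, j). c j i))\<bar> \<le> (\<Prod>j<t. h j)"
  using assms
proof (induction t arbitrary: c)
  case 0
  have "incidence_column n (\<lambda>i. mat n n (\<lambda>(i, j). c j i) $$ (i, j))" if "j < n" for j
    using 0(4)[of j] that by (simp add: incidence_column_def)
  then show ?case using det_incidence_le_1[of "mat n n (\<lambda>(i, j). c j i)" n] by simp
next
  case (Suc t)
  have t: "t < n" using Suc.prems(1) by simp
  obtain K where K: "\<And>f. det (mat n n (\<lambda>(i, j). (c(t := f)) j i)) = (\<Sum>i<n. f i * K i)"
    using det_column_linear[OF t, of c] by blast
  obtain w where w: "\<And>i k. 0 \<le> w i k" "(\<Sum>i\<le>n. \<Sum>k\<le>n. w i k) \<le> h t"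
    "\<And>m. m < n \<Longrightarrow> c t m = (\<Sum>i\<le>n. \<Sum>k\<le>n. w i k * (of_bool (m = i) - of_bool (m = k)))"
    using incidence_decomposition[OF Suc.prems(2,3)[of t]] by auto
  define D where "D i k = (\<Sum>m<n. (of_bool (m = i) - of_bool (m = k)) * K m)" for i k :: nat
  have D: "\<bar>D i k\<bar> \<le> (\<Prod>j<t. h j)" for i k
  proof -
    let ?f = "\<lambda>m. of_bool (m = i) - of_bool (m = k) :: real"
    have "\<bar>det (mat n n (\<lambda>(m, j). (c(t := ?f)) j m))\<bar> \<le> (\<Prod>j<t. h j)"
    proof (rule Suc.IH)
      show "incidence_column n ((c(t := ?f)) j)" if "t \<le> j" "j < n" for j
        using Suc.prems(4)[of j] that by (cases "j = t") (auto simp: incidence_column_def)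
    qed (use Suc.prems in auto)
    then show ?thesis unfolding K D_def .
  qed
  have "det (mat n n (\<lambda>(i, j). c j i)) = (\<Sum>m<n. c t m * K m)"
    using K[of "c t"] by simp
  also have "\<dots> = (\<Sum>m<n. \<Sum>i\<le>n. \<Sum>k\<le>n. w i k * ((of_bool (m = i) - of_bool (m = k)) * K m))"
    using w(3) by (intro sum.cong refl) (simp add: sum_distrib_right mult.assoc)
  also have "\<dots> = (\<Sum>i\<le>n. \<Sum>k\<le>n. w i k * D i k)"
    unfolding D_def sum_distrib_left
    by (rule trans[OF sum.swap], rule sum.cong[OF refl], rule sum.swap)
  finally have "\<bar>det (mat n n (\<lambda>(i, j). c j i))\<bar> \<le> (\<Sum>i\<le>n. \<Sum>k\<le>n. \<bar>w i k * D i k\<bar>)"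
    by (auto intro!: order_trans[OF sum_abs] sum_mono)
  also have "\<dots> \<le> (\<Sum>i\<le>n. \<Sum>k\<le>n. w i k * (\<Prod>j<t. h j))"
    using w(1) D by (intro sum_mono) (simp add: abs_mult mult_left_mono)
  also have "\<dots> = (\<Sum>i\<le>n. \<Sum>k\<le>n. w i k) * (\<Prod>j<t. h j)"
    by (simp add: sum_distrib_right)
  also have "\<dots> \<le> h t * (\<Prod>j<t. h j)"
    using w(2) order_trans[OF abs_ge_zero D[of 0 0]] by (rule mult_right_mono)
  finally show ?case by (simp add: mult.commute)
qed

theorem abs_det_le_prod:
  fixes X :: "real mat"
  assumes X: "X \<in> carrier_mat n n"
    and "\<And>j. j < n \<Longrightarrow> (\<Sum>i<n. max 0 (X $$ (i, j))) \<le> h j"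
    and "\<And>j. j < n \<Longrightarrow> (\<Sum>i<n. max 0 (- X $$ (i, j))) \<le> h j"
  shows "\<bar>det X\<bar> \<le> (\<Prod>j<n. h j)"
proof -
  have "X = mat n n (\<lambda>(i, j). X $$ (i, j))" using X by (intro eq_matI) auto
  then show ?thesis using abs_det_le_prod_aux[of n n "\<lambda>j i. X $$ (i, j)" h] assms by simp
qed

section \<open>The index of a lattice\<close>

text \<open>\<open>X\<close> covers all classes of integer vectors modulo the lattice spanned by the
  columns, possibly repeatedly, so its cardinality bounds the index from above. Vectors are
  functions of which only the arguments below \<open>n\<close> count.\<close>

definition column_residues :: "int mat \<Rightarrow> nat \<Rightarrow> (nat \<Rightarrow> int) set \<Rightarrow> bool" where
  "column_residues A n X \<longleftrightarrow> (\<forall>x. \<exists>y\<in>X. \<exists>z. \<forall>i<n. x i = y i + (\<Sum>j<n. A $$ (i, j) * z j))"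

text \<open>Column operations do not change the lattice: the multiple of column \<open>l\<close>
  added to column \<open>k\<close> moves into the coefficient of column \<open>l\<close>.\<close>

lemma column_residues_addcol:
  assumes A: "A \<in> carrier_mat n n" and kl: "k < n" "l < n" "k \<noteq> l"
    and X: "column_residues (addcol a k l A) n X"
  shows "column_residues A n X"
  unfolding column_residues_def
proof
  fix x
  obtain y z where yz: "y \<in> X" "\<And>i. i < n \<Longrightarrow> x i = y i + (\<Sum>j<n. addcol a k l A $$ (i, j) * z j)"
    using X unfolding column_residues_def by blast
  define z' where "z' = z(l := z l + a * z k)"
  have "(\<Sum>j<n. addcol a k l A $$ (i, j) * z j) = (\<Sum>j<n. A $$ (i, j) * z' j)" if i: "i < n" for i
  proof -
    have "(\<Sum>j<n. addcol a k l A $$ (i, j) * z j) = (\<Sum>j<n. A $$ (i, j) * z j + (if j = k then a * A $$ (i, l) * z k else 0))"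
      using A i kl by (intro sum.cong) (auto simp: algebra_simps)
    also have "\<dots> = (\<Sum>j<n. A $$ (i, j) * z j) + a * A $$ (i, l) * z k"
      using kl by (simp add: sum.distrib)
    also have "\<dots> = (\<Sum>j<n. A $$ (i, j) * z j + (if j = l then a * A $$ (i, l) * z k else 0))"
      using kl by (simp add: sum.distrib)
    also have "\<dots> = (\<Sum>j<n. A $$ (i, j) * z' j)"
      by (intro sum.cong) (auto simp: z'_def algebra_simps)
    finally show ?thesis .
  qed
  then have "\<forall>i<n. x i = y i + (\<Sum>j<n. A $$ (i, j) * z' j)" using yz(2) by simp
  then show "\<exists>y\<in>X. \<exists>z. \<forall>i<n. x i = y i + (\<Sum>j<n. A $$ (i, j) * z j)" using yz(1) by blast
qed

lemma column_residues_swapcols: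
  assumes A: "A \<in> carrier_mat n n" and kl: "k < n" "l < n"
    and X: "column_residues (swapcols k l A) n X"
  shows "column_residues A n X"
  unfolding column_residues_def
proof
  fix x
  obtain y z where yz: "y \<in> X" "\<And>i. i < n \<Longrightarrow> x i = y i + (\<Sum>j<n. swapcols k l A $$ (i, j) * z j)"
    using X unfolding column_residues_def by blast
  let ?t = "Transposition.transpose k l"
  have "(\<Sum>j<n. swapcols k l A $$ (i, j) * z j) = (\<Sum>j<n. A $$ (i, j) * z (?t j))" if i: "i < n" for i
  proof -
    have bij: "bij_betw ?t {..<n} {..<n}" using kl by (intro permutes_imp_bij permutes_swap_id) auto
    have "(\<Sum>j<n. A $$ (i, j) * z (?t j)) = (\<Sum>j<n. A $$ (i, ?t j) * z (?t (?t j)))"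
      by (rule sum.reindex_bij_betw[OF bij, symmetric])
    also have "\<dots> = (\<Sum>j<n. swapcols k l A $$ (i, j) * z j)"
      using A i kl by (intro sum.cong) (auto simp: Transposition.transpose_def)
    finally show ?thesis by simp
  qed
  then have "\<forall>i<n. x i = y i + (\<Sum>j<n. A $$ (i, j) * z (?t j))" using yz(2) by simp
  then show "\<exists>y\<in>X. \<exists>z. \<forall>i<n. x i = y i + (\<Sum>j<n. A $$ (i, j) * z j)"
    using yz(1) by (intro bexI[of _ y] exI[of _ "\<lambda>j. z (?t j)"])
qed

text \<open>Column operations bring \<open>A\<close> to a form whose last row is \<open>(0, \<dots>, 0, d)\<close>.\<close>

theorem exists_column_residues:
  fixes A :: "int mat"
  assumes "A \<in> carrier_mat n n" "det A \<noteq> 0"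
  shows "\<exists>X. finite X \<and> int (card X) \<le> \<bar>det A\<bar> \<and> column_residues A n X"
  using assms
proof (induction n arbitrary: A)
  case 0
  then show ?case by (intro exI[of _ "{\<lambda>_. 0}"]) (simp add: column_residues_def)
next
  case (Suc m)
  have triangular: "\<exists>X. finite X \<and> int (card X) \<le> \<bar>det A\<bar> \<and> column_residues A (Suc m) X"
    if A: "A \<in> carrier_mat (Suc m) (Suc m)" and dA: "det A \<noteq> 0"
      and row: "\<And>j. j < m \<Longrightarrow> A $$ (m, j) = 0" for A :: "int mat"
  proof -
    define d where "d = A $$ (m, m)"
    define A1 where "A1 = mat_delete A m m"
    have A1: "A1 \<in> carrier_mat m m" using mat_delete_carrier[OF A] by (simp add: A1_def)
    have "det A = (\<Sum>j<Suc m. A $$ (m, j) * cofactor A m j)"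
      by (rule laplace_expansion_row[OF A]) simp
    also have "\<dots> = d * det A1"
      using row by (simp add: cofactor_def d_def A1_def)
    finally have det: "det A = d * det A1" .
    then have nz: "d \<noteq> 0" "det A1 \<noteq> 0" using dA by auto
    obtain X1 where X1: "finite X1" "int (card X1) \<le> \<bar>det A1\<bar>" "column_residues A1 m X1"
      using Suc.IH[OF A1 nz(2)] by blast
    \<comment> \<open>A residue for the block \<open>A1\<close> is completed by a remainder of the
      last coordinate modulo the absolute value of \<open>d\<close>, matching
      \<open>det A = d * det A1\<close>.\<close>
    define X where "X = (\<lambda>(y, c). y(m := c)) ` (X1 \<times> {0..<\<bar>d\<bar>})"
    have "int (card X) \<le> \<bar>det A\<bar>"
    proof -
      have "card X \<le> card X1 * nat \<bar>d\<bar>"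
        unfolding X_def using card_image_le[of "X1 \<times> {0..<\<bar>d\<bar>}"] X1(1) by (simp add: card_cartesian_product)
      then have "int (card X) \<le> int (card X1) * \<bar>d\<bar>" by (metis abs_ge_zero int_nat_eq of_nat_le_iff of_nat_mult)
      also have "\<dots> \<le> \<bar>det A1\<bar> * \<bar>d\<bar>" using X1(2) by (intro mult_right_mono) auto
      finally show ?thesis by (simp add: det abs_mult mult.commute)
    qed
    moreover have "column_residues A (Suc m) X"
      unfolding column_residues_def
    proof
      fix x :: "nat \<Rightarrow> int"
      define c where "c = x m mod \<bar>d\<bar>"
      \<comment> \<open>The sign compensates that of \<open>d\<close>, so that \<open>c\<close> is a
        nonnegative remainder with \<open>x m = c + d * z0\<close>.\<close>
      define z0 where "z0 = sgn d * (x m div \<bar>d\<bar>)"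
      have "\<bar>d\<bar> * (x m div \<bar>d\<bar>) + x m mod \<bar>d\<bar> = x m" by (rule mult_div_mod_eq)
      moreover have "d * z0 = \<bar>d\<bar> * (x m div \<bar>d\<bar>)" by (simp add: z0_def mult.assoc[symmetric] abs_sgn)
      ultimately have xm: "x m = c + d * z0" by (simp add: c_def)
      have c: "c \<in> {0..<\<bar>d\<bar>}" using nz(1) by (simp add: c_def)
      obtain y z where yz: "y \<in> X1"
        "\<And>i. i < m \<Longrightarrow> x i - A $$ (i, m) * z0 = y i + (\<Sum>j<m. A1 $$ (i, j) * z j)"
        using X1(3) unfolding column_residues_def by (elim allE[of _ "\<lambda>i. x i - A $$ (i, m) * z0"]) blast
      have "x i = (y(m := c)) i + (\<Sum>j<Suc m. A $$ (i, j) * (z(m := z0)) j)" if i: "i < Suc m" for i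
      proof (cases "i = m")
        case True
        then show ?thesis using xm row by (simp add: d_def)
      next
        case False
        then have i: "i < m" using i by simp
        have "A1 $$ (i, j) = A $$ (i, j)" if "j < m" for j
          using A i that by (simp add: A1_def mat_delete_def)
        then have "x i - A $$ (i, m) * z0 = y i + (\<Sum>j<m. A $$ (i, j) * z j)" using yz(2)[OF i] by simp
        then show ?thesis using i by simp
      qed
      moreover have "y(m := c) \<in> X" using yz(1) c by (auto simp: X_def)
      ultimately show "\<exists>y\<in>X. \<exists>z. \<forall>i<Suc m. x i = y i + (\<Sum>j<Suc m. A $$ (i, j) * z j)" by blast
    qed
    moreover have "finite X" using X1(1) by (simp add: X_def)
    ultimately show ?thesis by blast
  qed
  \<comment> \<open>Euclid's algorithm on the last row: the sum of its absolute values decreases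
    until a single nonzero entry is left, which a swap moves to the last column.\<close>
  from Suc.prems show ?case
  proof (induction "nat (\<Sum>j<Suc m. \<bar>A $$ (m, j)\<bar>)" arbitrary: A rule: less_induct)
    case (less A)
    note A = less.prems(1) and dA = less.prems(2)
    show ?case
    proof (cases "\<exists>k l. k < Suc m \<and> l < Suc m \<and> k \<noteq> l \<and> A $$ (m, k) \<noteq> 0 \<and> A $$ (m, l) \<noteq> 0")
      case True
      then obtain k l where kl: "k < Suc m" "l < Suc m" "k \<noteq> l" "A $$ (m, l) \<noteq> 0"
        and le: "\<bar>A $$ (m, l)\<bar> \<le> \<bar>A $$ (m, k)\<bar>"
        by (metis linear)
      \<comment> \<open>The signs make the added multiple oppose the larger entry, whose absolute
        value drops by that of the smaller one.\<close>
      define a where "a = - sgn (A $$ (m, k)) * sgn (A $$ (m, l))"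
      let ?B = "addcol a k l A"
      have B: "?B \<in> carrier_mat (Suc m) (Suc m)" using A by (intro carrier_matI) auto
      have detB: "det ?B = det A" using kl by (intro det_addcol[OF _ _ A]) auto
      have entry: "?B $$ (m, j) = (if j = k then a * A $$ (m, l) + A $$ (m, k) else A $$ (m, j))"
        if "j < Suc m" for j
        using A that by auto
      have lt: "\<bar>a * A $$ (m, l) + A $$ (m, k)\<bar> < \<bar>A $$ (m, k)\<bar>"
        using kl(4) le by (auto simp: a_def sgn_if abs_if split: if_splits)
      have "(\<Sum>j<Suc m. \<bar>?B $$ (m, j)\<bar>) < (\<Sum>j<Suc m. \<bar>A $$ (m, j)\<bar>)"
      proof (rule sum_strict_mono_ex1)
        show "\<forall>j\<in>{..<Suc m}. \<bar>?B $$ (m, j)\<bar> \<le> \<bar>A $$ (m, j)\<bar>"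
          using entry lt by (auto simp del: index_mat_addcol)
        show "\<exists>j\<in>{..<Suc m}. \<bar>?B $$ (m, j)\<bar> < \<bar>A $$ (m, j)\<bar>"
          using entry[OF kl(1)] lt kl(1) by (intro bexI[of _ k]) auto
      qed simp
      moreover have "0 \<le> (\<Sum>j<Suc m. \<bar>?B $$ (m, j)\<bar>)" by (intro sum_nonneg) simp
      ultimately have "nat (\<Sum>j<Suc m. \<bar>?B $$ (m, j)\<bar>) < nat (\<Sum>j<Suc m. \<bar>A $$ (m, j)\<bar>)" by linarith
      then obtain X where "finite X" "int (card X) \<le> \<bar>det ?B\<bar>" "column_residues ?B (Suc m) X"
        using less.hyps[OF _ B] detB dA by auto
      then show ?thesis using column_residues_addcol[OF A kl(1-3)] detB by auto
    next
      case False
      have "\<exists>k<Suc m. A $$ (m, k) \<noteq> 0"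
      proof (rule ccontr)
        assume "\<not> ?thesis"
        then have "det A = 0" using laplace_expansion_row[OF A, of m] by simp
        then show False using dA by simp
      qed
      then obtain k where k: "k < Suc m" "A $$ (m, k) \<noteq> 0" by blast
      have zero: "A $$ (m, j) = 0" if "j < Suc m" "j \<noteq> k" for j using False k that by blast
      show ?thesis
      proof (cases "k = m")
        case True
        then show ?thesis using triangular[OF A dA] zero by simp
      next
        case False
        let ?B = "swapcols k m A"
        have B: "?B \<in> carrier_mat (Suc m) (Suc m)" using A by simp
        have detB: "det ?B = - det A" using k False A by (intro det_swapcols) auto
        have "?B $$ (m, j) = 0" if "j < m" for j
          using that A k zero[of j] zero[of m] False by auto
        then obtain X where "finite X" "int (card X) \<le> \<bar>det ?B\<bar>" "column_residues ?B (Suc m) X"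
          using triangular[OF B] detB dA by auto
        then show ?thesis using column_residues_swapcols[OF A k(1), of m X] detB by auto
      qed
    qed
  qed
qed

section \<open>Finitely generated abelian groups\<close>

definition int_comb :: "('g, 'b) monoid_scheme \<Rightarrow> nat \<Rightarrow> (nat \<Rightarrow> 'g) \<Rightarrow> (nat \<Rightarrow> int) \<Rightarrow> 'g" where
  "int_comb G r a e = (\<Otimes>\<^bsub>G\<^esub>j\<in>{..<r}. a j [^]\<^bsub>G\<^esub> e j)"

context comm_group
begin

lemma int_comb_0: "int_comb G 0 a e = \<one>"
  by (simp add: int_comb_def)

lemma int_comb_Suc:
  "(\<And>j. j < Suc r \<Longrightarrow> a j \<in> carrier G) \<Longrightarrow> int_comb G (Suc r) a e = a r [^] e r \<otimes> int_comb G r a e"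
  unfolding int_comb_def lessThan_Suc by (intro finprod_insert) auto

lemma int_comb_closed: "(\<And>j. j < r \<Longrightarrow> a j \<in> carrier G) \<Longrightarrow> int_comb G r a e \<in> carrier G"
  by (auto simp: int_comb_def)

lemma int_comb_cong: 
  assumes "\<And>j. j < r \<Longrightarrow> a j \<in> carrier G" "\<And>j. j < r \<Longrightarrow> e j = f j"
  shows "int_comb G r a e = int_comb G r a f"
  unfolding int_comb_def using assms by (intro finprod_cong') auto

lemma int_comb_add:
  assumes "\<And>j. j < r \<Longrightarrow> a j \<in> carrier G"
  shows "int_comb G r a (\<lambda>j. e j + f j) = int_comb G r a e \<otimes> int_comb G r a f"
proof -
  have "int_comb G r a (\<lambda>j. e j + f j) = (\<Otimes>j\<in>{..<r}. a j [^] e j \<otimes> a j [^] f j)"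
    unfolding int_comb_def using assms by (intro finprod_cong') (auto simp: int_pow_mult)
  then show ?thesis unfolding int_comb_def using assms by (subst (asm) finprod_multf) auto
qed

lemma int_comb_zero: "int_comb G r a (\<lambda>_. 0) = \<one>"
  by (simp add: int_comb_def)

lemma int_comb_pow:
  assumes "\<And>j. j < r \<Longrightarrow> a j \<in> carrier G"
  shows "int_comb G r a e [^] (k::int) = int_comb G r a (\<lambda>j. k * e j)"
  using assms
proof (induction r)
  case (Suc r)
  then show ?case
    by (simp add: int_comb_Suc int_pow_distrib int_comb_closed int_pow_pow mult.commute)
qed (simp add: int_comb_0)

lemma int_comb_single:
  assumes a: "\<And>j. j < r \<Longrightarrow> a j \<in> carrier G" and i: "i < r"
  shows "int_comb G r a (\<lambda>j. of_bool (j = i)) = a i"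
proof -
  have "int_comb G r a (\<lambda>j. of_bool (j = i)) = (\<Otimes>j\<in>{..<r}. if i = j then a j else \<one>)"
    unfolding int_comb_def using a by (intro finprod_cong') auto
  also have "\<dots> = a i" using a i by (intro finprod_singleton) auto
  finally show ?thesis .
qed

lemma int_comb_compose:
  assumes a: "\<And>j. j < r \<Longrightarrow> a j \<in> carrier G"
    and b: "\<And>j. j < s \<Longrightarrow> b j = int_comb G r a (\<lambda>i. A i j)"
  shows "int_comb G s b z = int_comb G r a (\<lambda>i. \<Sum>j<s. A i j * z j)"
  using b
proof (induction s)
  case 0
  then show ?case by (simp add: int_comb_0 int_comb_zero)
next
  case (Suc s)
  have bc: "b j \<in> carrier G" if "j < Suc s" for j
    using Suc.prems[OF that] int_comb_closed[OF a] by simp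
  have "int_comb G (Suc s) b z = b s [^] z s \<otimes> int_comb G s b z" by (rule int_comb_Suc[OF bc])
  also have "b s [^] z s = int_comb G r a (\<lambda>i. z s * A i s)"
    using Suc.prems[of s] int_comb_pow[OF a] by simp
  also have "int_comb G s b z = int_comb G r a (\<lambda>i. \<Sum>j<s. A i j * z j)"
    using Suc.prems by (intro Suc.IH) simp
  also have "int_comb G r a (\<lambda>i. z s * A i s) \<otimes> int_comb G r a (\<lambda>i. \<Sum>j<s. A i j * z j)
      = int_comb G r a (\<lambda>i. z s * A i s + (\<Sum>j<s. A i j * z j))"
    by (rule int_comb_add[OF a, symmetric])
  finally show ?case by (simp add: add.commute mult.commute)
qed

lemma generate_eq_int_combs:
  assumes a: "\<And>j. j < r \<Longrightarrow> a j \<in> carrier G"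
  shows "generate G (a ` {..<r}) = range (int_comb G r a)"
proof
  show "generate G (a ` {..<r}) \<subseteq> range (int_comb G r a)"
  proof
    fix x assume "x \<in> generate G (a ` {..<r})"
    then show "x \<in> range (int_comb G r a)"
    proof induction
      case one
      show ?case using rangeI[of "int_comb G r a" "\<lambda>_. 0"] by (simp only: int_comb_zero)
    next
      case (incl h)
      then obtain i where i: "i < r" "h = a i" by blast
      then have "h = int_comb G r a (\<lambda>j. of_bool (j = i))" using int_comb_single[OF a i(1)] by simp
      then show ?case by (simp only:) (rule rangeI)
    next
      case (inv h)
      then obtain i where i: "i < r" "h = a i" by blast
      have "inv h = int_comb G r a (\<lambda>j. of_bool (j = i)) [^] (-1::int)"
        using i(2) a[OF i(1)] int_comb_single[OF a i(1)] by (simp add: int_pow_neg)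
      also have "\<dots> = int_comb G r a (\<lambda>j. -1 * of_bool (j = i))" by (rule int_comb_pow[OF a])
      finally show ?case by (simp only:) (rule rangeI)
    next
      case (eng h1 h2)
      then obtain e f where "h1 = int_comb G r a e" "h2 = int_comb G r a f" by blast
      then have "h1 \<otimes> h2 = int_comb G r a (\<lambda>j. e j + f j)" using int_comb_add[OF a] by simp
      then show ?case by (simp only:) (rule rangeI)
    qed
  qed
  have gen: "subgroup (generate G (a ` {..<r})) G"
    using a by (intro generate_is_subgroup) auto
  have "int_comb G k a e \<in> generate G (a ` {..<r})" if "k \<le> r" for k e
    using that
  proof (induction k)
    case 0
    then show ?case by (simp add: int_comb_0 generate.one)
  next
    case (Suc k)
    have ak: "a k \<in> generate G (a ` {..<r})" using Suc.prems by (intro generate.incl) auto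
    have "a k [^] e k \<in> generate G (a ` {..<r})"
      by (rule subgroup_int_pow_closed[OF gen ak])
    moreover have "int_comb G (Suc k) a e = a k [^] e k \<otimes> int_comb G k a e"
      by (rule int_comb_Suc) (use a Suc.prems in simp)
    ultimately show ?case using Suc generate.eng by simp
  qed
  then show "range (int_comb G r a) \<subseteq> generate G (a ` {..<r})" by auto
qed

lemma free_basis_expand:
  assumes "free_basis G r \<eta>" "x \<in> carrier G"
  obtains e where "x = int_comb G r \<eta> e"
proof -
  have "generate G (\<eta> ` {..<r}) = range (int_comb G r \<eta>)"
    by (rule generate_eq_int_combs) (use assms(1) in \<open>simp add: free_basis_def\<close>)
  then have "x \<in> range (int_comb G r \<eta>)" using assms by (simp add: free_basis_def)
  then show thesis using that by (elim rangeE)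
qed

lemma mult_independent_iff:
  "mult_independent G r a \<longleftrightarrow> (\<forall>e. int_comb G r a e = \<one> \<longrightarrow> (\<forall>j<r. e j = 0))"
  by (simp add: mult_independent_def int_comb_def)

lemma free_basis_closed: "free_basis G r \<eta> \<Longrightarrow> j < r \<Longrightarrow> \<eta> j \<in> carrier G"
  by (simp add: free_basis_def)

lemma exists_coordinate_matrix:
  assumes \<eta>: "free_basis G r \<eta>" and \<alpha>: "\<forall>j<s. \<alpha> j \<in> carrier G"
  shows "\<exists>A. \<forall>j<s. \<alpha> j = int_comb G r \<eta> (\<lambda>i. A i j)"
proof -
  have "\<exists>e. \<alpha> j = int_comb G r \<eta> e" if "j < s" for j
    using \<alpha> that by (auto elim: free_basis_expand[OF \<eta>])
  then obtain E where "\<And>j. j < s \<Longrightarrow> \<alpha> j = int_comb G r \<eta> (E j)" by metis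
  then show ?thesis by (intro exI[of _ "\<lambda>i j. E j i"]) simp
qed

text \<open>More than \<open>r\<close> exponent vectors with \<open>r\<close> entries satisfy a
  nontrivial integer relation. In particular all finite free bases have the same length.\<close>

lemma mult_independent_le_free_basis:
  assumes \<eta>: "free_basis G r \<eta>" and \<alpha>: "\<forall>j<s. \<alpha> j \<in> carrier G" and ind: "mult_independent G s \<alpha>"
  shows "s \<le> r"
proof (rule ccontr)
  assume "\<not> s \<le> r"
  then have "r < s" by simp
  obtain A where A: "\<And>j. j < s \<Longrightarrow> \<alpha> j = int_comb G r \<eta> (\<lambda>i. A i j)"
    using exists_coordinate_matrix[OF \<eta> \<alpha>] by auto
  obtain z where z: "\<exists>j<s. z j \<noteq> 0" "\<forall>i<r. (\<Sum>j<s. A i j * z j) = 0"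
    using exists_nontrivial_kernel[OF \<open>r < s\<close>, of A] by blast
  note c = free_basis_closed[OF \<eta>]
  have "int_comb G s \<alpha> z = int_comb G r \<eta> (\<lambda>i. \<Sum>j<s. A i j * z j)" by (rule int_comb_compose[OF c A])
  also have "\<dots> = int_comb G r \<eta> (\<lambda>_. 0)" by (rule int_comb_cong[OF c]) (use z in auto)
  finally have "int_comb G s \<alpha> z = \<one>" by (simp add: int_comb_zero)
  then show False using ind z(1) unfolding mult_independent_iff by blast
qed

lemma coordinate_matrix_det_nonzero:
  assumes \<eta>: "free_basis G r \<eta>" and A: "\<And>j. j < r \<Longrightarrow> \<alpha> j = int_comb G r \<eta> (\<lambda>i. A i j)"
    and ind: "mult_independent G r \<alpha>"
  shows "det (mat r r (\<lambda>(i, j). A i j)) \<noteq> 0"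
proof (rule trivial_kernel_imp_det_nonzero)
  fix z assume z: "\<And>i. i < r \<Longrightarrow> (\<Sum>j<r. A i j * z j) = 0"
  note c = free_basis_closed[OF \<eta>]
  have "int_comb G r \<alpha> z = int_comb G r \<eta> (\<lambda>i. \<Sum>j<r. A i j * z j)" by (rule int_comb_compose[OF c A])
  also have "\<dots> = int_comb G r \<eta> (\<lambda>_. 0)" by (rule int_comb_cong[OF c]) (use z in auto)
  finally have "int_comb G r \<alpha> z = \<one>" by (simp add: int_comb_zero)
  then show "\<forall>j<r. z j = 0" using ind unfolding mult_independent_iff by blast
qed

text \<open>Cosets of the generated subgroup correspond to exponent vectors modulo the columns of
  \<open>A\<close>, so a set of column residues supplies representatives of all cosets.\<close>

lemma subgroup_index_le_det:
  assumes \<eta>: "free_basis G r \<eta>" and A: "\<And>j. j < r \<Longrightarrow> \<alpha> j = int_comb G r \<eta> (\<lambda>i. A i j)"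
    and det: "det (mat r r (\<lambda>(i, j). A i j)) \<noteq> 0"
  shows "int (subgroup_index G (generate G (\<alpha> ` {..<r}))) \<le> \<bar>det (mat r r (\<lambda>(i, j). A i j))\<bar>"
proof -
  let ?A = "mat r r (\<lambda>(i, j). A i j)" and ?H = "generate G (\<alpha> ` {..<r})"
  note c = free_basis_closed[OF \<eta>]
  have \<alpha>: "\<alpha> j \<in> carrier G" if "j < r" for j using A[OF that] int_comb_closed[OF c] by simp
  obtain X where X: "finite X" "int (card X) \<le> \<bar>det ?A\<bar>" "column_residues ?A r X"
    using exists_column_residues[of ?A r] det by auto
  have H: "subgroup ?H G" using \<alpha> by (intro generate_is_subgroup) auto
  have "rcosets ?H \<subseteq> (\<lambda>y. ?H #> int_comb G r \<eta> y) ` X"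
  proof
    fix K assume "K \<in> rcosets ?H"
    then obtain x where x: "x \<in> carrier G" "K = ?H #> x" by (auto simp: RCOSETS_def)
    obtain e where e: "x = int_comb G r \<eta> e" using free_basis_expand[OF \<eta> x(1)] .
    obtain y z where yz: "y \<in> X" "\<And>i. i < r \<Longrightarrow> e i = y i + (\<Sum>j<r. ?A $$ (i, j) * z j)"
      using X(3) unfolding column_residues_def by blast
    have "x = int_comb G r \<eta> (\<lambda>i. (\<Sum>j<r. A i j * z j) + y i)"
      unfolding e by (rule int_comb_cong[OF c]) (use yz(2) in auto)
    also have "\<dots> = int_comb G r \<eta> (\<lambda>i. \<Sum>j<r. A i j * z j) \<otimes> int_comb G r \<eta> y"
      by (rule int_comb_add) (rule c)
    also have "int_comb G r \<eta> (\<lambda>i. \<Sum>j<r. A i j * z j) = int_comb G r \<alpha> z"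
      by (rule int_comb_compose[symmetric]) (rule c A, assumption)+
    finally have "x = int_comb G r \<alpha> z \<otimes> int_comb G r \<eta> y" .
    moreover have "?H = range (int_comb G r \<alpha>)" by (rule generate_eq_int_combs) (rule \<alpha>)
    then have "int_comb G r \<alpha> z \<in> ?H" by simp
    ultimately have "x \<in> ?H #> int_comb G r \<eta> y" by (auto simp: r_coset_def)
    then have "K = ?H #> int_comb G r \<eta> y"
      unfolding x(2) using repr_independence[OF _ int_comb_closed[OF c] H] by simp
    then show "K \<in> (\<lambda>y. ?H #> int_comb G r \<eta> y) ` X" using yz(1) by blast
  qed
  then have "card (rcosets ?H) \<le> card X" using X(1) by (meson card_image_le card_mono finite_imageI order_trans)
  then show ?thesis using X(2) by (simp add: subgroup_index_def)
qed

lemma additive_int_comb: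
  fixes L :: "'a \<Rightarrow> real"
  assumes L: "\<And>x y. x \<in> carrier G \<Longrightarrow> y \<in> carrier G \<Longrightarrow> L (x \<otimes> y) = L x + L y"
    and a: "\<And>j. j < r \<Longrightarrow> a j \<in> carrier G"
  shows "L (int_comb G r a e) = (\<Sum>j<r. of_int (e j) * L (a j))"
proof -
  have one: "L \<one> = 0" using L[of \<one> \<one>] by simp
  have inv: "L (inv x) = - L x" if "x \<in> carrier G" for x
    using L[of x "inv x"] that one by simp
  have nat_pow: "L (x [^] (n::nat)) = of_nat n * L x" if "x \<in> carrier G" for x n
    using that by (induction n) (simp_all add: one L algebra_simps)
  have int_pow: "L (x [^] (k::int)) = of_int k * L x" if x: "x \<in> carrier G" for x k
  proof (cases "k < 0")
    case True
    then have "L (x [^] k) = - (real (nat (- k)) * L x)"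
      by (simp only: int_pow_def2 if_True inv[OF nat_pow_closed[OF x]] nat_pow[OF x])
    then show ?thesis using True by simp
  next
    case False
    then have "L (x [^] k) = real (nat k) * L x"
      by (simp only: int_pow_def2 if_False nat_pow[OF x])
    then show ?thesis using False by simp
  qed
  show ?thesis
    using a
  proof (induction r)
    case (Suc r)
    have "int_comb G (Suc r) a e = a r [^] e r \<otimes> int_comb G r a e"
      by (rule int_comb_Suc) (use Suc.prems in simp)
    moreover have "int_comb G r a e \<in> carrier G"
      by (rule int_comb_closed) (use Suc.prems in simp)
    ultimately show ?case using Suc by (simp add: L int_pow)
  qed (simp add: int_comb_0 one)
qed

end

section \<open>Groups of $S$-units\<close>

context
  fixes S :: "('a::field_char_0 \<Rightarrow> real) set"
  assumes k: "number_field TYPE('a)"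
begin

lemma S_unit_nonzero: "x \<in> carrier (S_units S) \<Longrightarrow> x \<noteq> 0"
  by (simp add: S_units_def)

lemma normalized_abs_mult:
  assumes "v \<in> places" shows "normalized_abs v (x * y) = normalized_abs v x * normalized_abs v (y :: 'a)"
  using absval_mult[OF place_data(1)[OF k assms]] absval_nonneg[OF place_data(1)[OF k assms]]
  by (simp add: normalized_abs_def powr_mult)

lemma normalized_abs_inverse:
  assumes "v \<in> places" shows "normalized_abs v (inverse x) = inverse (normalized_abs v (x :: 'a))"
  using absval_inverse[OF place_data(1)[OF k assms]] absval_nonneg[OF place_data(1)[OF k assms]]
  by (simp add: normalized_abs_def inverse_powr)

lemma normalized_abs_1:
  assumes "v \<in> places" shows "normalized_abs v (1 :: 'a) = 1"
  using absval_1[OF place_data(1)[OF k assms]] by (simp add: normalized_abs_def)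

lemma S_units_comm_group: "comm_group (S_units S)"
proof (rule comm_groupI)
  fix x assume x: "x \<in> carrier (S_units S)"
  then show "\<exists>y\<in>carrier (S_units S). y \<otimes>\<^bsub>S_units S\<^esub> x = \<one>\<^bsub>S_units S\<^esub>"
    by (intro bexI[of _ "inverse x"]) (auto simp: S_units_def normalized_abs_inverse)
qed (auto simp: S_units_def normalized_abs_mult normalized_abs_1 mult_ac)

interpretation G: comm_group "S_units S" by (rule S_units_comm_group)

lemma S_units_nat_pow: "x [^]\<^bsub>S_units S\<^esub> (n::nat) = x ^ n"
  by (induction n) (simp_all add: nat_pow_def S_units_def mult.commute)

lemma torsion_absval:
  assumes t: "t \<in> torsion_subgroup (S_units S)" and v: "v \<in> places" shows "v t = 1"
proof -
  obtain n :: nat where n: "n > 0" "t ^ n = 1"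
    using t by (auto simp: torsion_subgroup_def S_units_nat_pow) (auto simp: S_units_def)
  have "v t ^ n = 1"
    using absval_power[OF place_data(1)[OF k v], of t n] absval_1[OF place_data(1)[OF k v]] n(2) by simp
  then show ?thesis
    using n(1) absval_nonneg[OF place_data(1)[OF k v], of t] power_eq_imp_eq_base[of "v t" n 1] by simp
qed

lemma torsion_subgroup_subgroup: "subgroup (torsion_subgroup (S_units S)) (S_units S)"
proof (rule G.subgroupI)
  let ?T = "torsion_subgroup (S_units S)"
  show "?T \<subseteq> carrier (S_units S)" by (auto simp: torsion_subgroup_def)
  have "\<exists>n>0. \<one>\<^bsub>S_units S\<^esub> [^]\<^bsub>S_units S\<^esub> (n::nat) = \<one>\<^bsub>S_units S\<^esub>" by (rule exI[of _ 1]) simp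
  then have "\<one>\<^bsub>S_units S\<^esub> \<in> ?T" using G.one_closed unfolding torsion_subgroup_def by blast
  then show "?T \<noteq> {}" by blast
  show "inv\<^bsub>S_units S\<^esub> x \<in> ?T" if "x \<in> ?T" for x
    using that by (auto simp: torsion_subgroup_def G.nat_pow_inv)
  show "x \<otimes>\<^bsub>S_units S\<^esub> y \<in> ?T" if x: "x \<in> ?T" and y: "y \<in> ?T" for x y
  proof -
    obtain m n :: nat where mn: "m > 0" "x [^]\<^bsub>S_units S\<^esub> m = \<one>\<^bsub>S_units S\<^esub>" "n > 0" "y [^]\<^bsub>S_units S\<^esub> n = \<one>\<^bsub>S_units S\<^esub>"
      using x y by (auto simp: torsion_subgroup_def)
    have xy: "x \<in> carrier (S_units S)" "y \<in> carrier (S_units S)" using x y by (auto simp: torsion_subgroup_def)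
    have "(x \<otimes>\<^bsub>S_units S\<^esub> y) [^]\<^bsub>S_units S\<^esub> (m * n)
        = (x [^]\<^bsub>S_units S\<^esub> m) [^]\<^bsub>S_units S\<^esub> n \<otimes>\<^bsub>S_units S\<^esub> (y [^]\<^bsub>S_units S\<^esub> n) [^]\<^bsub>S_units S\<^esub> m"
      using xy by (simp add: G.pow_mult_distrib G.m_comm G.nat_pow_pow mult.commute)
    then have "(x \<otimes>\<^bsub>S_units S\<^esub> y) [^]\<^bsub>S_units S\<^esub> (m * n) = \<one>\<^bsub>S_units S\<^esub>" using mn by simp
    then show ?thesis using xy mn(1,3) unfolding torsion_subgroup_def
      by (auto intro!: exI[of _ "m * n"])
  qed
qed

interpretation N: normal "torsion_subgroup (S_units S)" "S_units S"
  by (rule G.subgroup_imp_normal[OF torsion_subgroup_subgroup])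

lemma free_S_units_comm_group: "comm_group (free_S_units S)"
  unfolding free_S_units_def by (rule G.abelian_FactGroup[OF torsion_subgroup_subgroup])

abbreviation unit_class :: "'a \<Rightarrow> 'a set" where
  "unit_class x \<equiv> torsion_subgroup (S_units S) #>\<^bsub>S_units S\<^esub> x"

lemma carrier_free_S_units: "carrier (free_S_units S) = unit_class ` carrier (S_units S)"
  by (simp add: free_S_units_def carrier_FactGroup)

lemma unit_class_mult:
  "x \<in> carrier (S_units S) \<Longrightarrow> y \<in> carrier (S_units S) \<Longrightarrow>
    unit_class x \<otimes>\<^bsub>free_S_units S\<^esub> unit_class y = unit_class (x * y)"
  using N.rcos_sum[of x y] by (simp add: free_S_units_def) (simp add: S_units_def)

lemma unit_class_members:
  assumes "y \<in> unit_class x" obtains t where "t \<in> torsion_subgroup (S_units S)" "y = t * x"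
  using assms by (auto simp: r_coset_def S_units_def)

lemma coset_value_unit_class:
  assumes x: "x \<in> carrier (S_units S)" and f: "\<And>t. t \<in> torsion_subgroup (S_units S) \<Longrightarrow> f (t * x) = f x"
  shows "coset_value f (unit_class x) = f x"
proof -
  have "f y = f x" if "y \<in> unit_class x" for y
    using f that by (auto elim: unit_class_members)
  moreover have "x \<in> unit_class x" using G.rcos_self[OF x torsion_subgroup_subgroup] .
  ultimately have "f ` unit_class x = {f x}" by blast
  then show ?thesis by (simp add: coset_value_def)
qed

lemma coset_value_place:
  assumes x: "x \<in> carrier (S_units S)" and v: "v \<in> places"
  shows "coset_value v (unit_class x) = v x"
  using coset_value_unit_class[OF x, of v] torsion_absval[OF _ v] absval_mult[OF place_data(1)[OF k v]]
  by simp

lemma height_unit_class: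
  assumes x: "x \<in> carrier (S_units S)"
  shows "height (unit_class x) = weil_height x"
  unfolding height_def
proof (rule coset_value_unit_class[OF x])
  fix t assume t: "t \<in> torsion_subgroup (S_units S)"
  have "normalized_abs v (t * x) = normalized_abs v x" if "v \<in> places" for v
    using torsion_absval[OF t that] absval_mult[OF place_data(1)[OF k that], of t x] by (simp add: normalized_abs_def)
  then show "weil_height (t * x) = weil_height x"
    unfolding weil_height_def by (intro infsum_cong) simp
qed

lemma log_coset_value_mult:
  assumes v: "v \<in> places" and c: "c \<in> carrier (free_S_units S)" "d \<in> carrier (free_S_units S)"
  shows "ln (coset_value v (c \<otimes>\<^bsub>free_S_units S\<^esub> d)) = ln (coset_value v c) + ln (coset_value v d)"
proof -
  obtain x y where xy: "x \<in> carrier (S_units S)" "c = unit_class x" "y \<in> carrier (S_units S)" "d = unit_class y"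
    using c by (auto simp: carrier_free_S_units)
  have "x * y \<in> carrier (S_units S)" using G.m_closed[OF xy(1,3)] by (simp add: S_units_def)
  moreover have "0 < v x" "0 < v y"
    using absval_pos[OF place_data(1)[OF k v]] S_unit_nonzero xy(1,3) by auto
  ultimately show ?thesis
    using xy by (simp add: unit_class_mult coset_value_place v absval_mult[OF place_data(1)[OF k v]] ln_mult)
qed

text \<open>Outside \<open>S\<close> the normalised value is 1, so the infinite sum collapses to
  \<open>S\<close>; the factor \<open>field_degree\<close> cancels the denominator of the
  exponent.\<close>

lemma weil_height_S_unit:
  assumes S: "finite S" "S \<subseteq> places" and x: "x \<in> carrier (S_units S)"
  shows "real (field_degree TYPE('a)) * weil_height x = (\<Sum>v\<in>S. max 0 (real (local_degree v) * ln (v x)))"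
proof -
  let ?d = "real (field_degree TYPE('a))"
  have d: "0 < ?d" using field_degree_pos[OF k] by simp
  have "weil_height x = (\<Sum>\<^sub>\<infinity>v\<in>S. max 0 (ln (normalized_abs v x)))"
    unfolding weil_height_def
    using x S(2) by (intro infsum_cong_neutral) (auto simp: S_units_def)
  also have "\<dots> = (\<Sum>v\<in>S. max 0 (ln (normalized_abs v x)))" using S(1) by simp
  finally have "?d * weil_height x = (\<Sum>v\<in>S. ?d * max 0 (ln (normalized_abs v x)))" by (simp add: sum_distrib_left)
  also have "\<dots> = (\<Sum>v\<in>S. max 0 (real (local_degree v) * ln (v x)))"
  proof (intro sum.cong refl)
    fix v assume "v \<in> S"
    have "?d * max 0 (ln (normalized_abs v x)) = max (?d * 0) (?d * ln (normalized_abs v x))"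
      using d by (simp add: max_mult_distrib_left)
    then show "?d * max 0 (ln (normalized_abs v x)) = max 0 (real (local_degree v) * ln (v x))"
      using d by (simp add: normalized_abs_def)
  qed
  finally show ?thesis .
qed

lemma regulator_matrix_det_le:
  assumes S: "finite S" "S \<subseteq> places" "{v. archimedean_place v} \<subseteq> S"
    and vs: "w \<in> S" "distinct vs" "set vs = S - {w}" "length vs = r"
    and \<alpha>: "\<And>j. j < r \<Longrightarrow> \<alpha> j \<in> carrier (free_S_units S)"
  shows "\<bar>det (regulator_matrix vs r \<alpha>)\<bar> \<le> (\<Prod>j<r. real (field_degree TYPE('a)) * height (\<alpha> j))"
proof (rule abs_det_le_prod)
  show "regulator_matrix vs r \<alpha> \<in> carrier_mat r r" by (simp add: regulator_matrix_def vs)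
  fix j assume j: "j < r"
  obtain x where x: "x \<in> carrier (S_units S)" "\<alpha> j = unit_class x"
    using \<alpha>[OF j] by (auto simp: carrier_free_S_units)
  define g where "g v = real (local_degree v) * ln (v x)" for v
  have h: "real (field_degree TYPE('a)) * height (\<alpha> j) = (\<Sum>v\<in>S. max 0 (g v))"
    using weil_height_S_unit[OF S(1,2) x(1)] height_unit_class[OF x(1)] x(2) by (simp add: g_def)
  have entry: "regulator_matrix vs r \<alpha> $$ (i, j) = g (vs ! i)" if i: "i < r" for i
  proof -
    have "vs ! i \<in> places" using vs S(2) i nth_mem[of i vs] by auto
    then show ?thesis using i j vs(4) coset_value_place[OF x(1)] by (simp add: regulator_matrix_def g_def x(2))
  qed
  have bij: "bij_betw ((!) vs) {..<r} (S - {w})" using bij_betw_nth[OF vs(2)] vs(3,4) by auto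
  have sum: "(\<Sum>i<r. f (regulator_matrix vs r \<alpha> $$ (i, j))) = (\<Sum>v\<in>S - {w}. f (g v))" for f :: "real \<Rightarrow> real"
    using sum.reindex_bij_betw[OF bij, of "\<lambda>v. f (g v)"] entry by simp
  have sub: "(\<Sum>v\<in>S - {w}. max 0 (f v)) \<le> (\<Sum>v\<in>S. max 0 (f v))" for f :: "_ \<Rightarrow> real"
    using S(1) by (intro sum_mono2) auto
  show "(\<Sum>i<r. max 0 (regulator_matrix vs r \<alpha> $$ (i, j))) \<le> real (field_degree TYPE('a)) * height (\<alpha> j)"
    unfolding h sum by (rule sub)
  have "(\<Sum>v\<in>S. max 0 (g v)) - (\<Sum>v\<in>S. max 0 (- g v)) = (\<Sum>v\<in>S. g v)"
    unfolding sum_subtractf[symmetric] by (intro sum.cong) auto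
  also have "\<dots> = 0" unfolding g_def by (rule S_unit_product_formula[OF k S x(1)])
  finally have "(\<Sum>v\<in>S. max 0 (- g v)) = (\<Sum>v\<in>S. max 0 (g v))" by simp
  then show "(\<Sum>i<r. max 0 (- regulator_matrix vs r \<alpha> $$ (i, j))) \<le> real (field_degree TYPE('a)) * height (\<alpha> j)"
    unfolding h using sum[of "\<lambda>y. max 0 (- y)"] sub[of "\<lambda>v. - g v"] by simp
qed

text \<open>Logarithms of absolute values are additive on the unit group, so the matrix for
  \<open>\<alpha>\<close> is that for \<open>\<eta>\<close> times the matrix of exponents.\<close>

lemma regulator_matrix_change_basis:
  assumes vs: "set vs \<subseteq> places" "length vs = r"
    and \<eta>: "\<And>j. j < r \<Longrightarrow> \<eta> j \<in> carrier (free_S_units S)"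
    and A: "\<And>j. j < r \<Longrightarrow> \<alpha> j = int_comb (free_S_units S) r \<eta> (\<lambda>i. A i j)"
  shows "det (regulator_matrix vs r \<alpha>) = det (regulator_matrix vs r \<eta>) * of_int (det (mat r r (\<lambda>(i, j). A i j)))"
proof -
  interpret U: comm_group "free_S_units S" by (rule free_S_units_comm_group)
  let ?A = "map_mat real_of_int (mat r r (\<lambda>(i, j). A i j))"
  have "regulator_matrix vs r \<alpha> = regulator_matrix vs r \<eta> * ?A"
  proof (rule eq_matI)
    fix i j assume "i < dim_row (regulator_matrix vs r \<eta> * ?A)" "j < dim_col (regulator_matrix vs r \<eta> * ?A)"
    then have ij: "i < r" "j < r" by (simp_all add: regulator_matrix_def vs)
    have v: "vs ! i \<in> places" using vs ij nth_mem[of i vs] by auto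
    have "ln (coset_value (vs ! i) (\<alpha> j)) = (\<Sum>l<r. of_int (A l j) * ln (coset_value (vs ! i) (\<eta> l)))"
      unfolding A[OF ij(2)]
      by (rule U.additive_int_comb[of "\<lambda>c. ln (coset_value (vs ! i) c)"]) (simp_all add: log_coset_value_mult[OF v] \<eta>)
    then show "regulator_matrix vs r \<alpha> $$ (i, j) = (regulator_matrix vs r \<eta> * ?A) $$ (i, j)"
      using ij by (simp add: regulator_matrix_def vs scalar_prod_def atLeast0LessThan sum_distrib_left mult_ac)
  qed (simp_all add: regulator_matrix_def vs)
  moreover have "det (regulator_matrix vs r \<eta> * ?A) = det (regulator_matrix vs r \<eta>) * det ?A"
    by (rule det_mult[of _ r]) (simp_all add: regulator_matrix_def vs)
  ultimately show ?thesis by (simp add: of_int_hom.hom_det)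
qed

end

theorem theorem1p1:
  fixes S :: "('a::field_char_0 \<Rightarrow> real) set" and \<alpha> :: "nat \<Rightarrow> 'a set" and r :: nat
  assumes "number_field TYPE('a)"
    and "finite S" and "S \<subseteq> places" and "{v. archimedean_place v} \<subseteq> S"
    and "has_rank (S_units S) r" and "r > 0"
    and "\<forall>j<r. \<alpha> j \<in> carrier (free_S_units S)"
    and "mult_independent (free_S_units S) r \<alpha>"
  shows "S_regulator S
           * real (subgroup_index (free_S_units S) (generate (free_S_units S) (\<alpha> ` {..<r})))
         \<le> (\<Prod>j<r. real (field_degree TYPE('a)) * height (\<alpha> j))"
proof -
  note k = assms(1) and S = assms(2-4) and ind = assms(8)
  have \<alpha>: "\<alpha> j \<in> carrier (free_S_units S)" if "j < r" for j using assms(7) that by blast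
  interpret U: comm_group "free_S_units S" by (rule free_S_units_comm_group[OF k])
  let ?ind = "subgroup_index (free_S_units S) (generate (free_S_units S) (\<alpha> ` {..<r}))"
  obtain \<eta>0 where \<eta>0: "free_basis (free_S_units S) r \<eta>0"
    using assms(5) by (auto simp: has_rank_def free_S_units_def)
  obtain w0 where w0: "w0 \<in> S" using exists_archimedean_place[OF k] S(3) by blast
  obtain vs0 where vs0: "set vs0 = S - {w0}" "distinct vs0"
    using finite_distinct_list[of "S - {w0}"] S(1) by auto
  \<comment> \<open>The existence of some witness makes the choice in \<open>S_regulator\<close>
    meaningful. The chosen one is known by its defining properties alone, which leave the length
    \<open>r'\<close> of its basis open.\<close>
  have "\<exists>r' \<eta> w vs. free_basis (free_S_units S) r' \<eta> \<and> w \<in> S \<and> distinct vs \<and> set vs = S - {w} \<and>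
      S_regulator S = \<bar>det (regulator_matrix vs r' \<eta>)\<bar>"
    unfolding S_regulator_def by (rule someI_ex) (use \<eta>0 w0 vs0 in blast)
  then obtain r' \<eta> w vs where \<eta>: "free_basis (free_S_units S) r' \<eta>"
    and vs: "w \<in> S" "distinct vs" "set vs = S - {w}"
    and R: "S_regulator S = \<bar>det (regulator_matrix vs r' \<eta>)\<bar>" by blast
  have "r' \<le> r" "r \<le> r'"
    using U.mult_independent_le_free_basis[OF \<eta>0, of r' \<eta>] U.mult_independent_le_free_basis[OF \<eta>, of r \<eta>0] \<eta> \<eta>0
    by (simp_all add: free_basis_def)
  then have r': "r' = r" by simp
  show ?thesis
  proof (cases "length vs = r")
    case True
    obtain A where A: "\<And>j. j < r \<Longrightarrow> \<alpha> j = int_comb (free_S_units S) r \<eta> (\<lambda>i. A i j)"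
      using U.exists_coordinate_matrix[of r \<eta> r \<alpha>] \<eta> \<alpha> unfolding r' by auto
    let ?A = "mat r r (\<lambda>(i, j). A i j)"
    have detA: "det ?A \<noteq> 0" using U.coordinate_matrix_det_nonzero[of r \<eta> \<alpha> A] \<eta> A ind unfolding r' by blast
    have "int ?ind \<le> \<bar>det ?A\<bar>" using U.subgroup_index_le_det[of r \<eta> \<alpha> A] \<eta> A detA unfolding r' by blast
    then have index: "real ?ind \<le> \<bar>real_of_int (det ?A)\<bar>" by linarith
    have "S_regulator S * real ?ind \<le> \<bar>det (regulator_matrix vs r \<eta>)\<bar> * \<bar>real_of_int (det ?A)\<bar>"
      unfolding R r' by (intro mult_left_mono index) simp
    also have "\<dots> = \<bar>det (regulator_matrix vs r \<alpha>)\<bar>"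
    proof -
      have "set vs \<subseteq> places" using vs(3) S(2) by blast
      moreover have "\<eta> j \<in> carrier (free_S_units S)" if "j < r" for j
        using U.free_basis_closed[OF \<eta>] that r' by simp
      ultimately show ?thesis
        using regulator_matrix_change_basis[OF k _ True, of \<eta> S \<alpha> A] A by (simp add: abs_mult)
    qed
    also have "\<dots> \<le> (\<Prod>j<r. real (field_degree TYPE('a)) * height (\<alpha> j))"
      by (rule regulator_matrix_det_le[OF k S vs True \<alpha>])
    finally show ?thesis .
  next
    case False
    \<comment> \<open>\<open>det\<close> of a matrix that is not square is 0 by definition, so the
      claim reduces to nonnegativity of the right-hand side.\<close>
    then have "S_regulator S = 0" unfolding R r' by (simp add: det_def regulator_matrix_def)
    moreover have "0 \<le> (\<Prod>j<r. real (field_degree TYPE('a)) * height (\<alpha> j))"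
    proof (intro prod_nonneg ballI)
      fix j assume "j \<in> {..<r}"
      then obtain x where x: "x \<in> carrier (S_units S)" "\<alpha> j = torsion_subgroup (S_units S) #>\<^bsub>S_units S\<^esub> x"
        using \<alpha>[of j] by (auto simp: carrier_free_S_units[OF k])
      have "real (field_degree TYPE('a)) * height (\<alpha> j) = (\<Sum>v\<in>S. max 0 (real (local_degree v) * ln (v x)))"
        using weil_height_S_unit[OF k S(1,2) x(1)] height_unit_class[OF k x(1)] x(2) by simp
      then show "0 \<le> real (field_degree TYPE('a)) * height (\<alpha> j)" by (simp add: sum_nonneg)
    qed
    ultimately show ?thesis by simp
  qed
qed

end
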